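(* Let $d\ge 1$ and $s\ge 2$ be integers. There exists a constant $c_0=c_0(d,s)>0$ such that the following holds. For all integers $N$ large enough depending only on $d$ and $s$, for every real polynomial $g(n)=\sum_{j=0}^d\beta_jn^j$ of degree $d$, let $$S_N=\frac1{\sqrt N}\sum_{n\le N}f(n)\,e(g(n)),$$ where $f$ is a Steinhaus random multiplicative function. Then for every $\delta$ with $N^{-c_0}<\delta<1/8$, at least one of the following holds: (1) $$\Big|\mathbb{E}|S_N|^{2s}-s!\Big|\ll_{d,s}\delta(\log N)^{O(s^2)}.$$ (2) There exists $q\in\mathbb{Z}\setminus\{0\}$ with $|q|\ll_d\delta^{-O_d(1)}$ such that $\|qg\|_{C^\infty[N]}\ll_d\delta^{-O_d(1)}$.
   Context: Notation: $e(x)=\exp(2\pi i x)$; $\|x\|_{\mathbb{R}/\mathbb{Z}}$ is the distance from $x\in\mathbb R$ to the nearest integer. Sums $\sum_{n\le N}$ run over positive integers $n\le N$. Steinhaus random multiplicative function: let $\{f(p)\}_{p\text{ prime}}$ be independent random variables, each uniformly distributed on the complex unit circle, and extend to all natural numbers by complete multiplicativity, $f(n)=\prod_{p^k\parallel n}f(p)^k$, where $p^k\parallel n$ means $p^k$ is the highest power of $p$ dividing $n$. Smoothness norm: for a real polynomial $g(n)=\sum_{j=0}^d\beta_jn^j$ and $N\ge1$, $\|g\|_{C^\infty[N]}:=\max_{1\le j\le d}N^j\|\beta_j\|_{\mathbb{R}/\mathbb{Z}}$. Asymptotic notation: $X\ll Y$ or $X=O(Y)$ means $|X|\le C|Y|$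 with $C$ an absolute constant; subscripts indicate the parameters on which the constant may depend. Exponents written $O(s^2)$, $O_d(1)$ are quantities bounded by an absolute constant times $s^2$, respectively by a constant depending only on $d$. In particular no implied constant depends on $g$, $N$ or $\delta$. *)

theory Defs
  imports
    "HOL-Probability.Probability"
    "HOL-Computational_Algebra.Computational_Algebra"
begin

definition unit_exp :: "real \<Rightarrow> complex" where
  "unit_exp x = exp (2 * complex_of_real pi * \<i> * complex_of_real x)"

definition dist_to_int :: "real \<Rightarrow> real" where
  "dist_to_int x = infdist x \<int>"

text \<open>Only meaningful for nonconstant polynomials: for a constant one the maximum is over the empty set.\<close>

definition smoothness_norm :: "real \<Rightarrow> real poly \<Rightarrow> real" where
  "smoothness_norm N g = Max ((\<lambda>j. N ^ j * dist_to_int (coeff g j)) ` {1..degree g})"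

definition uniform_circle :: "complex measure" where
  "uniform_circle = distr (uniform_measure lborel {0..<1}) borel unit_exp"

text \<open>
  The values at the primes determine the values at all positive integers; the value at 0 is
  left unspecified.
\<close>

definition steinhaus :: "'a measure \<Rightarrow> (nat \<Rightarrow> 'a \<Rightarrow> complex) \<Rightarrow> bool" where
  "steinhaus M f \<longleftrightarrow>
     prob_space M \<and>
     prob_space.indep_vars M (\<lambda>_. borel) f {p. prime p} \<and>
     (\<forall>p. prime p \<longrightarrow> distr M borel (f p) = uniform_circle) \<and>
     (\<forall>n>0. \<forall>\<omega>\<in>space M. f n \<omega> = (\<Prod>p\<in>prime_factors n. f p \<omega> ^ multiplicity p n))"

definition normalized_sum ::
  "(nat \<Rightarrow> 'a \<Rightarrow> complex) \<Rightarrow> real poly \<Rightarrow> nat \<Rightarrow> 'a \<Rightarrow> complex" where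
  "normalized_sum f g N \<omega> =
     complex_of_real (1 / sqrt (real N)) * (\<Sum>n=1..N. f n \<omega> * unit_exp (poly g (real n)))"

lemma unit_exp_measurable: "unit_exp \<in> borel_measurable borel"
  unfolding unit_exp_def by measurable

lemma prob_space_uniform_circle: "prob_space uniform_circle"
proof -
  have "prob_space (uniform_measure lborel {0..<1::real})"
    by (rule prob_space_uniform_measure) auto
  moreover have "unit_exp \<in> measurable (uniform_measure lborel {0..<1}) borel"
    using unit_exp_measurable by (simp add: measurable_def)
  ultimately show ?thesis
    unfolding uniform_circle_def by (rule prob_space.prob_space_distr)
qed

lemma steinhaus_exists: "\<exists>(M :: (nat \<Rightarrow> complex) measure) f. steinhaus M f"
proof -
  let ?P = "{p::nat. prime p}"
  define M where "M = PiM ?P (\<lambda>_. uniform_circle)"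
  define f where "f n \<omega> = (\<Prod>p\<in>prime_factors n. \<omega> p ^ multiplicity p n)"
    for n and \<omega> :: "nat \<Rightarrow> complex"
  interpret C: prob_space uniform_circle by (rule prob_space_uniform_circle)
  interpret product_prob_space "\<lambda>_. uniform_circle" ?P ..
  have S: "sets uniform_circle = sets borel" by (simp add: uniform_circle_def)
  have f_prime: "f p = (\<lambda>\<omega>. \<omega> p)" if "prime p" for p
    using that by (simp add: fun_eq_iff f_def prime_factorization_prime)
  have M: "prob_space M" unfolding M_def by (rule prob_space_PiM) (rule C.prob_space_axioms)
  have law: "distr M borel (\<lambda>\<omega>. \<omega> p) = uniform_circle" if "prime p" for p
  proof -
    have "distr M borel (\<lambda>\<omega>. \<omega> p) = distr M uniform_circle (\<lambda>\<omega>. \<omega> p)"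
      by (rule distr_cong) (auto simp: S)
    also have "\<dots> = uniform_circle"
      unfolding M_def using that by (intro PiM_component) auto
    finally show ?thesis .
  qed
  have rv: "(\<lambda>\<omega>. \<omega> p) \<in> measurable M borel" if "prime p" for p
  proof -
    have "(\<lambda>\<omega>. \<omega> p) \<in> measurable M uniform_circle"
      unfolding M_def using that by (intro measurable_component_singleton) auto
    then show ?thesis by (simp add: measurable_cong_sets[OF refl S])
  qed
  interpret M: prob_space M by (rule M)
  have "M.indep_vars (\<lambda>_. borel) (\<lambda>p \<omega>. \<omega> p) ?P"
  proof (subst M.indep_vars_iff_distr_eq_PiM')
    show "?P \<noteq> {}" using two_is_prime_nat by blast
    show "\<And>i. i \<in> ?P \<Longrightarrow> M.random_variable borel (\<lambda>\<omega>. \<omega> i)" using rv by blast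
    have SM: "sets (PiM ?P (\<lambda>_. borel)) = sets M"
      unfolding M_def by (rule sets_PiM_cong) (simp_all add: S)
    have "(\<lambda>i\<in>?P. x i) = x" if "x \<in> space M" for x
      using that unfolding M_def space_PiM PiE_def
      by (intro extensional_restrict) blast
    then have "distr M (PiM ?P (\<lambda>_. borel)) (\<lambda>x. \<lambda>i\<in>?P. x i) = distr M M (\<lambda>x. x)"
      by (intro distr_cong SM refl)
    also have "\<dots> = PiM ?P (\<lambda>_. uniform_circle)" by (simp add: M_def)
    also have "\<dots> = PiM ?P (\<lambda>i. distr M borel (\<lambda>\<omega>. \<omega> i))"
      by (rule PiM_cong) (auto simp: law)
    finally show "distr M (PiM ?P (\<lambda>_. borel)) (\<lambda>x. \<lambda>i\<in>?P. x i) =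
      PiM ?P (\<lambda>i. distr M borel (\<lambda>\<omega>. \<omega> i))" .
  qed
  then have "M.indep_vars (\<lambda>_. borel) f ?P"
    by (subst M.indep_vars_cong[where Y = "\<lambda>p \<omega>. \<omega> p"]) (auto simp: f_prime)
  moreover have "\<forall>p. prime p \<longrightarrow> distr M borel (f p) = uniform_circle"
    using law by (simp add: f_prime)
  moreover have "f n \<omega> = (\<Prod>p\<in>prime_factors n. f p \<omega> ^ multiplicity p n)" for n \<omega>
    unfolding f_def[of n] by (rule prod.cong) (simp_all add: f_prime in_prime_factors_iff)
  ultimately have "steinhaus M f"
    unfolding steinhaus_def using M by blast
  then show ?thesis by blast
qed

end

theory Submission
  imports Defs
begin

text \<open>
Write \<open>a n = e(g(n))\<close>. The values of a Steinhaus function are orthonormal, so the \<open>2s\<close>-th moment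
of the unnormalised sum is a weighted count of the solutions of \<open>n\<^sub>1 \<cdots> n\<^sub>s = m\<^sub>1 \<cdots> m\<^sub>s\<close> with all
entries at most \<open>N\<close>, the weight being the phase \<open>a(n\<^sub>1) \<cdots> a(n\<^sub>s)\<close> times the conjugate of
\<open>a(m\<^sub>1) \<cdots> a(m\<^sub>s)\<close> (\<open>expectation_eq_moment\<close>). Permutations give the main term \<open>s! N\<^sup>s\<close>. All other
solutions together are more numerous by a power of \<open>log N\<close>, so their phases have to cancel.

The count \<open>T(k)\<close> for \<open>k\<close>-tuples is treated through \<open>T(k+1) = (k+1) N T(k) + error\<close>. The entry
\<open>n = n\<^sub>1\<close> divides the product of the \<open>m\<^sub>j\<close>, hence, unless \<open>n\<close> is small, some \<open>gcd(n, m\<^sub>j)\<close> is at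
least \<open>Y\<close>, a fixed small power of \<open>N\<close>. By symmetry this entry may be taken to be \<open>m = m\<^sub>1\<close>; dividing
by the number of entries with a large gcd makes up for the choice (\<open>moment_Suc_split\<close>). The
terms with \<open>n = m\<close> produce \<open>(k+1) N T(k)\<close>, because two entries rarely share a large factor.
For \<open>n \<noteq> m\<close> write \<open>n = u h\<close> and \<open>m = v h\<close> with \<open>u\<close>, \<open>v\<close> coprime. The other entries only determine
\<open>u / v\<close>, so \<open>h\<close> runs freely over \<open>Y \<le> h \<le> N / max u v\<close>, up to the factor by which the choice of \<open>m\<close>
was compensated. That factor depends on \<open>h\<close> only through its gcd with the product of the other
entries, and expanding it over the divisors \<open>e\<close> of that gcd (\<open>inner_sum_bound\<close>) leaves sums of
\<open>e(g(e u l) - g(e v l))\<close> over intervals of \<open>l\<close>.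

Such a sum saves the factor \<open>R = 1 / \<delta>\<close> unless the triple \<open>(e, u, v)\<close> is exceptional. If the
exceptional triples have density at most \<open>R\<^sup>-\<^sup>2\<close> in every box, then by Cauchy-Schwarz and moments
of divisor functions they contribute \<open>\<delta>\<close> times a power of \<open>log N\<close>, and the first alternative
holds. If some box has more of them (\<open>box_inverse_theorem\<close>), then Weyl's inequality, applied to
each exceptional triple, shows that one \<open>q\<close> of size \<open>R\<^sup>O\<^sup>(\<^sup>1\<^sup>)\<close> brings \<open>q \<beta>\<^sub>j e\<^sup>j (u\<^sup>j - v\<^sup>j)\<close> close to the
integers for a positive proportion of the box. A monomial that is close to the integers so often
has a nearly rational coefficient; using this for \<open>e\<close> and then for \<open>u\<close> isolates \<open>\<beta>\<^sub>j\<close>, and the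
second alternative holds.

Losses are recorded throughout as powers of a parameter \<open>R \<ge> 2\<close>, so that absolute constants
disappear in the exponents. The exponents of \<open>R\<close> depend only on the degree.
\<close>

section \<open>Distance to the nearest integer\<close>

lemma dist_to_int_eq_round: "dist_to_int x = \<bar>x - of_int (round x)\<bar>"
proof -
  have "dist_to_int x \<le> \<bar>x - of_int (round x)\<bar>"
    unfolding dist_to_int_def
    using infdist_le[of "of_int (round x)" \<int> x] by (simp add: dist_real_def)
  moreover have "\<bar>x - of_int (round x)\<bar> \<le> dist_to_int x"
    unfolding dist_to_int_def
  proof (subst infdist_notempty)
    show "(\<int>::real set) \<noteq> {}" using Ints_0 by blast
    show "\<bar>x - of_int (round x)\<bar> \<le> (INF a\<in>\<int>. dist x a)"
    proof (rule cINF_greatest)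
      show "(\<int>::real set) \<noteq> {}" using Ints_0 by blast
      fix a :: real assume "a \<in> \<int>"
      then obtain m where "a = of_int m" by (auto elim: Ints_cases)
      then show "\<bar>x - of_int (round x)\<bar> \<le> dist x a"
        using round_diff_minimal[of x m] by (simp add: dist_real_def)
    qed
  qed
  ultimately show ?thesis by simp
qed

lemma dist_to_int_le: "dist_to_int x \<le> \<bar>x - of_int m\<bar>"
  by (simp add: dist_to_int_eq_round round_diff_minimal)

lemma dist_to_int_nonneg [simp]: "dist_to_int x \<ge> 0"
  by (simp add: dist_to_int_eq_round)

lemma dist_to_int_le_half: "dist_to_int x \<le> 1/2"
  using of_int_round_abs_le[of x] by (simp add: dist_to_int_eq_round abs_minus_commute)

lemma dist_to_int_0 [simp]: "dist_to_int 0 = 0"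
  by (simp add: dist_to_int_eq_round)

lemma dist_to_int_obtain:
  obtains m :: int where "dist_to_int x = \<bar>x - of_int m\<bar>"
  using dist_to_int_eq_round by blast

lemma dist_to_int_add: "dist_to_int (x + y) \<le> dist_to_int x + dist_to_int y"
  using dist_to_int_le[of "x + y" "round x + round y"]
  by (simp add: dist_to_int_eq_round[of x] dist_to_int_eq_round[of y])

lemma dist_to_int_minus [simp]: "dist_to_int (- x) = dist_to_int x"
proof -
  have "dist_to_int (- y) \<le> dist_to_int y" for y
    using dist_to_int_le[of "- y" "- round y"] by (simp add: dist_to_int_eq_round[of y])
  from this[of x] this[of "-x"] show ?thesis by simp
qed

lemma dist_to_int_diff: "dist_to_int (x - y) \<le> dist_to_int x + dist_to_int y"
  using dist_to_int_add[of x "-y"] by simp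

lemma dist_to_int_mult_int: "dist_to_int (of_int k * x) \<le> \<bar>of_int k\<bar> * dist_to_int x"
proof -
  have "dist_to_int (of_int k * x) \<le> \<bar>of_int k * x - of_int (k * round x)\<bar>"
    by (rule dist_to_int_le)
  also have "of_int k * x - of_int (k * round x) = of_int k * (x - of_int (round x))"
    by (simp add: algebra_simps)
  finally show ?thesis by (simp add: dist_to_int_eq_round[of x] abs_mult)
qed

lemma dist_to_int_mult_nat: "dist_to_int (of_nat k * x) \<le> of_nat k * dist_to_int x"
  using dist_to_int_mult_int[of "int k" x] by simp

lemma dist_to_int_add_int [simp]: "dist_to_int (x + of_int m) = dist_to_int x"
proof -
  have "dist_to_int (y + of_int k) \<le> dist_to_int y" for y k
    using dist_to_int_le[of "y + of_int k" "round y + k"] by (simp add: dist_to_int_eq_round[of y])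
  from this[of x m] this[of "x + of_int m" "-m"] show ?thesis by simp
qed

lemma dist_to_int_small: "\<bar>x\<bar> \<le> 1/2 \<Longrightarrow> dist_to_int x = \<bar>x\<bar>"
proof -
  assume a: "\<bar>x\<bar> \<le> 1/2"
  have "\<bar>x\<bar> \<le> \<bar>x - of_int m\<bar>" for m :: int
  proof (cases "m = 0")
    case False
    then have "\<bar>of_int m :: real\<bar> \<ge> 1" by linarith
    then show ?thesis using a by linarith
  qed auto
  then show ?thesis using dist_to_int_le[of x 0] by (simp add: dist_to_int_eq_round)
      (metis antisym)
qed

section \<open>Tuples, averaging and pigeonholing\<close>

definition tuples :: "'a set \<Rightarrow> nat \<Rightarrow> 'a list set" where
  "tuples A k = {xs. set xs \<subseteq> A \<and> length xs = k}"

lemma finite_tuples [simp, intro]: "finite A \<Longrightarrow> finite (tuples A k)"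
  unfolding tuples_def by (rule finite_lists_length_eq)

lemma card_tuples: "finite A \<Longrightarrow> card (tuples A k) = card A ^ k"
  unfolding tuples_def by (rule card_lists_length_eq)

lemma tuples_0 [simp]: "tuples A 0 = {[]}"
  by (auto simp: tuples_def)

lemma tuples_Suc: "tuples A (Suc k) = (\<lambda>(x, xs). x # xs) ` (A \<times> tuples A k)"
  by (auto simp: tuples_def length_Suc_conv image_iff)

lemma inj_Cons_pair: "inj_on (\<lambda>(x, xs). x # xs) S"
  by (auto simp: inj_on_def)

lemma sum_tuples_Suc:
  "(\<Sum>xs\<in>tuples A (Suc k). F xs) = (\<Sum>x\<in>A. \<Sum>xs\<in>tuples A k. F (x # xs))"
  unfolding tuples_Suc
  by (subst sum.reindex[OF inj_Cons_pair]) (simp add: sum.cartesian_product case_prod_unfold)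

text \<open>
The fibres with fewer than \<open>|B| / (2R)\<close> points hold at most half of the points that are counted,
so the others have to be numerous.
\<close>
lemma popular_fibres:
  fixes R :: real
  assumes fin: "finite A" "finite B" and ne: "B \<noteq> {}" and R: "R > 0"
    and count: "real (card {(a, b). a \<in> A \<and> b \<in> B \<and> P a b}) \<ge> real (card A) * real (card B) / R"
  shows "real (card {a \<in> A. real (card {b \<in> B. P a b}) \<ge> real (card B) / (2 * R)})
           \<ge> real (card A) / (2 * R)"
proof -
  define G where "G = {a \<in> A. real (card {b \<in> B. P a b}) \<ge> real (card B) / (2 * R)}"
  have "{(a, b). a \<in> A \<and> b \<in> B \<and> P a b} = (SIGMA a:A. {b \<in> B. P a b})" by auto
  then have "real (card {(a, b). a \<in> A \<and> b \<in> B \<and> P a b}) = (\<Sum>a\<in>A. real (card {b \<in> B. P a b}))"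
    using fin by (simp add: card_SigmaI)
  also have "\<dots> \<le> (\<Sum>a\<in>A. real (card B) * of_bool (a \<in> G) + real (card B) / (2 * R))"
  proof (rule sum_mono)
    fix a assume a: "a \<in> A"
    have "card {b \<in> B. P a b} \<le> card B" using fin by (intro card_mono) auto
    then show "real (card {b \<in> B. P a b}) \<le> real (card B) * of_bool (a \<in> G) + real (card B) / (2 * R)"
      using R a by (auto simp: G_def add_increasing2)
  qed
  also have "\<dots> = real (card B) * real (card G) + real (card A) * (real (card B) / (2 * R))"
  proof -
    have "(\<Sum>a\<in>A. of_bool (a \<in> G)) = real (card G)"
      using fin by (simp add: sum_of_bool_eq G_def Collect_conj_eq[symmetric] Int_def)
    then show ?thesis by (simp add: sum.distrib flip: sum_distrib_left)
  qed
  finally have "real (card A) * real (card B) / R \<le> real (card B) * real (card G) + real (card A) * (real (card B) / (2 * R))"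
    using count by linarith
  then have "real (card B) * (real (card A) / (2 * R)) \<le> real (card B) * real (card G)"
    using R by (simp add: field_simps)
  moreover have "card B > 0" using fin ne by (simp add: card_gt_0_iff)
  ultimately show ?thesis unfolding G_def[symmetric]
    using mult_le_cancel_left_pos[of "real (card B)" "real (card A) / (2 * R)" "real (card G)"]
      of_nat_0_less_iff by blast
qed

lemma pigeonhole_value:
  fixes f :: "'a \<Rightarrow> nat" and X :: real
  assumes fin: "finite A" and f: "\<And>a. a \<in> A \<Longrightarrow> 1 \<le> f a \<and> real (f a) \<le> X" and ne: "X \<ge> 1"
  obtains q where "1 \<le> q" "real q \<le> X" "real (card {a \<in> A. f a = q}) \<ge> real (card A) / X"
proof -
  define m where "m = nat \<lfloor>X\<rfloor>"
  have m: "real m \<le> X" "m \<ge> 1" and fm: "f a \<in> {1..m}" if "a \<in> A" for a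
    using ne f[OF that] by (auto simp: m_def le_nat_iff le_floor_iff)
  show ?thesis
  proof (rule ccontr)
    assume "\<not> thesis"
    with that have neg: "real (card {a \<in> A. f a = q}) < real (card A) / X" if "q \<in> {1..m}" for q
      using that m_def ne by (force simp: le_nat_iff le_floor_iff)
    have m1: "m \<ge> 1" "real m \<le> X" using ne by (auto simp: m_def le_nat_iff le_floor_iff)
    have "A = (\<Union>q\<in>{1..m}. {a \<in> A. f a = q})" using fm by auto
    then have "card A \<le> (\<Sum>q\<in>{1..m}. card {a \<in> A. f a = q})"
      using card_UN_le[of "{1..m}" "\<lambda>q. {a \<in> A. f a = q}"] by simp
    then have "real (card A) \<le> (\<Sum>q\<in>{1..m}. real (card {a \<in> A. f a = q}))"
      by (metis of_nat_le_iff of_nat_sum)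
    also have "\<dots> < (\<Sum>q\<in>{1..m}. real (card A) / X)"
      using neg m1 by (intro sum_strict_mono) auto
    also have "\<dots> = real m * (real (card A) / X)" by simp
    also have "\<dots> \<le> X * (real (card A) / X)" using m1 ne by (intro mult_right_mono) auto
    finally show False using ne by simp
  qed
qed

lemma card_le_diameter:
  fixes T :: "nat set"
  assumes "finite T" "D \<ge> 0" "\<And>a b. a \<in> T \<Longrightarrow> b \<in> T \<Longrightarrow> a \<le> b \<Longrightarrow> real (b - a) \<le> D"
  shows "real (card T) \<le> D + 1"
proof (cases "T = {}")
  case False
  have "T \<subseteq> {Min T..Min T + nat \<lfloor>D\<rfloor>}"
  proof
    fix b assume b: "b \<in> T"
    have "Min T \<le> b" "Min T \<in> T" using assms(1) b False by auto
    with assms(3)[of "Min T" b] b assms(2) show "b \<in> {Min T..Min T + nat \<lfloor>D\<rfloor>}"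
      by (simp add: le_nat_iff le_floor_iff flip: le_diff_conv2) linarith
  qed
  from card_mono[OF _ this] have "card T \<le> nat \<lfloor>D\<rfloor> + 1" by simp
  then show ?thesis using assms(2) by linarith
qed (use assms in auto)

section \<open>Numbers with many multiples close to the integers\<close>

text \<open>
Since \<open>S\<close> is dense, two elements of \<open>S \<union> {0}\<close> differ by some \<open>q \<le> R\<close>, and \<open>\<alpha> q = p + \<sigma>\<close> with \<open>p\<close> an
integer and \<open>\<bar>\<sigma>\<bar> \<le> 2\<epsilon>\<close>. Then \<open>h \<sigma>\<close> is within \<open>R \<epsilon>\<close> of an integer for each \<open>h\<close> in \<open>S\<close>. If \<open>H \<bar>\<sigma>\<bar> \<le> 1/2\<close>,
the integer is \<open>0\<close> and the largest element of \<open>S\<close> bounds \<open>\<sigma>\<close>. Otherwise the multiples of \<open>\<sigma>\<close> run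
around the circle in steps of at most \<open>2\<epsilon>\<close> and are near the integers too rarely for \<open>S\<close>.
\<close>
lemma vinogradov_linear:
  fixes \<alpha> \<epsilon> R :: real and H :: nat
  assumes R: "R \<ge> 2" and H: "H \<ge> 1" and S: "S \<subseteq> {1..H}" and card: "real (card S) \<ge> real H / R"
    and near: "\<And>h. h \<in> S \<Longrightarrow> dist_to_int (\<alpha> * real h) \<le> \<epsilon>" and small: "20 * R\<^sup>2 * \<epsilon> \<le> 1"
  obtains q where "1 \<le> q" "real q \<le> R" "dist_to_int (\<alpha> * real q) \<le> R\<^sup>2 * \<epsilon> / real H"
proof -
  have fS: "finite S" using S finite_subset by blast
  have "card S > 0" using card H R by (metis divide_pos_pos gr0I less_eq_real_def not_less of_nat_0
    of_nat_0_less_iff order_less_le_trans zero_less_numeral zero_less_one)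
  then obtain h0 where h0: "h0 \<in> S" by (metis card.empty equals0I less_irrefl)
  have e0: "\<epsilon> \<ge> 0" using near[OF h0] dist_to_int_nonneg order_trans by blast
  define r where "r = nat \<lfloor>R\<rfloor>"
  have r: "real r \<le> R" "R < real (r + 1)" using R unfolding r_def by linarith+
  \<comment> \<open>The elements of S and 0 are too many to lie in different blocks of length r + 1.\<close>
  have "\<not> inj_on (\<lambda>h. h div (r + 1)) (insert 0 S)"
  proof
    assume inj: "inj_on (\<lambda>h. h div (r + 1)) (insert 0 S)"
    have "(\<lambda>h. h div (r + 1)) ` (insert 0 S) \<subseteq> {0..H div (r + 1)}"
      using S by (auto intro!: div_le_mono)
    from card_inj_on_le[OF inj this] have "card (insert 0 S) \<le> H div (r + 1) + 1" by simp
    then have "card S \<le> H div (r + 1)" using S fS by (subst (asm) card_insert_disjoint) auto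
    then have "real (card S) \<le> real H / real (r + 1)"
      using of_nat_mono of_nat_div_le_of_nat order_trans by blast
    also have "\<dots> < real H / R" using r R H by (intro divide_strict_left_mono) auto
    finally show False using card by linarith
  qed
  then obtain a b where ab: "a \<in> insert 0 S" "b \<in> insert 0 S" "a < b" "a div (r + 1) = b div (r + 1)"
    unfolding inj_on_def by (metis nat_neq_iff)
  define k where "k = b - a"
  have k: "1 \<le> k" "k \<le> r"
  proof -
    show "1 \<le> k" using ab by (simp add: k_def)
    have "b < (r + 1) + (b div (r+1)) * (r+1)" by (rule dividend_less_div_times) simp
    moreover have "(a div (r+1)) * (r+1) \<le> a" by (rule div_times_less_eq_dividend)
    ultimately show "k \<le> r" unfolding k_def ab(4) by linarith
  qed
  have near0: "dist_to_int (\<alpha> * real h) \<le> \<epsilon>" if "h \<in> insert 0 S" for h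
    using that near e0 by auto
  have "\<alpha> * real k = \<alpha> * real b - \<alpha> * real a" using ab(3) by (simp add: k_def of_nat_diff algebra_simps)
  then have near_k: "dist_to_int (\<alpha> * real k) \<le> 2 * \<epsilon>"
    using dist_to_int_diff[of "\<alpha> * real b" "\<alpha> * real a"] near0[OF ab(1)] near0[OF ab(2)] by simp
  define p where "p = round (\<alpha> * real k)"
  define \<sigma> where "\<sigma> = \<alpha> * real k - of_int p"
  have s: "dist_to_int (\<alpha> * real k) = \<bar>\<sigma>\<bar>" by (simp add: dist_to_int_eq_round \<sigma>_def p_def)
  have kR: "real k \<le> R" using k r by linarith
  define \<kappa> where "\<kappa> = R * \<epsilon>"
  have \<kappa>: "dist_to_int (real h * \<sigma>) \<le> \<kappa>" if "h \<in> S" for h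
  proof -
    have "real h * \<sigma> = of_nat k * (\<alpha> * real h) + of_int (- (int h * p))"
      by (simp add: \<sigma>_def algebra_simps)
    then have "dist_to_int (real h * \<sigma>) = dist_to_int (of_nat k * (\<alpha> * real h))"
      by (metis dist_to_int_add_int)
    also have "\<dots> \<le> real k * dist_to_int (\<alpha> * real h)" by (rule dist_to_int_mult_nat)
    also have "\<dots> \<le> R * \<epsilon>" using near[OF that] kR R by (intro mult_mono) auto
    finally show ?thesis by (simp add: \<kappa>_def)
  qed
  have "\<bar>\<sigma>\<bar> \<le> R\<^sup>2 * \<epsilon> / real H"
  proof (cases "real H * \<bar>\<sigma>\<bar> \<le> 1/2")
    case True
    have "S \<subseteq> {1..Max S}" using S fS by auto
    from card_mono[OF _ this] have "card S \<le> Max S" by simp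
    then have m: "real H / R \<le> real (Max S)" using card by linarith
    have mS: "Max S \<in> S" using fS h0 by (intro Max_in) auto
    have "\<bar>real (Max S) * \<sigma>\<bar> \<le> 1/2"
    proof -
      have "real (Max S) * \<bar>\<sigma>\<bar> \<le> real H * \<bar>\<sigma>\<bar>" using mS S by (intro mult_right_mono) auto
      then show ?thesis using True by (simp add: abs_mult)
    qed
    from dist_to_int_small[OF this] \<kappa>[OF mS] have "real (Max S) * \<bar>\<sigma>\<bar> \<le> \<kappa>" by (simp add: abs_mult)
    moreover have "real H / R * \<bar>\<sigma>\<bar> \<le> real (Max S) * \<bar>\<sigma>\<bar>" using m by (intro mult_right_mono) auto
    ultimately have "real H / R * \<bar>\<sigma>\<bar> \<le> R * \<epsilon>" unfolding \<kappa>_def by linarith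
    then show ?thesis using R H by (simp add: field_simps power2_eq_square)
  next
    case False
    then have sp: "\<bar>\<sigma>\<bar> > 0" by (metis abs_ge_zero less_eq_real_def mult_zero_right zero_le_divide_1_iff zero_le_numeral)
    \<comment> \<open>The integers that some multiple of \<sigma> up to H can be close to.\<close>
    define W where "W = {z::int. \<bar>real_of_int z\<bar> \<le> real H * \<bar>\<sigma>\<bar> + 1/2}"
    define w where "w = \<lfloor>real H * \<bar>\<sigma>\<bar> + 1/2\<rfloor>"
    have Wsub: "W = {-w..w}" unfolding W_def w_def by (auto simp: abs_le_iff le_floor_iff) linarith+
    have w0: "w \<ge> 0" unfolding w_def by simp
    have cW: "real (card W) \<le> 6 * (real H * \<bar>\<sigma>\<bar>)"
    proof -
      have "real (card W) = 2 * real_of_int w + 1" unfolding Wsub using w0 by simp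
      moreover have "real_of_int w \<le> real H * \<bar>\<sigma>\<bar> + 1/2" unfolding w_def by linarith
      ultimately show ?thesis using False by linarith
    qed
    have cover: "S \<subseteq> (\<Union>z\<in>W. {h \<in> S. round (real h * \<sigma>) = z})"
    proof
      fix h assume h: "h \<in> S"
      have "\<bar>real_of_int (round (real h * \<sigma>))\<bar> \<le> \<bar>real h * \<sigma>\<bar> + 1/2"
        using of_int_round_abs_le[of "real h * \<sigma>"] by linarith
      moreover have "\<bar>real h * \<sigma>\<bar> \<le> real H * \<bar>\<sigma>\<bar>" using h S by (auto simp: abs_mult intro!: mult_right_mono)
      ultimately have "round (real h * \<sigma>) \<in> W" unfolding W_def by simp
      then show "h \<in> (\<Union>z\<in>W. {h \<in> S. round (real h * \<sigma>) = z})" using h by auto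
    qed
    have each: "real (card {h \<in> S. round (real h * \<sigma>) = z}) \<le> 2 * \<kappa> / \<bar>\<sigma>\<bar> + 1" for z
    proof (rule card_le_diameter)
      show "finite {h \<in> S. round (real h * \<sigma>) = z}" using fS by simp
      show "2 * \<kappa> / \<bar>\<sigma>\<bar> \<ge> 0" using e0 R by (simp add: \<kappa>_def)
      fix a b assume a: "a \<in> {h \<in> S. round (real h * \<sigma>) = z}" and b: "b \<in> {h \<in> S. round (real h * \<sigma>) = z}" and le: "a \<le> b"
      have "\<bar>real a * \<sigma> - z\<bar> \<le> \<kappa>" "\<bar>real b * \<sigma> - z\<bar> \<le> \<kappa>"
        using a b \<kappa>[of a] \<kappa>[of b] by (auto simp: dist_to_int_eq_round)
      then have "\<bar>real b * \<sigma> - real a * \<sigma>\<bar> \<le> 2 * \<kappa>" by linarith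
      moreover have "\<bar>real b * \<sigma> - real a * \<sigma>\<bar> = real (b - a) * \<bar>\<sigma>\<bar>"
        using le by (simp add: abs_mult of_nat_diff flip: left_diff_distrib)
      ultimately show "real (b - a) \<le> 2 * \<kappa> / \<bar>\<sigma>\<bar>" using sp by (simp add: field_simps)
    qed
    have fW: "finite W" unfolding Wsub by simp
    have "card S \<le> card (\<Union>z\<in>W. {h \<in> S. round (real h * \<sigma>) = z})"
      using cover fW fS by (intro card_mono) auto
    also have "\<dots> \<le> (\<Sum>z\<in>W. card {h \<in> S. round (real h * \<sigma>) = z})"
      by (rule card_UN_le[OF fW])
    finally have "real (card S) \<le> (\<Sum>z\<in>W. real (card {h \<in> S. round (real h * \<sigma>) = z}))"
      by (metis of_nat_le_iff of_nat_sum)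
    also have "\<dots> \<le> (\<Sum>z\<in>W. 2 * \<kappa> / \<bar>\<sigma>\<bar> + 1)" by (intro sum_mono each)
    also have "\<dots> = real (card W) * (2 * \<kappa> / \<bar>\<sigma>\<bar> + 1)" by simp
    also have "\<dots> \<le> 6 * (real H * \<bar>\<sigma>\<bar>) * (2 * \<kappa> / \<bar>\<sigma>\<bar> + 1)"
      using cW e0 R by (intro mult_right_mono) (auto simp: \<kappa>_def intro!: add_nonneg_nonneg divide_nonneg_nonneg)
    also have "\<dots> = real H * (12 * (R * \<epsilon>) + 6 * \<bar>\<sigma>\<bar>)" using sp by (simp add: \<kappa>_def field_simps)
    also have "\<dots> \<le> real H * (18 * (R * \<epsilon>))"
    proof -
      have "\<bar>\<sigma>\<bar> \<le> 2 * \<epsilon>" using near_k s by simp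
      moreover have "2 * \<epsilon> \<le> R * \<epsilon>" using R e0 by (intro mult_right_mono) auto
      ultimately show ?thesis by (intro mult_left_mono) auto
    qed
    finally have "real H / R \<le> real H * (18 * (R * \<epsilon>))" using card by linarith
    then have "1 \<le> 18 * R\<^sup>2 * \<epsilon>" using H R by (simp add: field_simps power2_eq_square)
    moreover have "\<epsilon> > 0" using near_k s sp by linarith
    moreover have "R\<^sup>2 * \<epsilon> > 0" using R calculation(2) by simp
    ultimately show ?thesis using small by linarith
  qed
  then show ?thesis using that[of k] k kR s by simp
qed

text \<open>
Freezing all factors but one, the linear case supplies a multiplier \<open>q\<close> that depends on the frozen
factors. It has at most \<open>2R\<close> possible values, so a positive proportion of the frozen tuples share
it, and the claim for one factor less applies to \<open>q \<theta>\<close>.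
\<close>
lemma vinogradov_multilinear:
  "\<exists>C::nat. \<forall>R H \<theta> \<epsilon>. R \<ge> 2 \<and> H \<ge> 1 \<and> \<epsilon> \<ge> 0 \<and> \<epsilon> * R ^ C \<le> (1::real) \<and>
     real (card {hs \<in> tuples {1..H} j. dist_to_int (\<theta> * real (prod_list hs)) \<le> \<epsilon>}) \<ge> real H ^ j / R
     \<longrightarrow> (\<exists>q\<ge>1. real q \<le> R ^ C \<and> dist_to_int (\<theta> * real q) \<le> R ^ C * \<epsilon> / real H ^ j)"
proof (induction j)
  case 0
  show ?case
  proof (rule exI[of _ 0], intro allI impI)
    fix R H \<theta> \<epsilon> assume a: "R \<ge> 2 \<and> H \<ge> 1 \<and> \<epsilon> \<ge> 0 \<and> \<epsilon> * R ^ 0 \<le> (1::real) \<and>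
     real (card {hs \<in> tuples {1..H} 0. dist_to_int (\<theta> * real (prod_list hs)) \<le> \<epsilon>}) \<ge> real H ^ 0 / R"
    have "dist_to_int \<theta> \<le> \<epsilon>"
    proof (rule ccontr)
      assume "\<not> dist_to_int \<theta> \<le> \<epsilon>"
      then have "{hs \<in> tuples {1..H} 0. dist_to_int (\<theta> * real (prod_list hs)) \<le> \<epsilon>} = {}" by auto
      then have "real (card {hs \<in> tuples {1..H} 0. dist_to_int (\<theta> * real (prod_list hs)) \<le> \<epsilon>}) = 0"
        by (simp only: card.empty of_nat_0)
      with a have "real H ^ 0 / R \<le> 0" "R \<ge> 2" by argo+
      then show False by (simp add: field_simps)
    qed
    then show "\<exists>q\<ge>1. real q \<le> R ^ 0 \<and> dist_to_int (\<theta> * real q) \<le> R ^ 0 * \<epsilon> / real H ^ 0"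
      by (intro exI[of _ 1]) auto
  qed
next
  case (Suc j)
  then obtain C :: nat where C: "\<And>R H \<theta> \<epsilon>. R \<ge> 2 \<Longrightarrow> H \<ge> 1 \<Longrightarrow> \<epsilon> \<ge> 0 \<Longrightarrow> \<epsilon> * R ^ C \<le> (1::real) \<Longrightarrow>
     real (card {hs \<in> tuples {1..H} j. dist_to_int (\<theta> * real (prod_list hs)) \<le> \<epsilon>}) \<ge> real H ^ j / R
     \<Longrightarrow> (\<exists>q\<ge>1. real q \<le> R ^ C \<and> dist_to_int (\<theta> * real q) \<le> R ^ C * \<epsilon> / real H ^ j)" by blast
  show ?case
  proof (rule exI[of _ "4 * C + 9"], intro allI impI)
    fix R \<theta> \<epsilon> :: real and H :: nat
    let ?E = "4 * C + 9"
    assume a: "R \<ge> 2 \<and> H \<ge> 1 \<and> \<epsilon> \<ge> 0 \<and> \<epsilon> * R ^ ?E \<le> (1::real) \<and>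
     real (card {hs \<in> tuples {1..H} (Suc j). dist_to_int (\<theta> * real (prod_list hs)) \<le> \<epsilon>}) \<ge> real H ^ Suc j / R"
    then have R: "R \<ge> 2" and H: "H \<ge> 1" and e0: "\<epsilon> \<ge> 0" and small: "\<epsilon> * R ^ ?E \<le> 1" by auto
    have R4: "4 * R\<^sup>2 \<le> R ^ 4" "80 * R\<^sup>2 \<le> R ^ 9" "4 \<le> R ^ 2" "2 * R \<le> R ^ 2"
    proof -
      have "(2::real) ^ 2 \<le> R ^ 2" "(2::real) ^ 7 \<le> R ^ 7" using R by (intro power_mono; simp)+
      then show "4 \<le> R ^ 2" "4 * R\<^sup>2 \<le> R ^ 4" "80 * R\<^sup>2 \<le> R ^ 9"
        using mult_right_mono[of 4 "R^2" "R^2"] mult_right_mono[of 80 "R^7" "R^2"]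
        by (auto simp: power_add[symmetric])
      show "2 * R \<le> R ^ 2" using R by (simp add: power2_eq_square)
    qed
    define P where "P hs h \<longleftrightarrow> dist_to_int (\<theta> * real (prod_list (h # hs))) \<le> \<epsilon>" for hs and h :: nat
    define T where "T = {hs \<in> tuples {1..H} j. real (card {h \<in> {1..H}. P hs h}) \<ge> real (card {1..H}) / (2 * R)}"
    have "real (card T) \<ge> real (card (tuples {1..H} j)) / (2 * R)"
      unfolding T_def
    proof (rule popular_fibres)
      have "{hs \<in> tuples {1..H} (Suc j). dist_to_int (\<theta> * real (prod_list hs)) \<le> \<epsilon>}
        = (\<lambda>(hs, h). h # hs) ` {(hs, h). hs \<in> tuples {1..H} j \<and> h \<in> {1..H} \<and> P hs h}"
        by (auto simp: tuples_Suc P_def image_iff)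
      moreover have "inj_on (\<lambda>(hs, h). h # hs) {(hs, h). hs \<in> tuples {1..H} j \<and> h \<in> {1..H} \<and> P hs h}"
        by (auto simp: inj_on_def)
      ultimately have "card {hs \<in> tuples {1..H} (Suc j). dist_to_int (\<theta> * real (prod_list hs)) \<le> \<epsilon>}
        = card {(hs, h). hs \<in> tuples {1..H} j \<and> h \<in> {1..H} \<and> P hs h}" by (simp add: card_image)
      then show "real (card {(hs, h). hs \<in> tuples {1..H} j \<and> h \<in> {1..H} \<and> P hs h}) \<ge> real (card (tuples {1..H} j)) * real (card {1..H}) / R"
        using a by (simp add: card_tuples mult.commute)
    qed (use R H in auto)
    then have cT: "real (card T) \<ge> real H ^ j / (2 * R)" by (simp add: card_tuples)
    have "\<exists>q. 1 \<le> q \<and> real q \<le> 2 * R \<and> dist_to_int (\<theta> * real (prod_list hs) * real q) \<le> (2*R)\<^sup>2 * \<epsilon> / real H" if "hs \<in> T" for hs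
    proof -
      have "20 * (2 * R)\<^sup>2 * \<epsilon> \<le> 1"
      proof -
        have "20 * (2 * R)\<^sup>2 * \<epsilon> = 80 * R\<^sup>2 * \<epsilon>" by (simp add: power_mult_distrib)
        also have "\<dots> \<le> R ^ 9 * \<epsilon>" using R4 e0 by (intro mult_right_mono) auto
        also have "\<dots> \<le> R ^ ?E * \<epsilon>" using R e0 by (intro mult_right_mono power_increasing) auto
        finally show ?thesis using small by (simp add: mult.commute)
      qed
      note sm = this
      show ?thesis
      proof (rule vinogradov_linear[of "2 * R" H "{h \<in> {1..H}. P hs h}" "\<theta> * real (prod_list hs)" \<epsilon>])
        show "real (card {h \<in> {1..H}. P hs h}) \<ge> real H / (2 * R)" using that by (simp add: T_def)
        show "dist_to_int (\<theta> * real (prod_list hs) * real h) \<le> \<epsilon>" if "h \<in> {h \<in> {1..H}. P hs h}" for h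
          using that by (simp add: P_def mult.commute mult.left_commute)
      qed (use R H sm in auto)
    qed
    then obtain f where f: "\<And>hs. hs \<in> T \<Longrightarrow> 1 \<le> f hs \<and> real (f hs) \<le> 2 * R \<and> dist_to_int (\<theta> * real (prod_list hs) * real (f hs)) \<le> (2*R)\<^sup>2 * \<epsilon> / real H"
      by metis
    have fT: "finite T" unfolding T_def by simp
    obtain q where q: "1 \<le> q" "real q \<le> 2 * R" "real (card {hs \<in> T. f hs = q}) \<ge> real (card T) / (2 * R)"
      using pigeonhole_value[OF fT, of f "2 * R"] f R by force
    define \<epsilon>' where "\<epsilon>' = (2*R)\<^sup>2 * \<epsilon> / real H"
    have e': "0 \<le> \<epsilon>'" "\<epsilon>' \<le> R ^ 4 * \<epsilon> / real H"
      using R4 e0 H by (auto simp: \<epsilon>'_def power_mult_distrib intro!: divide_right_mono mult_right_mono)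
    have "\<exists>q'\<ge>1. real q' \<le> (R ^ 4) ^ C \<and> dist_to_int (\<theta> * real q * real q') \<le> (R ^ 4) ^ C * \<epsilon>' / real H ^ j"
    proof (rule C)
      show "R ^ 4 \<ge> 2" using R4 R by (smt (verit) mult_right_mono power2_eq_square)
      show "\<epsilon>' * (R ^ 4) ^ C \<le> 1"
      proof -
        have "\<epsilon>' * (R ^ 4) ^ C \<le> (R ^ 4 * \<epsilon> / real H) * (R ^ 4) ^ C"
          using e' R by (intro mult_right_mono) auto
        also have "\<dots> \<le> (R ^ 4 * \<epsilon>) * (R ^ 4) ^ C"
          using divide_left_mono[of 1 "real H" "R ^ 4 * \<epsilon>"] H R e0 by (intro mult_right_mono) auto
        also have "\<dots> = \<epsilon> * R ^ (4 * C + 4)" by (simp add: power_add power_mult)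
        also have "\<dots> \<le> \<epsilon> * R ^ ?E" using R e0 by (intro mult_left_mono power_increasing) auto
        finally show ?thesis using small by linarith
      qed
      have sub: "{hs \<in> T. f hs = q} \<subseteq> {hs \<in> tuples {1..H} j. dist_to_int (\<theta> * real q * real (prod_list hs)) \<le> \<epsilon>'}"
        using f unfolding T_def \<epsilon>'_def by (fastforce simp: mult.commute mult.left_commute)
      have "real H ^ j / R ^ 4 \<le> real H ^ j / (4 * R\<^sup>2)"
        using R4 R by (intro divide_left_mono) auto
      also have "\<dots> = real H ^ j / (2 * R) / (2 * R)" by (simp add: power2_eq_square)
      also have "\<dots> \<le> real (card T) / (2 * R)" using cT R by (intro divide_right_mono) auto
      also have "\<dots> \<le> real (card {hs \<in> T. f hs = q})" by (rule q)
      also have "\<dots> \<le> real (card {hs \<in> tuples {1..H} j. dist_to_int (\<theta> * real q * real (prod_list hs)) \<le> \<epsilon>'})"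
        using sub by (intro of_nat_mono card_mono) auto
      finally show "real H ^ j / R ^ 4 \<le> \<dots>" .
    qed (use e' H in auto)
    then obtain q' where q': "q' \<ge> 1" "real q' \<le> (R ^ 4) ^ C" "dist_to_int (\<theta> * real q * real q') \<le> (R ^ 4) ^ C * \<epsilon>' / real H ^ j" by blast
    show "\<exists>q\<ge>1. real q \<le> R ^ ?E \<and> dist_to_int (\<theta> * real q) \<le> R ^ ?E * \<epsilon> / real H ^ Suc j"
    proof (intro exI[of _ "q * q'"] conjI)
      show "1 \<le> q * q'" using q q' by simp
      have "real (q * q') \<le> R ^ 2 * (R ^ 4) ^ C"
        using q q' R R4 by (simp only: of_nat_mult) (intro mult_mono, auto)
      also have "\<dots> = R ^ (4 * C + 2)" by (simp add: power2_eq_square power_add flip: power_mult)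
      also have "\<dots> \<le> R ^ ?E" using R by (intro power_increasing) auto
      finally show "real (q * q') \<le> R ^ ?E" .
      have "dist_to_int (\<theta> * real (q * q')) \<le> (R ^ 4) ^ C * \<epsilon>' / real H ^ j"
        using q'(3) by (simp add: mult.assoc)
      also have "\<dots> \<le> (R ^ 4) ^ C * (R ^ 4 * \<epsilon> / real H) / real H ^ j"
        using e' R by (intro divide_right_mono mult_left_mono) auto
      also have "\<dots> = R ^ (4 * C + 4) * \<epsilon> / real H ^ Suc j" by (simp add: power_add power_mult)
      also have "\<dots> \<le> R ^ ?E * \<epsilon> / real H ^ Suc j"
        using R e0 by (intro divide_right_mono mult_right_mono power_increasing) auto
      finally show "dist_to_int (\<theta> * real (q * q')) \<le> R ^ ?E * \<epsilon> / real H ^ Suc j" .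
    qed
  qed
qed

section \<open>Exponential sums\<close>

lemma norm_unit_exp [simp]: "norm (unit_exp x) = 1"
  by (simp add: unit_exp_def norm_exp_eq_Re)

lemma unit_exp_add: "unit_exp (x + y) = unit_exp x * unit_exp y"
  by (simp add: unit_exp_def distrib_left exp_add)

lemma unit_exp_0 [simp]: "unit_exp 0 = 1"
  by (simp add: unit_exp_def)

lemma cnj_unit_exp: "cnj (unit_exp x) = unit_exp (- x)"
  by (simp add: unit_exp_def exp_cnj)

lemma unit_exp_mult_cnj: "unit_exp x * cnj (unit_exp y) = unit_exp (x - y)"
  by (simp add: cnj_unit_exp flip: unit_exp_add)

lemma unit_exp_of_int [simp]: "unit_exp (of_int m) = 1"
proof -
  have "unit_exp (of_int m) = exp (2 * of_int m * of_real pi * \<i>)"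
    by (simp add: unit_exp_def mult_ac)
  also have "\<dots> = 1" by (simp add: exp_eq_1)
  finally show ?thesis .
qed

lemma unit_exp_add_int [simp]: "unit_exp (x + of_int m) = unit_exp x"
  by (simp add: unit_exp_add)

lemma unit_exp_of_nat_mult: "unit_exp (real n * x) = unit_exp x ^ n"
  by (induction n) (simp_all add: distrib_right unit_exp_add)

lemma norm_unit_exp_minus_1: "norm (unit_exp x - 1) = 2 * \<bar>sin (pi * x)\<bar>"
proof -
  have "unit_exp x = exp (\<i> * of_real (2 * pi * x))" by (simp add: unit_exp_def mult_ac)
  then have "norm (unit_exp x - 1) = 2 * \<bar>sin (2 * pi * x / 2)\<bar>" by (simp only: dist_exp_i_1)
  then show ?thesis by simp
qed

lemma norm_unit_exp_diff: "norm (unit_exp x - unit_exp y) \<le> 2 * pi * \<bar>x - y\<bar>"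
proof -
  have "unit_exp x - unit_exp y = unit_exp y * (unit_exp (x - y) - 1)"
    by (simp add: algebra_simps flip: unit_exp_add)
  then have "norm (unit_exp x - unit_exp y) = 2 * \<bar>sin (pi * (x - y))\<bar>"
    by (simp add: norm_mult norm_unit_exp_minus_1)
  also have "\<dots> \<le> 2 * \<bar>pi * (x - y)\<bar>" using abs_sin_x_le_abs_x by (intro mult_left_mono) auto
  finally show ?thesis by (simp add: abs_mult)
qed

lemma sin_ge_half:
  assumes "0 \<le> y" "y \<le> pi / 2"
  shows "sin y \<ge> y / 2"
proof (cases "y \<le> pi / 3")
  case True
  have "(\<lambda>t. sin t - t / 2) 0 \<le> (\<lambda>t. sin t - t / 2) y"
  proof (rule DERIV_nonneg_imp_nondecreasing[OF assms(1)])
    fix x assume x: "0 \<le> x" "x \<le> y"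
    have "cos x \<ge> cos (pi / 3)" using x True by (intro cos_monotone_0_pi_le) auto
    then have "cos x - 1/2 \<ge> 0" by (simp add: cos_60)
    moreover have "((\<lambda>t. sin t - t / 2) has_real_derivative cos x - 1/2) (at x)"
      by (auto intro!: derivative_eq_intros)
    ultimately show "\<exists>z. ((\<lambda>t. sin t - t / 2) has_real_derivative z) (at x) \<and> 0 \<le> z" by blast
  qed
  then show ?thesis by simp
next
  case False
  have "sin (pi / 3) \<le> sin y" using False assms by (intro sin_monotone_2pi_le) (auto intro: order_trans[of _ 0])
  moreover have "sqrt 3 \<ge> 17/10" by (rule real_le_rsqrt) (simp add: power2_eq_square)
  moreover have "pi < 3.2" using pi_approx by simp
  ultimately show ?thesis using assms by (simp add: sin_60)
qed

lemma norm_unit_exp_minus_1_ge: "norm (unit_exp x - 1) \<ge> 2 * dist_to_int x"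
proof -
  define t where "t = x - of_int (round x)"
  have d: "dist_to_int x = \<bar>t\<bar>" by (simp add: dist_to_int_eq_round t_def)
  have t: "\<bar>t\<bar> \<le> 1/2" using dist_to_int_le_half[of x] d by simp
  have "unit_exp x = unit_exp t" using unit_exp_add_int[of t "round x"] by (simp add: t_def)
  then have "norm (unit_exp x - 1) = 2 * \<bar>sin (pi * t)\<bar>" by (simp add: norm_unit_exp_minus_1)
  also have "\<bar>sin (pi * t)\<bar> = \<bar>sin (pi * \<bar>t\<bar>)\<bar>" by (cases "t \<ge> 0") auto
  also have "sin (pi * \<bar>t\<bar>) \<ge> pi * \<bar>t\<bar> / 2"
  proof (rule sin_ge_half)
    show "pi * \<bar>t\<bar> \<le> pi / 2" using t mult_left_mono[OF t, of pi] by simp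
  qed auto
  then have "2 * \<bar>sin (pi * \<bar>t\<bar>)\<bar> \<ge> pi * \<bar>t\<bar>" by linarith
  moreover have "pi * \<bar>t\<bar> \<ge> 2 * \<bar>t\<bar>" using pi_ge_two by (intro mult_right_mono) auto
  ultimately show ?thesis using d by linarith
qed

lemma geometric_sum_bound:
  "dist_to_int b * norm (\<Sum>n<y. unit_exp (c + b * real n)) \<le> 1"
proof -
  have "unit_exp (c + b * real n) = unit_exp c * unit_exp b ^ n" for n
    using unit_exp_of_nat_mult[of n b] by (simp add: unit_exp_add mult.commute)
  then have "(\<Sum>n<y. unit_exp (c + b * real n)) = unit_exp c * (\<Sum>n<y. unit_exp b ^ n)"
    by (simp add: sum_distrib_left)
  then have eq: "norm (\<Sum>n<y. unit_exp (c + b * real n)) = norm (\<Sum>n<y. unit_exp b ^ n)"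
    by (simp add: norm_mult)
  have "(unit_exp b - 1) * (\<Sum>n<y. unit_exp b ^ n) = unit_exp b ^ y - 1"
    by (rule power_diff_1_eq[symmetric])
  then have "norm (unit_exp b - 1) * norm (\<Sum>n<y. unit_exp b ^ n) = norm (unit_exp b ^ y - 1)"
    by (metis norm_mult)
  also have "\<dots> \<le> 2" using norm_triangle_ineq4[of "unit_exp b ^ y" 1] by (simp add: norm_power)
  finally have "norm (unit_exp b - 1) * norm (\<Sum>n<y. unit_exp b ^ n) \<le> 2" .
  moreover have "2 * dist_to_int b * norm (\<Sum>n<y. unit_exp b ^ n)
      \<le> norm (unit_exp b - 1) * norm (\<Sum>n<y. unit_exp b ^ n)"
    by (intro mult_right_mono norm_unit_exp_minus_1_ge) auto
  ultimately show ?thesis unfolding eq by linarith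
qed

section \<open>Repeated differencing\<close>

text \<open>
On a phase \<open>e(P(n))\<close> this operation differences the polynomial \<open>P\<close>; on the indicator function of a
set it indicates the parallelepipeds with edges \<open>hs\<close> inside that set. Weyl's inequality uses the
first, the recurrence of monomials the second.
\<close>
primrec multdiff :: "nat list \<Rightarrow> (nat \<Rightarrow> complex) \<Rightarrow> nat \<Rightarrow> complex" where
  "multdiff [] F = F"
| "multdiff (h # hs) F = (\<lambda>n. multdiff hs F (n + h) * cnj (multdiff hs F n))"

lemma multdiff_support:
  fixes L :: nat
  assumes "\<And>n. n \<ge> L \<Longrightarrow> F n = 0" "n \<ge> L"
  shows "multdiff hs F n = 0"
  using assms(2) by (induction hs arbitrary: n) (auto simp: assms(1))

lemma sum_triangle_swap:
  "(\<Sum>n<L. \<Sum>m<n. g n m) = (\<Sum>m<(L::nat). \<Sum>n\<in>{m<..<L}. g n m)"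
proof -
  have "(\<Sum>n<L. \<Sum>m<n. g n m) = (\<Sum>(n, m)\<in>(SIGMA n:{..<L}. {..<n}). g n m)"
    by (rule sum.Sigma) auto
  also have "\<dots> = (\<Sum>(m, n)\<in>(SIGMA m:{..<L}. {m<..<L}). g n m)"
    by (rule sum.reindex_bij_witness[of _ "\<lambda>(a, b). (b, a)" "\<lambda>(a, b). (b, a)"]) auto
  also have "\<dots> = (\<Sum>m<L. \<Sum>n\<in>{m<..<L}. g n m)"
    by (rule sum.Sigma[symmetric]) auto
  finally show ?thesis .
qed

text \<open>
In \<open>\<bar>\<Sum> F\<bar>\<^sup>2 = \<Sum>\<^sub>m \<Sum>\<^sub>n F m F(n)\<^sup>*\<close> the pairs with \<open>m < n\<close> contribute the complex conjugate of those with
\<open>m > n\<close>. Hence nonnegative shifts suffice, at the cost of the factor \<open>2\<close>.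
\<close>
lemma van_der_corput:
  fixes L :: nat
  assumes supp: "\<And>n. n \<ge> L \<Longrightarrow> F n = (0::complex)"
  shows "(norm (\<Sum>n<L. F n))\<^sup>2 \<le> 2 * (\<Sum>h<L. norm (\<Sum>n<L. F (n + h) * cnj (F n)))"
proof -
  define A where "A h = (\<Sum>n<L. F (n + h) * cnj (F n))" for h
  have shift: "(\<Sum>m\<in>{n..<L}. F m * c) = (\<Sum>h<L. F (n + h) * c)" if "n \<le> L" for n c
  proof -
    have "(\<Sum>m\<in>{n..<L}. F m * c) = (\<Sum>h<L - n. F (n + h) * c)"
      using that by (intro sum.reindex_bij_witness[of _ "\<lambda>h. n + h" "\<lambda>m. m - n"]) auto
    also have "\<dots> = (\<Sum>h<L. F (n + h) * c)"
      by (intro sum.mono_neutral_left) (auto simp: supp)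
    finally show ?thesis .
  qed
  have X: "(\<Sum>n<L. \<Sum>m\<in>{n..<L}. F m * cnj (F n)) = (\<Sum>h<L. A h)"
    unfolding A_def by (subst sum.swap) (simp add: shift)
  have U: "(\<Sum>n<L. \<Sum>m\<in>{n<..<L}. F m * cnj (F n)) = (\<Sum>h<L. A h) - A 0"
  proof -
    have "(\<Sum>m\<in>{n<..<L}. F m * cnj (F n)) = (\<Sum>m\<in>{n..<L}. F m * cnj (F n)) - F n * cnj (F n)" if "n < L" for n
    proof -
      have "{n..<L} = insert n {n<..<L}" using that by auto
      then show ?thesis by simp
    qed
    then have "(\<Sum>n<L. \<Sum>m\<in>{n<..<L}. F m * cnj (F n)) = (\<Sum>n<L. (\<Sum>m\<in>{n..<L}. F m * cnj (F n)) - F n * cnj (F n))"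
      by (intro sum.cong) auto
    then show ?thesis by (simp add: sum_subtractf X) (simp add: A_def)
  qed
  have lower: "(\<Sum>n<L. \<Sum>m<n. F m * cnj (F n)) = cnj ((\<Sum>h<L. A h) - A 0)"
  proof -
    have "(\<Sum>n<L. \<Sum>m<n. F m * cnj (F n)) = (\<Sum>m<L. \<Sum>n\<in>{m<..<L}. F m * cnj (F n))"
      by (rule sum_triangle_swap)
    also have "\<dots> = cnj (\<Sum>m<L. \<Sum>n\<in>{m<..<L}. F n * cnj (F m))"
      by (simp add: mult.commute)
    finally show ?thesis unfolding U .
  qed
  have "(\<Sum>n<L. F n) * cnj (\<Sum>n<L. F n) = (\<Sum>n<L. \<Sum>m<L. F m * cnj (F n))"
    unfolding cnj_sum sum_product by (rule sum.swap)
  also have "\<dots> = (\<Sum>n<L. (\<Sum>m<n. F m * cnj (F n)) + (\<Sum>m\<in>{n..<L}. F m * cnj (F n)))"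
  proof (rule sum.cong)
    fix n assume "n \<in> {..<L}"
    then have "{..<L} = {..<n} \<union> {n..<L}" by auto
    then show "(\<Sum>m<L. F m * cnj (F n)) = (\<Sum>m<n. F m * cnj (F n)) + (\<Sum>m\<in>{n..<L}. F m * cnj (F n))"
      by (simp add: sum.union_disjoint ivl_disj_int)
  qed auto
  also have "\<dots> = (\<Sum>h<L. A h) + cnj ((\<Sum>h<L. A h) - A 0)" by (simp add: sum.distrib X lower)
  finally have eq: "(\<Sum>n<L. F n) * cnj (\<Sum>n<L. F n) = (\<Sum>h<L. A h) + cnj ((\<Sum>h<L. A h) - A 0)" .
  have b: "norm ((\<Sum>h<L. A h) - A 0) \<le> (\<Sum>h<L. norm (A h))"
  proof (cases "L = 0")
    case False
    then have "{..<L} = insert 0 {1..<L}" by auto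
    then have "(\<Sum>h<L. A h) - A 0 = (\<Sum>h\<in>{1..<L}. A h)" by simp
    also have "norm \<dots> \<le> (\<Sum>h\<in>{1..<L}. norm (A h))" by (rule norm_sum)
    also have "\<dots> \<le> (\<Sum>h<L. norm (A h))" by (intro sum_mono2) auto
    finally show ?thesis .
  qed (simp add: A_def)
  have "(norm (\<Sum>n<L. F n))\<^sup>2 = norm ((\<Sum>n<L. F n) * cnj (\<Sum>n<L. F n))"
    by (simp only: norm_mult complex_mod_cnj power2_eq_square)
  also have "\<dots> \<le> norm (\<Sum>h<L. A h) + norm (cnj ((\<Sum>h<L. A h) - A 0))"
    unfolding eq by (rule norm_triangle_ineq)
  also have "\<dots> \<le> (\<Sum>h<L. norm (A h)) + (\<Sum>h<L. norm (A h))"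
    using b by (intro add_mono norm_sum) (simp only: complex_mod_cnj)
  finally show ?thesis by (simp add: A_def)
qed

text \<open>
Each further shift costs one application of the Cauchy-Schwarz inequality to the sum over the
shifts already present, and one van der Corput step.
\<close>
lemma multdiff_large:
  fixes R :: real and L :: nat
  assumes supp: "\<And>n. n \<ge> L \<Longrightarrow> F n = (0::complex)" and R: "R > 0" and L: "L \<ge> 1"
    and large: "norm (\<Sum>n<L. F n) \<ge> real L / R"
  shows "(\<Sum>hs\<in>tuples {..<L} j. norm (\<Sum>n<L. multdiff hs F n)) \<ge> 2 * real L ^ (j + 1) / (2 * R) ^ (2 ^ j)"
proof (induction j)
  case 0
  then show ?case using large by simp
next
  case (Suc j)
  define X where "X = (\<Sum>hs\<in>tuples {..<L} j. norm (\<Sum>n<L. multdiff hs F n))"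
  define Y where "Y = (\<Sum>hs\<in>tuples {..<L} (Suc j). norm (\<Sum>n<L. multdiff hs F n))"
  define b where "b = 2 * real L ^ (j + 1) / (2 * R) ^ (2 ^ j)"
  have b0: "b \<ge> 0" using R by (simp add: b_def)
  have "b\<^sup>2 \<le> X\<^sup>2" using Suc b0 unfolding X_def b_def by (intro power_mono)
  also have "X\<^sup>2 \<le> (\<Sum>hs\<in>tuples {..<L} j. (norm (\<Sum>n<L. multdiff hs F n))\<^sup>2) * card (tuples {..<L} j)"
    unfolding X_def by (rule sum_squared_le_sum_of_squares)
  also have "\<dots> \<le> (\<Sum>hs\<in>tuples {..<L} j. 2 * (\<Sum>h<L. norm (\<Sum>n<L. multdiff (h # hs) F n))) * card (tuples {..<L} j)"
    by (intro mult_right_mono sum_mono) (auto intro!: van_der_corput multdiff_support supp)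
  also have "\<dots> = 2 * Y * real L ^ j"
    unfolding Y_def sum_tuples_Suc by (subst sum.swap) (simp add: sum_distrib_left card_tuples)
  finally have "b\<^sup>2 \<le> 2 * Y * real L ^ j" .
  moreover have "b\<^sup>2 = 2 * (2 * real L ^ (j + 2) / (2 * R) ^ (2 ^ Suc j)) * real L ^ j"
  proof -
    have "((2 * R) ^ (2 ^ j))\<^sup>2 = (2 * R) ^ (2 ^ Suc j)" by (simp only: power_mult[symmetric] power_Suc2)
    moreover have "(real L ^ (j + 1))\<^sup>2 = real L ^ (j + 2) * real L ^ j"
      by (simp only: power_mult[symmetric] power_add[symmetric]) (rule arg_cong[where f = "power (real L)"], simp)
    ultimately show ?thesis by (simp only: b_def power_divide power_mult_distrib) simp
  qed
  ultimately have "2 * (2 * real L ^ (j + 2) / (2 * R) ^ (2 ^ Suc j)) * real L ^ j \<le> 2 * Y * real L ^ j" by simp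
  then have "2 * real L ^ (j + 2) / (2 * R) ^ (2 ^ Suc j) \<le> Y"
    using mult_right_le_imp_le[of "2 * (2 * real L ^ (j + 2) / (2 * R) ^ (2 ^ Suc j))" "real L ^ j" "2 * Y"] L
    by (simp del: power_Suc)
  then show ?case by (simp add: Y_def)
qed

primrec polydiff :: "nat list \<Rightarrow> real poly \<Rightarrow> real poly" where
  "polydiff [] P = P"
| "polydiff (h # hs) P = pcompose (polydiff hs P) [:real h, 1:] - polydiff hs P"

lemma poly_polydiff_Cons:
  "poly (polydiff (h # hs) P) x = poly (polydiff hs P) (x + real h) - poly (polydiff hs P) x"
  by (simp add: poly_pcompose add.commute)

text \<open>
The coefficient below the top one is included because it becomes the leading coefficient of the
difference \<open>P(x + h) - P(x)\<close>.
\<close>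
lemma coeff_shift:
  fixes P :: "real poly"
  assumes "degree P \<le> d"
  shows "degree (pcompose P [:h, 1:]) \<le> d \<and> coeff (pcompose P [:h, 1:]) d = coeff P d \<and>
    (d \<ge> 1 \<longrightarrow> coeff (pcompose P [:h, 1:]) (d - 1) = coeff P (d - 1) + real d * h * coeff P d)"
  using assms
proof (induction P arbitrary: d)
  case (pCons a P)
  show ?case
  proof (cases "P = 0")
    case True
    then show ?thesis by (simp add: coeff_pCons split: nat.splits)
  next
    case False
    with pCons.prems obtain e where d: "d = Suc e" "degree P \<le> e" by (cases d) auto
    define X where "X = pcompose P [:h, 1:]"
    have IH: "degree X \<le> e" "coeff X e = coeff P e"
      "e \<ge> 1 \<Longrightarrow> coeff X (e - 1) = coeff P (e - 1) + real e * h * coeff P e"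
      using pCons.IH[OF d(2)] unfolding X_def by auto
    have eq: "pcompose (pCons a P) [:h, 1:] = [:a:] + smult h X + pCons 0 X"
      by (simp add: pcompose_pCons X_def mult.commute)
    have top: "coeff X (Suc e) = 0" using IH(1) by (intro coeff_eq_0) simp
    have "degree ([:a:] + smult h X + pCons 0 X) \<le> Suc e"
      using IH(1) by (intro degree_add_le) (auto simp: degree_pCons_eq_if)
    moreover have "coeff ([:a:] + smult h X + pCons 0 X) e = coeff (pCons a P) e + real (Suc e) * h * coeff P e"
    proof (cases e)
      case 0
      then show ?thesis using IH by simp
    next
      case (Suc e')
      then show ?thesis using IH by (simp add: algebra_simps)
    qed
    ultimately show ?thesis using IH top unfolding eq d by (simp add: coeff_pCons)
  qed
qed simp

lemma polydiff_coeff: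
  assumes "degree P \<le> d" "length hs \<le> d"
  shows "degree (polydiff hs P) \<le> d - length hs \<and>
    coeff (polydiff hs P) (d - length hs) = fact d / fact (d - length hs) * real (prod_list hs) * coeff P d"
  using assms(2)
proof (induction hs)
  case (Cons h hs)
  define e where "e = d - length hs"
  have e: "e \<ge> 1" "d - length (h # hs) = e - 1" using Cons.prems by (auto simp: e_def)
  define Q where "Q = polydiff hs P"
  have IH: "degree Q \<le> e" "coeff Q e = fact d / fact e * real (prod_list hs) * coeff P d"
    using Cons unfolding e_def Q_def by auto
  note S = coeff_shift[OF IH(1), of "real h"]
  have "degree (polydiff (h # hs) P) \<le> e - 1"
  proof (rule degree_le, intro allI impI)
    fix i assume i: "e - 1 < i"
    show "coeff (polydiff (h # hs) P) i = 0"
    proof (cases "i = e")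
      case True
      then show ?thesis using S by (simp add: Q_def)
    next
      case False
      then have "i > e" using i by simp
      then show ?thesis using S IH(1) by (simp add: Q_def coeff_eq_0)
    qed
  qed
  moreover have "coeff (polydiff (h # hs) P) (e - 1) = real e * real h * coeff Q e"
    using S e by (simp add: Q_def)
  moreover have "(fact e :: real) = real e * fact (e - 1)" using e by (simp add: fact_reduce)
  ultimately show ?case unfolding e(2) IH(2) using e by (simp add: field_simps)
qed (use assms in auto)

lemma multdiff_phase:
  "multdiff hs (\<lambda>n. if n < x then unit_exp (poly P (real n)) else 0) n =
   (if n + sum_list hs < x then unit_exp (poly (polydiff hs P) (real n)) else 0)"
  by (induction hs arbitrary: n)
     (auto simp: unit_exp_mult_cnj poly_polydiff_Cons add_ac simp del: polydiff.simps(2))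

section \<open>Recurrence of monomials\<close>

lemma real_le_power_self:
  fixes R :: real
  assumes "R \<ge> 2"
  shows "real n \<le> R ^ n"
proof -
  have "real n \<le> 2 ^ n" using of_nat_less_two_power[of n, where 'a = real] by simp
  also have "\<dots> \<le> R ^ n" using assms by (intro power_mono) auto
  finally show ?thesis .
qed

lemma card_tuples_zero_entry:
  fixes L :: nat
  assumes L: "L \<ge> 1"
  shows "real (card {hs \<in> tuples {..<L} j. 0 \<in> set hs}) \<le> real j * real L ^ j / real L"
proof -
  have "{hs \<in> tuples {..<L} j. 0 \<in> set hs} = tuples {..<L} j - tuples {1..<L} j"
    by (auto simp: tuples_def subset_iff) (metis One_nat_def Suc_leI gr0I)
  also have "card \<dots> = card (tuples {..<L} j) - card (tuples {1..<L} j)"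
    by (intro card_Diff_subset finite_tuples) (auto simp: tuples_def)
  also have "real \<dots> = real L ^ j - real (L - 1) ^ j"
    by (simp add: card_tuples of_nat_diff power_mono)
  finally have eq: "real (card {hs \<in> tuples {..<L} j. 0 \<in> set hs}) = real L ^ j - real (L - 1) ^ j" .
  have "1 + real j * (- 1 / real L) \<le> (1 + (- 1 / real L)) ^ j"
    using L by (intro Bernoulli_inequality) auto
  then have "real L ^ j * (1 + real j * (- 1 / real L)) \<le> real L ^ j * (1 + (- 1 / real L)) ^ j"
    by (intro mult_left_mono) auto
  also have "\<dots> = (real L * (1 + (- 1 / real L))) ^ j" by (simp only: power_mult_distrib)
  also have "real L * (1 + (- 1 / real L)) = real (L - 1)" using L by (simp add: field_simps of_nat_diff)
  finally show ?thesis unfolding eq by (simp add: algebra_simps)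
qed

text \<open>
A nonvanishing iterated difference of \<open>F\<close> involves only points of the support of \<open>F\<close>, and the same
iterated difference of \<open>P\<close> is a signed sum of the values of \<open>P\<close> at these points.
\<close>
lemma multdiff_indicator_near:
  assumes "\<And>n. F n \<noteq> 0 \<Longrightarrow> dist_to_int (poly P (real n)) \<le> \<epsilon>" "multdiff hs F n \<noteq> 0"
  shows "dist_to_int (poly (polydiff hs P) (real n)) \<le> 2 ^ length hs * \<epsilon>"
  using assms(2)
proof (induction hs arbitrary: n)
  case (Cons h hs)
  then have "multdiff hs F (n + h) \<noteq> 0" "multdiff hs F n \<noteq> 0" by auto
  then have "dist_to_int (poly (polydiff hs P) (real (n + h))) \<le> 2 ^ length hs * \<epsilon>"
    "dist_to_int (poly (polydiff hs P) (real n)) \<le> 2 ^ length hs * \<epsilon>" using Cons.IH by blast+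
  then show ?case
    using dist_to_int_diff[of "poly (polydiff hs P) (real (n + h))" "poly (polydiff hs P) (real n)"]
    by (simp add: poly_polydiff_Cons del: polydiff.simps)
qed (use assms in auto)

lemma norm_multdiff_le_1:
  assumes "\<And>n. norm (F n) \<le> 1"
  shows "norm (multdiff hs F n) \<le> 1"
  by (induction hs arbitrary: n) (auto simp: assms norm_mult intro!: mult_le_one)

text \<open>
A dense set \<open>S\<close> contains many \<open>j\<close>-dimensional parallelepipeds. The alternating sum of \<open>\<theta> a\<^sup>j - c\<close> over
the corners of one is \<open>j! \<theta> h\<^sub>1 \<cdots> h\<^sub>j\<close>, with \<open>h\<^sub>i\<close> the edges, so the shift \<open>c\<close> drops out and the
multilinear lemma applies. If \<open>A\<close> is itself bounded by a power of \<open>R\<close>, the parallelepipeds may be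
degenerate, but then \<open>b\<^sup>j - a\<^sup>j\<close> for any two elements \<open>a < b\<close> of \<open>S\<close> is an admissible \<open>q\<close>.
\<close>
lemma monomial_recurrence:
  assumes j: "j \<ge> 1"
  shows "\<exists>C::nat. \<forall>R A S \<theta> c \<epsilon>. R \<ge> 2 \<and> A \<ge> 1 \<and> S \<subseteq> {0..A} \<and> card S \<ge> 2 \<and> real (card S) \<ge> real A / R \<and>
     \<epsilon> \<ge> 0 \<and> \<epsilon> * R ^ C \<le> (1::real) \<and> (\<forall>a\<in>S. dist_to_int (\<theta> * real a ^ j - c) \<le> \<epsilon>)
     \<longrightarrow> (\<exists>q\<ge>1. real q \<le> R ^ C \<and> dist_to_int (\<theta> * real q) \<le> R ^ C * \<epsilon> / real A ^ j)"
proof -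
  obtain V :: nat where V: "\<And>R H \<theta> \<epsilon>. R \<ge> 2 \<Longrightarrow> H \<ge> 1 \<Longrightarrow> \<epsilon> \<ge> 0 \<Longrightarrow> \<epsilon> * R ^ V \<le> (1::real) \<Longrightarrow>
     real (card {hs \<in> tuples {1..H} j. dist_to_int (\<theta> * real (prod_list hs)) \<le> \<epsilon>}) \<ge> real H ^ j / R
     \<Longrightarrow> (\<exists>q\<ge>1. real q \<le> R ^ V \<and> dist_to_int (\<theta> * real q) \<le> R ^ V * \<epsilon> / real H ^ j)"
    using vinogradov_multilinear[of j] by blast
  define t :: nat where "t = 3 * 2 ^ j"
  define C where "C = fact j + t * V + j + (j + t) * j + 1"
  show ?thesis
  proof (rule exI[of _ C], intro allI impI)
    fix R \<theta> c \<epsilon> :: real and A :: nat and S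
    assume asm: "R \<ge> 2 \<and> A \<ge> 1 \<and> S \<subseteq> {0..A} \<and> card S \<ge> 2 \<and> real (card S) \<ge> real A / R \<and>
     \<epsilon> \<ge> 0 \<and> \<epsilon> * R ^ C \<le> (1::real) \<and> (\<forall>a\<in>S. dist_to_int (\<theta> * real a ^ j - c) \<le> \<epsilon>)"
    then have R: "R \<ge> 2" and A: "A \<ge> 1" and S: "S \<subseteq> {0..A}" and S2: "card S \<ge> 2" and dens: "real (card S) \<ge> real A / R"
      and e0: "\<epsilon> \<ge> 0" and small: "\<epsilon> * R ^ C \<le> 1" and near: "\<And>a. a \<in> S \<Longrightarrow> dist_to_int (\<theta> * real a ^ j - c) \<le> \<epsilon>"
      by auto
    have fS: "finite S" using S finite_subset by blast
    define T where "T = (2 * (2 * R)) ^ (2 ^ j)"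
    have TR: "T \<le> R ^ t"
    proof -
      have "2 * (2 * R) \<le> R ^ 3"
        using mult_mono[of 2 R 2 R] R by (simp add: power3_eq_cube)
      then have "T \<le> (R ^ 3) ^ (2 ^ j)" unfolding T_def using R by (intro power_mono) auto
      then show ?thesis by (simp add: t_def power_mult)
    qed
    have "2 * (2 * R) \<le> T" unfolding T_def using R by (intro self_le_power) auto
    then have T2: "T \<ge> 2" using R by linarith
    have pw: "R ^ a \<le> R ^ b" if "a \<le> b" for a b using R that by (intro power_increasing) auto
    show "\<exists>q\<ge>1. real q \<le> R ^ C \<and> dist_to_int (\<theta> * real q) \<le> R ^ C * \<epsilon> / real A ^ j"
    proof (cases "real (A + 1) \<ge> real j * T")
      case False
      then have "real A \<le> real j * T" by simp
      also have "\<dots> \<le> R ^ j * R ^ t" using TR T2 R real_le_power_self[OF R, of j] by (intro mult_mono) auto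
      finally have "real A ^ j \<le> (R ^ (j + t)) ^ j" by (intro power_mono) (auto simp: power_add)
      then have Aj: "real A ^ j \<le> R ^ ((j + t) * j)" by (simp add: power_mult)
      obtain a b where ab: "a \<in> S" "b \<in> S" "a < b"
      proof -
        have "\<not> S \<subseteq> {Min S}" using S2 fS card_mono[of "{Min S}" S] by auto
        then obtain b where "b \<in> S" "b \<noteq> Min S" by auto
        then show ?thesis using that[of "Min S" b] fS Min_in[of S] Min_le[of S b] by fastforce
      qed
      define q where "q = b ^ j - a ^ j"
      have lt: "a ^ j < b ^ j" using ab j by (intro power_strict_mono) auto
      have q: "q \<ge> 1" "q \<le> A ^ j"
      proof -
        show "q \<ge> 1" using lt by (simp add: q_def)
        have "b ^ j \<le> A ^ j" using ab S by (intro power_mono) auto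
        then show "q \<le> A ^ j" by (simp add: q_def)
      qed
      have "\<theta> * real q = (\<theta> * real b ^ j - c) - (\<theta> * real a ^ j - c)"
        using lt by (simp add: q_def of_nat_diff algebra_simps)
      then have "dist_to_int (\<theta> * real q) \<le> \<epsilon> + \<epsilon>"
        using dist_to_int_diff[of "\<theta> * real b ^ j - c" "\<theta> * real a ^ j - c"] near[OF ab(1)] near[OF ab(2)] by simp
      also have "\<dots> = 2 * real A ^ j * \<epsilon> / real A ^ j" using A by simp
      also have "\<dots> \<le> R * R ^ ((j + t) * j) * \<epsilon> / real A ^ j"
        using R Aj e0 by (intro divide_right_mono mult_right_mono mult_mono) auto
      also have "\<dots> = R ^ ((j + t) * j + 1) * \<epsilon> / real A ^ j" by simp
      also have "\<dots> \<le> R ^ C * \<epsilon> / real A ^ j"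
        using e0 by (intro divide_right_mono mult_right_mono pw) (auto simp: C_def)
      finally have "dist_to_int (\<theta> * real q) \<le> R ^ C * \<epsilon> / real A ^ j" .
      moreover have "real q \<le> R ^ C"
      proof -
        have "real q \<le> real A ^ j" using q(2) by (metis of_nat_le_iff of_nat_power)
        also note Aj
        also have "R ^ ((j + t) * j) \<le> R ^ C" by (intro pw) (simp add: C_def)
        finally show ?thesis .
      qed
      ultimately show ?thesis using q by blast
    next
      case True
      define L where "L = A + 1"
      define F :: "nat \<Rightarrow> complex" where "F n = (if n \<in> S then 1 else 0)" for n
      have supp: "F n = 0" if "n \<ge> L" for n using S that by (auto simp: F_def L_def)
      have "(\<Sum>n<L. F n) = of_nat (card S)"
      proof -
        have "{..<L} \<inter> S = S" using S by (auto simp: L_def)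
        then show ?thesis by (simp add: F_def sum.If_cases)
      qed
      then have nF: "norm (\<Sum>n<L. F n) = real (card S)" by simp
      have "real L / (2 * R) \<le> real A / R" using A R by (simp add: L_def field_simps)
      then have big: "norm (\<Sum>n<L. F n) \<ge> real L / (2 * R)" using dens nF by linarith
      define G where "G = {hs \<in> tuples {..<L} j. \<exists>n. multdiff hs F n \<noteq> 0}"
      have "2 * real L ^ (j + 1) / T \<le> (\<Sum>hs\<in>tuples {..<L} j. norm (\<Sum>n<L. multdiff hs F n))"
        unfolding T_def using multdiff_large[OF supp _ _ big, of j] R by (simp add: L_def)
      also have "\<dots> \<le> (\<Sum>hs\<in>tuples {..<L} j. real L * of_bool (hs \<in> G))"
      proof (rule sum_mono)
        fix hs assume hs: "hs \<in> tuples {..<L} j"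
        show "norm (\<Sum>n<L. multdiff hs F n) \<le> real L * of_bool (hs \<in> G)"
        proof (cases "hs \<in> G")
          case True
          have "norm (\<Sum>n<L. multdiff hs F n) \<le> (\<Sum>n<L. 1)"
            by (intro sum_norm_le norm_multdiff_le_1) (auto simp: F_def)
          then show ?thesis using True by simp
        next
          case False
          then have "multdiff hs F n = 0" for n using hs by (auto simp: G_def)
          then show ?thesis by simp
        qed
      qed
      also have "\<dots> = real L * real (card G)"
      proof -
        have "tuples {..<L} j \<inter> {hs. hs \<in> G} = G" by (auto simp: G_def)
        then show ?thesis by (simp add: sum_distrib_left[symmetric] sum_of_bool_eq)
      qed
      finally have "real L * (2 * real L ^ j / T) \<le> real L * real (card G)" by (simp add: mult_ac)
      then have cG: "2 * real L ^ j / T \<le> real (card G)"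
        by (rule mult_left_le_imp_le) (simp add: L_def)
      \<comment> \<open>Edges of length 0 carry no information and have to be discarded.\<close>
      define Z where "Z = {hs \<in> tuples {..<L} j. 0 \<in> set hs}"
      have "real (card Z) \<le> real j * real L ^ j / real L"
        unfolding Z_def by (rule card_tuples_zero_entry) (simp add: L_def)
      also have "\<dots> \<le> real L ^ j / T"
      proof -
        have "real j * T \<le> real L" using True by (simp add: L_def)
        then have "real j / real L \<le> 1 / T" using T2 by (simp add: L_def field_simps)
        from mult_right_mono[OF this, of "real L ^ j"] show ?thesis by simp
      qed
      finally have cZ: "real (card Z) \<le> real L ^ j / T" .
      have fG: "finite G" unfolding G_def by simp
      have "card G \<le> card (G - Z) + card Z"
        using card_Un_le[of "G - Z" Z] card_mono[of "(G - Z) \<union> Z" G] fG by (auto simp: Z_def)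
      then have cGZ: "real (card (G - Z)) \<ge> real A ^ j / T"
      proof -
        assume "card G \<le> card (G - Z) + card Z"
        then have "real (card G) \<le> real (card (G - Z)) + real (card Z)" by linarith
        moreover have "real A ^ j / T \<le> real L ^ j / T" using T2 by (intro divide_right_mono power_mono) (auto simp: L_def)
        ultimately show ?thesis using cG cZ by simp
      qed
      define Q where "Q = monom \<theta> j - [:c:]"
      have degQ: "degree Q \<le> j" unfolding Q_def by (intro degree_diff_le) (auto simp: degree_monom_le)
      have cQ: "coeff Q j = \<theta>" using j by (cases j) (auto simp: Q_def)
      have nearQ: "dist_to_int (poly Q (real n)) \<le> \<epsilon>" if "F n \<noteq> 0" for n
        using near[of n] that by (auto simp: Q_def poly_monom F_def split: if_splits)
      define \<epsilon>' where "\<epsilon>' = 2 ^ j * \<epsilon>"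
      have sub: "G - Z \<subseteq> {hs \<in> tuples {1..A} j. dist_to_int (fact j * \<theta> * real (prod_list hs)) \<le> \<epsilon>'}"
      proof
        fix hs assume hs: "hs \<in> G - Z"
        then have h: "set hs \<subseteq> {..<L}" "length hs = j" "0 \<notin> set hs" by (auto simp: G_def Z_def tuples_def)
        have "h \<in> {1..A}" if "h \<in> set hs" for h using h that by (cases h) (auto simp: L_def)
        with h have t1: "hs \<in> tuples {1..A} j" by (auto simp: tuples_def)
        from hs obtain n where "multdiff hs F n \<noteq> 0" by (auto simp: G_def)
        from multdiff_indicator_near[of F Q, OF nearQ this]
        have n1: "dist_to_int (poly (polydiff hs Q) (real n)) \<le> 2 ^ length hs * \<epsilon>" by blast
        have len: "length hs = j" using t1 by (simp add: tuples_def)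
        have "degree (polydiff hs Q) = 0" "coeff (polydiff hs Q) 0 = fact j * real (prod_list hs) * \<theta>"
          using polydiff_coeff[OF degQ, of hs] len cQ by auto
        then have "polydiff hs Q = [:fact j * real (prod_list hs) * \<theta>:]"
          by (metis degree_eq_zeroE coeff_pCons_0)
        then have "poly (polydiff hs Q) (real n) = fact j * \<theta> * real (prod_list hs)" by simp
        then show "hs \<in> {hs \<in> tuples {1..A} j. dist_to_int (fact j * \<theta> * real (prod_list hs)) \<le> \<epsilon>'}"
          using n1 t1 len by (simp add: \<epsilon>'_def)
      qed
      have TV: "T ^ V \<le> R ^ (t * V)" using TR T2 by (simp add: power_mult power_mono)
      have e'R: "\<epsilon>' \<le> R ^ j * \<epsilon>" unfolding \<epsilon>'_def using R e0 by (intro mult_right_mono power_mono) auto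
      have eTV: "\<epsilon>' * T ^ V \<le> \<epsilon> * R ^ (j + t * V)"
      proof -
        have "\<epsilon>' * T ^ V \<le> (R ^ j * \<epsilon>) * R ^ (t * V)"
          using TV e'R e0 R T2 by (intro mult_mono) (auto simp: \<epsilon>'_def)
        then show ?thesis by (simp add: power_add mult_ac)
      qed
      have "\<exists>q\<ge>1. real q \<le> T ^ V \<and> dist_to_int (fact j * \<theta> * real q) \<le> T ^ V * \<epsilon>' / real A ^ j"
      proof (rule V[OF T2 A])
        show "\<epsilon>' \<ge> 0" using e0 by (simp add: \<epsilon>'_def)
        have "\<epsilon> * R ^ (j + t * V) \<le> \<epsilon> * R ^ C" using e0 by (intro mult_left_mono pw) (auto simp: C_def)
        then show "\<epsilon>' * T ^ V \<le> 1" using eTV small by linarith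
        have "card (G - Z) \<le> card {hs \<in> tuples {1..A} j. dist_to_int (fact j * \<theta> * real (prod_list hs)) \<le> \<epsilon>'}"
          by (rule card_mono[OF _ sub]) simp
        then show "real A ^ j / T \<le> real (card {hs \<in> tuples {1..A} j. dist_to_int (fact j * \<theta> * real (prod_list hs)) \<le> \<epsilon>'})"
          using cGZ by linarith
      qed
      then obtain q where q: "q \<ge> 1" "real q \<le> T ^ V" "dist_to_int (fact j * \<theta> * real q) \<le> T ^ V * \<epsilon>' / real A ^ j" by blast
      show ?thesis
      proof (intro exI[of _ "fact j * q"] conjI)
        show "1 \<le> fact j * q" using q by simp
        have "real (fact j * q) \<le> R ^ fact j * R ^ (t * V)"
          unfolding of_nat_mult using real_le_power_self[OF R, of "fact j"] q TV R by (intro mult_mono) auto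
        also have "\<dots> = R ^ (fact j + t * V)" by (simp add: power_add)
        also have "\<dots> \<le> R ^ C" by (intro pw) (simp add: C_def)
        finally show "real (fact j * q) \<le> R ^ C" .
        have "dist_to_int (\<theta> * real (fact j * q)) \<le> T ^ V * \<epsilon>' / real A ^ j" using q(3) by (simp add: mult_ac)
        also have "\<dots> \<le> \<epsilon> * R ^ (j + t * V) / real A ^ j" using eTV by (intro divide_right_mono) (auto simp: mult_ac)
        also have "\<dots> \<le> \<epsilon> * R ^ C / real A ^ j" using e0 by (intro divide_right_mono mult_left_mono pw) (auto simp: C_def)
        finally show "dist_to_int (\<theta> * real (fact j * q)) \<le> R ^ C * \<epsilon> / real A ^ j" by (simp add: mult.commute)
      qed
    qed
  qed
qed

section \<open>Weyl's inequality\<close>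

text \<open>
After \<open>d - 1\<close> differencing steps there remain geometric sums of frequency \<open>d! \<gamma> h\<^sub>1 \<cdots> h\<^sub>d\<^sub>-\<^sub>1\<close>, where \<open>\<gamma>\<close>
is the top coefficient. Many of them are longer than \<open>L\<close> divided by a power of \<open>R\<close>, so that
frequency is within \<open>R\<^sup>O\<^sup>(\<^sup>1\<^sup>) / L\<close> of an integer, and the multilinear lemma applies. If \<open>L\<close> is bounded
by a power of \<open>R\<close> the claim is trivial with \<open>q = 1\<close>.
\<close>
lemma weyl_top_coefficient:
  assumes d: "d \<ge> 1"
  shows "\<exists>C::nat. \<forall>R L P x. R \<ge> (2::real) \<and> L \<ge> 1 \<and> degree P \<le> d \<and> x \<le> L \<and>
     norm (\<Sum>n<x. unit_exp (poly P (real n))) \<ge> real L / R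
     \<longrightarrow> (\<exists>q\<ge>1. real q \<le> R ^ C \<and> dist_to_int (real q * coeff P d) \<le> R ^ C / real L ^ d)"
proof -
  define j where "j = d - 1"
  have dj: "d = Suc j" using d by (simp add: j_def)
  obtain V :: nat where V: "\<And>R H \<theta> \<epsilon>. R \<ge> 2 \<Longrightarrow> H \<ge> 1 \<Longrightarrow> \<epsilon> \<ge> 0 \<Longrightarrow> \<epsilon> * R ^ V \<le> (1::real) \<Longrightarrow>
     real (card {hs \<in> tuples {1..H} j. dist_to_int (\<theta> * real (prod_list hs)) \<le> \<epsilon>}) \<ge> real H ^ j / R
     \<Longrightarrow> (\<exists>q\<ge>1. real q \<le> R ^ V \<and> dist_to_int (\<theta> * real q) \<le> R ^ V * \<epsilon> / real H ^ j)"
    using vinogradov_multilinear[of j] by blast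
  define t :: nat where "t = 2 ^ d + 1"
  define b where "b = t * (V + 1) + j"
  define C where "C = fact d + t * (V + 1) + d * b"
  show ?thesis
  proof (rule exI[of _ C], intro allI impI)
    fix R :: real and L x :: nat and P :: "real poly"
    assume asm: "R \<ge> (2::real) \<and> L \<ge> 1 \<and> degree P \<le> d \<and> x \<le> L \<and>
     norm (\<Sum>n<x. unit_exp (poly P (real n))) \<ge> real L / R"
    then have R: "R \<ge> 2" and L: "L \<ge> 1" and deg: "degree P \<le> d" and x: "x \<le> L"
      and large: "norm (\<Sum>n<x. unit_exp (poly P (real n))) \<ge> real L / R" by auto
    have pw: "R ^ a \<le> R ^ b" if "a \<le> b" for a b using R that by (intro power_increasing) auto
    define \<gamma> where "\<gamma> = coeff P d"
    show "\<exists>q\<ge>1. real q \<le> R ^ C \<and> dist_to_int (real q * coeff P d) \<le> R ^ C / real L ^ d"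
    proof (cases "real L \<ge> R ^ b")
      case False
      then have "real L ^ d \<le> (R ^ b) ^ d" by (intro power_mono) auto
      also have "\<dots> = R ^ (d * b)" by (simp add: power_mult mult.commute[of d])
      also have "\<dots> \<le> R ^ C" by (intro pw) (simp add: C_def)
      finally have "1 \<le> R ^ C / real L ^ d" using L by simp
      moreover have "1 \<le> R ^ C" using R by (intro one_le_power) auto
      ultimately show ?thesis using dist_to_int_le_half[of \<gamma>] by (intro exI[of _ 1]) (auto simp: \<gamma>_def)
    next
      case True
      define T where "T = (2 * R) ^ (2 ^ j)"
      have TR: "T \<le> R ^ (2 ^ d)"
      proof -
        have "T \<le> (R ^ 2) ^ (2 ^ j)" unfolding T_def using R by (intro power_mono) (auto simp: power2_eq_square)
        then show ?thesis by (simp add: dj power_mult[symmetric])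
      qed
      have T2R: "2 * T \<le> R ^ t" using TR R mult_mono[of 2 R T "R ^ (2 ^ d)"] by (simp add: t_def T_def)
      have "2 * R \<le> T" unfolding T_def using R by (intro self_le_power) auto
      then have T2: "T \<ge> 2" using R by linarith
      define F :: "nat \<Rightarrow> complex" where "F = (\<lambda>n. if n < x then unit_exp (poly P (real n)) else 0)"
      have supp: "F n = 0" if "n \<ge> L" for n using x that by (auto simp: F_def)
      have "(\<Sum>n<L. F n) = (\<Sum>n<x. unit_exp (poly P (real n)))"
        unfolding F_def using x by (intro sum.mono_neutral_cong_right) auto
      then have big: "norm (\<Sum>n<L. F n) \<ge> real L / R" using large by simp
      define W where "W hs = norm (\<Sum>n<L. multdiff hs F n)" for hs
      define G where "G = {hs \<in> tuples {..<L} j. W hs \<ge> real L / T}"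
      have "2 * real L ^ (j + 1) / T \<le> (\<Sum>hs\<in>tuples {..<L} j. W hs)"
        unfolding T_def W_def using multdiff_large[OF supp _ L big, of j] R by simp
      also have "\<dots> \<le> (\<Sum>hs\<in>tuples {..<L} j. real L * of_bool (hs \<in> G) + real L / T)"
      proof (rule sum_mono)
        fix hs assume hs: "hs \<in> tuples {..<L} j"
        have "W hs \<le> (\<Sum>n<L. 1)" unfolding W_def
          by (intro sum_norm_le norm_multdiff_le_1) (auto simp: F_def)
        then show "W hs \<le> real L * of_bool (hs \<in> G) + real L / T"
          using hs T2 by (auto simp: G_def add_increasing2)
      qed
      also have "\<dots> = real L * real (card G) + real L ^ j * (real L / T)"
      proof -
        have "tuples {..<L} j \<inter> {hs. hs \<in> G} = G" by (auto simp: G_def)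
        then show ?thesis by (simp add: sum.distrib sum_distrib_left[symmetric] sum_of_bool_eq card_tuples)
      qed
      finally have up: "2 * real L ^ (j + 1) / T \<le> real L * real (card G) + real L ^ j * (real L / T)" .
      have "2 * real L ^ (j + 1) / T = real L * (real L ^ j / T) + real L ^ j * (real L / T)"
        using T2 by (simp add: field_simps)
      with up have "real L * (real L ^ j / T) \<le> real L * real (card G)" by linarith
      then have cG: "real L ^ j / T \<le> real (card G)"
        by (rule mult_left_le_imp_le) (use L in simp)
      define Z where "Z = {hs \<in> tuples {..<L} j. 0 \<in> set hs}"
      have LT: "2 * (real j * T) \<le> real L" "real L \<ge> T * (2 * T) ^ V"
      proof -
        have "2 * (real j * T) = real j * (2 * T)" by simp
        also have "\<dots> \<le> R ^ j * R ^ t" using T2R T2 R real_le_power_self[OF R, of j] by (intro mult_mono) auto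
        also have "\<dots> = R ^ (j + t)" by (simp add: power_add)
        also have "\<dots> \<le> R ^ b" by (intro pw) (simp add: b_def)
        finally show "2 * (real j * T) \<le> real L" using True by linarith
        have "T * (2 * T) ^ V \<le> (2 * T) * (2 * T) ^ V" using T2 by (intro mult_right_mono) auto
        also have "\<dots> = (2 * T) ^ (V + 1)" by simp
        also have "\<dots> \<le> (R ^ t) ^ (V + 1)" using T2R T2 by (intro power_mono) auto
        also have "\<dots> = R ^ (t * (V + 1))" by (simp only: power_mult)
        also have "\<dots> \<le> R ^ b" by (intro pw) (simp add: b_def)
        finally show "real L \<ge> T * (2 * T) ^ V" using True by linarith
      qed
      have "real (card Z) \<le> real j * real L ^ j / real L"
        unfolding Z_def by (rule card_tuples_zero_entry) (rule L)
      also have "\<dots> \<le> real L ^ j / (2 * T)"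
      proof -
        have "real j / real L \<le> 1 / (2 * T)" using T2 LT L by (simp add: field_simps)
        from mult_right_mono[OF this, of "real L ^ j"] show ?thesis by simp
      qed
      finally have cZ: "real (card Z) \<le> real L ^ j / (2 * T)" .
      have fG: "finite G" unfolding G_def by simp
      have "card G \<le> card (G - Z) + card Z"
        using card_Un_le[of "G - Z" Z] card_mono[of "(G - Z) \<union> Z" G] fG by (auto simp: Z_def)
      then have "real (card G) \<le> real (card (G - Z)) + real (card Z)" by linarith
      moreover have "real L ^ j / T = real L ^ j / (2 * T) + real L ^ j / (2 * T)" by (simp add: field_simps)
      ultimately have cGZ: "real (card (G - Z)) \<ge> real L ^ j / (2 * T)" using cG cZ by linarith
      have sub: "G - Z \<subseteq> {hs \<in> tuples {1..L} j. dist_to_int (fact d * \<gamma> * real (prod_list hs)) \<le> T / real L}"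
      proof
        fix hs assume hs: "hs \<in> G - Z"
        then have h: "set hs \<subseteq> {..<L}" "length hs = j" "0 \<notin> set hs" by (auto simp: G_def Z_def tuples_def)
        have "h \<in> {1..L}" if "h \<in> set hs" for h using h that by (cases h) (auto)
        with h have t1: "hs \<in> tuples {1..L} j" by (auto simp: tuples_def)
        have len: "length hs = j" using t1 by (simp add: tuples_def)
        define Q where "Q = polydiff hs P"
        have Q: "degree Q \<le> 1" "coeff Q 1 = fact d * real (prod_list hs) * \<gamma>"
          using polydiff_coeff[OF deg, of hs] len by (auto simp: dj Q_def \<gamma>_def)
        have polyQ: "poly Q y = coeff Q 0 + coeff Q 1 * y" for y
        proof -
          have "Q = [:coeff Q 0, coeff Q 1:]"
            using Q(1) by (intro poly_eqI) (auto simp: coeff_pCons coeff_eq_0 split: nat.splits)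
          then show ?thesis by (metis poly_pCons poly_0 mult.commute add.right_neutral mult_zero_right)
        qed
        have "(\<Sum>n<L. multdiff hs F n) = (\<Sum>n<x - sum_list hs. unit_exp (coeff Q 0 + coeff Q 1 * real n))"
          unfolding F_def multdiff_phase polyQ[symmetric] Q_def[symmetric]
          using x by (intro sum.mono_neutral_cong_right) auto
        then have "dist_to_int (coeff Q 1) * W hs \<le> 1"
          unfolding W_def using geometric_sum_bound by simp
        moreover have "dist_to_int (coeff Q 1) * (real L / T) \<le> dist_to_int (coeff Q 1) * W hs"
          using hs by (intro mult_left_mono) (auto simp: G_def)
        ultimately have "dist_to_int (coeff Q 1) * (real L / T) \<le> 1" by linarith
        then have "dist_to_int (coeff Q 1) \<le> T / real L" using T2 L by (simp add: field_simps)
        then show "hs \<in> {hs \<in> tuples {1..L} j. dist_to_int (fact d * \<gamma> * real (prod_list hs)) \<le> T / real L}"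
          using t1 Q(2) by (simp add: mult_ac)
      qed
      have "\<exists>q\<ge>1. real q \<le> (2 * T) ^ V \<and> dist_to_int (fact d * \<gamma> * real q) \<le> (2 * T) ^ V * (T / real L) / real L ^ j"
      proof (rule V[OF _ L])
        show "T / real L * (2 * T) ^ V \<le> 1" using LT L by (simp add: field_simps)
        have "card (G - Z) \<le> card {hs \<in> tuples {1..L} j. dist_to_int (fact d * \<gamma> * real (prod_list hs)) \<le> T / real L}"
          by (rule card_mono[OF _ sub]) simp
        then show "real L ^ j / (2 * T) \<le> real (card {hs \<in> tuples {1..L} j. dist_to_int (fact d * \<gamma> * real (prod_list hs)) \<le> T / real L})"
          using cGZ by linarith
      qed (use T2 in auto)
      then obtain q where q: "q \<ge> 1" "real q \<le> (2 * T) ^ V" "dist_to_int (fact d * \<gamma> * real q) \<le> (2 * T) ^ V * (T / real L) / real L ^ j" by blast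
      have TV: "(2 * T) ^ V \<le> R ^ (t * V)" using T2R T2 by (simp only: power_mult) (intro power_mono, auto)
      show ?thesis
      proof (intro exI[of _ "fact d * q"] conjI)
        show "1 \<le> fact d * q" using q by simp
        have "real (fact d * q) \<le> R ^ fact d * R ^ (t * V)"
          unfolding of_nat_mult using real_le_power_self[OF R, of "fact d"] q TV R by (intro mult_mono) auto
        also have "\<dots> = R ^ (fact d + t * V)" by (simp add: power_add)
        also have "\<dots> \<le> R ^ C" by (intro pw) (simp add: C_def)
        finally show "real (fact d * q) \<le> R ^ C" .
        have "dist_to_int (real (fact d * q) * coeff P d) \<le> (2 * T) ^ V * (T / real L) / real L ^ j" using q(3) by (simp add: mult_ac \<gamma>_def)
        also have "\<dots> = (2 * T) ^ V * T / real L ^ d" by (simp add: dj)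
        also have "\<dots> \<le> R ^ (t * V) * R ^ t / real L ^ d"
          using TV T2R T2 R by (intro divide_right_mono mult_mono) auto
        also have "\<dots> = R ^ (t * (V + 1)) / real L ^ d" by (simp add: power_add[symmetric] add.commute)
        also have "\<dots> \<le> R ^ C / real L ^ d" by (intro divide_right_mono pw) (auto simp: C_def)
        finally show "dist_to_int (real (fact d * q) * coeff P d) \<le> R ^ C / real L ^ d" .
      qed
    qed
  qed
qed

lemma abel_summation_bound:
  fixes a w :: "nat \<Rightarrow> complex"
  assumes M: "\<And>y. y \<le> x \<Longrightarrow> norm (\<Sum>n<y. a n) \<le> M" and w: "norm (w x) \<le> 1"
    and V: "(\<Sum>n<x. norm (w (Suc n) - w n)) \<le> V"
  shows "norm (\<Sum>n<x. a n * w n) \<le> M * (1 + V)"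
proof -
  have M0: "M \<ge> 0" using M[of 0] by simp
  have eq: "(\<Sum>n<x. a n * w n) = (\<Sum>n<x. a n) * w x - (\<Sum>n<x. (\<Sum>m<Suc n. a m) * (w (Suc n) - w n))"
    by (induction x) (simp_all add: algebra_simps)
  have "norm (\<Sum>n<x. (\<Sum>m<Suc n. a m) * (w (Suc n) - w n)) \<le> (\<Sum>n<x. M * norm (w (Suc n) - w n))"
  proof (rule sum_norm_le)
    fix n assume "n \<in> {..<x}"
    then show "norm ((\<Sum>m<Suc n. a m) * (w (Suc n) - w n)) \<le> M * norm (w (Suc n) - w n)"
      unfolding norm_mult by (intro mult_right_mono M) auto
  qed
  also have "\<dots> \<le> M * V" unfolding sum_distrib_left[symmetric] by (intro mult_left_mono V M0)
  finally have 1: "norm (\<Sum>n<x. (\<Sum>m<Suc n. a m) * (w (Suc n) - w n)) \<le> M * V" .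
  have 2: "norm ((\<Sum>n<x. a n) * w x) \<le> M * 1"
    unfolding norm_mult using M[of x] w M0 by (intro mult_mono) auto
  show ?thesis unfolding eq using norm_triangle_ineq4[of "(\<Sum>n<x. a n) * w x" "\<Sum>n<x. (\<Sum>m<Suc n. a m) * (w (Suc n) - w n)"] 1 2
    by (simp add: algebra_simps)
qed

lemma additive_characters_detect:
  fixes m :: int and q :: nat
  assumes q: "q \<ge> 1"
  shows "(\<Sum>b<q. unit_exp (real b * (of_int m / real q))) = (if int q dvd m then of_nat q else 0)"
proof (cases "int q dvd m")
  case True
  then obtain k where m: "m = int q * k" by blast
  have "unit_exp (real b * (of_int m / real q)) = 1" for b
    using unit_exp_of_int[of "int b * k"] q by (simp add: m)
  then show ?thesis using True by simp
next
  case False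
  define z where "z = unit_exp (of_int m / real q)"
  have zq: "z ^ q = 1"
    unfolding z_def unit_exp_of_nat_mult[symmetric] using q by simp
  have "z \<noteq> 1"
  proof
    assume "z = 1"
    then have "dist_to_int (of_int m / real q) \<le> 0"
      using norm_unit_exp_minus_1_ge[of "of_int m / real q"] by (simp add: z_def)
    then obtain k where "of_int m / real q = of_int k"
      by (auto simp: dist_to_int_eq_round)
    then have "real_of_int m = real_of_int (int q * k)" using q by (simp add: field_simps)
    then have "m = int q * k" using of_int_eq_iff by blast
    then show False using False by simp
  qed
  moreover have "(z - 1) * (\<Sum>b<q. z ^ b) = z ^ q - 1" by (rule power_diff_1_eq[symmetric])
  ultimately have "(\<Sum>b<q. z ^ b) = 0" using zq by simp
  then show ?thesis using False by (simp only: z_def unit_exp_of_nat_mult if_False)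
qed

text \<open>
The first factor of the summand has period \<open>q\<close>, so it is a combination of the \<open>q\<close> additive
characters modulo \<open>q\<close> with coefficients of modulus at most \<open>1\<close>. Trading it for a linear phase
keeps the summation over an interval and leaves the other coefficients of the phase as they are.
\<close>
lemma remove_rational_monomial:
  fixes a :: "nat \<Rightarrow> complex" and p :: int and q d :: nat
  assumes q: "q \<ge> 1"
  shows "\<exists>b<q. norm (\<Sum>n<x. a n * unit_exp (of_int p / real q * real n ^ d)) \<le>
    real q * norm (\<Sum>n<x. a n * unit_exp (real b / real q * real n))"
proof -
  define c where "c r = unit_exp (of_int p / real q * real r ^ d)" for r :: nat
  define X where "X b = (\<Sum>n<x. a n * unit_exp (real b / real q * real n))" for b :: nat
  have per: "c n = c (n mod q)" for n
  proof -
    have "int q dvd int n ^ d - int (n mod q) ^ d"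
      by (metis mod_eq_dvd_iff of_nat_mod of_nat_power power_mod)
    then obtain k where k: "int n ^ d - int (n mod q) ^ d = int q * k" by blast
    then have k': "real n ^ d - real (n mod q) ^ d = real q * of_int k"
      by (metis of_int_diff of_int_mult of_int_of_nat_eq of_int_power)
    have "of_int p / real q * real n ^ d = of_int p / real q * real (n mod q) ^ d + of_int p / real q * (real n ^ d - real (n mod q) ^ d)"
      by (simp add: algebra_simps)
    also have "of_int p / real q * (real n ^ d - real (n mod q) ^ d) = of_int (p * k)"
      unfolding k' using q by simp
    finally show ?thesis unfolding c_def by (simp only: unit_exp_add_int)
  qed
  have expand: "of_nat q * c n = (\<Sum>r<q. \<Sum>b<q. c r * unit_exp (- (real b / real q * real r)) * unit_exp (real b / real q * real n))" for n
  proof -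
    have "(\<Sum>b<q. c r * unit_exp (- (real b / real q * real r)) * unit_exp (real b / real q * real n))
      = (if r = n mod q then of_nat q * c r else 0)" if "r < q" for r
    proof -
      have "(\<Sum>b<q. c r * unit_exp (- (real b / real q * real r)) * unit_exp (real b / real q * real n))
        = c r * (\<Sum>b<q. unit_exp (real b * (of_int (int n - int r) / real q)))"
        by (simp add: sum_distrib_left mult.assoc diff_divide_distrib algebra_simps flip: unit_exp_add)
      also have "\<dots> = c r * (if int q dvd int n - int r then of_nat q else 0)"
        by (simp only: additive_characters_detect[OF q])
      also have "int q dvd int n - int r \<longleftrightarrow> r = n mod q"
        using that by (metis mod_eq_dvd_iff mod_less of_nat_eq_iff of_nat_mod)
      finally show ?thesis by simp
    qed
    then have "(\<Sum>r<q. \<Sum>b<q. c r * unit_exp (- (real b / real q * real r)) * unit_exp (real b / real q * real n))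
       = (\<Sum>r<q. if r = n mod q then of_nat q * c r else 0)" by simp
    also have "\<dots> = of_nat q * c n" using q by (simp add: per[of n])
    finally show ?thesis by simp
  qed
  have "of_nat q * (\<Sum>n<x. a n * c n) = (\<Sum>n<x. \<Sum>r<q. \<Sum>b<q. c r * unit_exp (- (real b / real q * real r)) * (a n * unit_exp (real b / real q * real n)))"
    by (simp add: sum_distrib_left expand mult.left_commute[of _ "a _"] mult.assoc)
  also have "\<dots> = (\<Sum>r<q. \<Sum>b<q. c r * unit_exp (- (real b / real q * real r)) * X b)"
    unfolding X_def sum_distrib_left by (subst sum.swap, rule sum.cong[OF refl], subst sum.swap, rule refl)
  finally have eq: "of_nat q * (\<Sum>n<x. a n * c n) = (\<Sum>r<q. \<Sum>b<q. c r * unit_exp (- (real b / real q * real r)) * X b)" .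
  define B where "B = Max ((\<lambda>b. norm (X b)) ` {..<q})"
  have "B \<in> (\<lambda>b. norm (X b)) ` {..<q}" unfolding B_def using q by (intro Max_in) (auto simp: lessThan_empty_iff)
  then obtain b where b: "b < q" "B = norm (X b)" by auto
  have le: "norm (X b') \<le> B" if "b' < q" for b' unfolding B_def using that by (intro Max_ge) auto
  have "real q * norm (\<Sum>n<x. a n * c n) = norm (of_nat q * (\<Sum>n<x. a n * c n))" by (simp add: norm_mult)
  also have "\<dots> \<le> (\<Sum>r<q. \<Sum>b<q. B)"
    unfolding eq by (intro sum_norm_le) (auto simp: norm_mult c_def le)
  also have "\<dots> = real q * (real q * B)" by simp
  finally have "norm (\<Sum>n<x. a n * c n) \<le> real q * B" using q by (simp add: mult_le_cancel_left_pos)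
  then show ?thesis using b unfolding X_def c_def by auto
qed

lemma variation_slow_phase:
  "(\<Sum>n<x. norm (unit_exp (\<theta> * real (Suc n) ^ d) - unit_exp (\<theta> * real n ^ d))) \<le> 2 * pi * \<bar>\<theta>\<bar> * real x ^ d"
proof -
  have "(\<Sum>n<x. norm (unit_exp (\<theta> * real (Suc n) ^ d) - unit_exp (\<theta> * real n ^ d)))
      \<le> (\<Sum>n<x. 2 * pi * \<bar>\<theta>\<bar> * (real (Suc n) ^ d - real n ^ d))"
  proof (rule sum_mono)
    fix n
    have "real n ^ d \<le> real (Suc n) ^ d" by (intro power_mono) auto
    then have "\<bar>\<theta> * real (Suc n) ^ d - \<theta> * real n ^ d\<bar> = \<bar>\<theta>\<bar> * (real (Suc n) ^ d - real n ^ d)"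
      by (simp add: right_diff_distrib[symmetric] abs_mult del: of_nat_Suc)
    with norm_unit_exp_diff[of "\<theta> * real (Suc n) ^ d" "\<theta> * real n ^ d"]
    show "norm (unit_exp (\<theta> * real (Suc n) ^ d) - unit_exp (\<theta> * real n ^ d)) \<le> 2 * pi * \<bar>\<theta>\<bar> * (real (Suc n) ^ d - real n ^ d)"
      by (simp only: mult.assoc)
  qed
  also have "\<dots> = 2 * pi * \<bar>\<theta>\<bar> * (real x ^ d - 0 ^ d)"
    unfolding sum_distrib_left[symmetric] by (subst sum_lessThan_telescope) simp
  also have "\<dots> \<le> 2 * pi * \<bar>\<theta>\<bar> * real x ^ d" by (intro mult_left_mono) auto
  finally show ?thesis .
qed

text \<open>
Induction on the degree. Once the top coefficient is known to be \<open>p / q + \<theta>\<close>, the phase \<open>e(p n\<^sup>d / q)\<close>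
is traded for \<open>e(b n / q)\<close>, and \<open>e(\<theta> n\<^sup>d)\<close>, whose variation on \<open>[0, L]\<close> is bounded by a power of \<open>R\<close>, is
removed by Abel summation. This is what makes initial segments \<open>n < x\<close> appear. The coefficient of
\<open>n\<close> in the remaining polynomial is off by \<open>b / q\<close>, which multiplication by \<open>q\<close> makes an integer.
\<close>
lemma weyl_all_coefficients:
  assumes "d \<ge> 1"
  shows "\<exists>C::nat. \<forall>R L P x. R \<ge> (2::real) \<and> L \<ge> 1 \<and> degree P \<le> d \<and> x \<le> L \<and>
     norm (\<Sum>n<x. unit_exp (poly P (real n))) \<ge> real L / R
     \<longrightarrow> (\<exists>q\<ge>1. real q \<le> R ^ C \<and> (\<forall>j\<in>{1..d}. dist_to_int (real q * coeff P j) \<le> R ^ C / real L ^ j))"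
  using assms
proof (induction d rule: nat_induct_at_least)
  case base
  from weyl_top_coefficient[of 1] show ?case by simp
next
  case (Suc d)
  obtain C1 where C1: "\<And>R L P x. R \<ge> (2::real) \<Longrightarrow> L \<ge> 1 \<Longrightarrow> degree P \<le> Suc d \<Longrightarrow> x \<le> L \<Longrightarrow>
     norm (\<Sum>n<x. unit_exp (poly P (real n))) \<ge> real L / R
     \<Longrightarrow> (\<exists>q\<ge>1. real q \<le> R ^ C1 \<and> dist_to_int (real q * coeff P (Suc d)) \<le> R ^ C1 / real L ^ Suc d)"
  proof -
    have "Suc d \<ge> 1" by simp
    from weyl_top_coefficient[OF this] show ?thesis using that by blast
  qed
  obtain C2 where C2: "\<And>R L P x. R \<ge> (2::real) \<Longrightarrow> L \<ge> 1 \<Longrightarrow> degree P \<le> d \<Longrightarrow> x \<le> L \<Longrightarrow>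
     norm (\<Sum>n<x. unit_exp (poly P (real n))) \<ge> real L / R
     \<Longrightarrow> (\<exists>q\<ge>1. real q \<le> R ^ C2 \<and> (\<forall>j\<in>{1..d}. dist_to_int (real q * coeff P j) \<le> R ^ C2 / real L ^ j))"
    using Suc.IH by blast
  define C where "C = C1 + (2 * C1 + 4) * C2"
  show ?case
  proof (rule exI[of _ C], intro allI impI)
    fix R :: real and L x :: nat and P :: "real poly"
    assume asm: "R \<ge> (2::real) \<and> L \<ge> 1 \<and> degree P \<le> Suc d \<and> x \<le> L \<and>
     norm (\<Sum>n<x. unit_exp (poly P (real n))) \<ge> real L / R"
    then have R: "R \<ge> 2" and L: "L \<ge> 1" and deg: "degree P \<le> Suc d" and x: "x \<le> L"
      and large: "norm (\<Sum>n<x. unit_exp (poly P (real n))) \<ge> real L / R" by auto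
    define \<gamma> where "\<gamma> = coeff P (Suc d)"
    obtain q0 where q0: "q0 \<ge> 1" "real q0 \<le> R ^ C1" "dist_to_int (real q0 * \<gamma>) \<le> R ^ C1 / real L ^ Suc d"
      using C1[OF R L deg x large] unfolding \<gamma>_def by blast
    obtain p where p: "dist_to_int (real q0 * \<gamma>) = \<bar>real q0 * \<gamma> - of_int p\<bar>" by (rule dist_to_int_obtain)
    define \<theta> where "\<theta> = (real q0 * \<gamma> - of_int p) / real q0"
    have gam: "\<gamma> = of_int p / real q0 + \<theta>" using q0 by (simp add: \<theta>_def field_simps)
    have th: "\<bar>\<theta>\<bar> \<le> R ^ C1 / real L ^ Suc d"
    proof -
      have "\<bar>\<theta>\<bar> = dist_to_int (real q0 * \<gamma>) / real q0" using q0 by (simp add: \<theta>_def p)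
      also have "\<dots> \<le> dist_to_int (real q0 * \<gamma>) / 1" using q0 by (intro divide_left_mono) auto
      finally show ?thesis using q0 by simp
    qed
    define P0 where "P0 = P - monom \<gamma> (Suc d)"
    have deg0: "degree P0 \<le> d"
    proof (rule degree_le, intro allI impI)
      fix i assume "d < i"
      then show "coeff P0 i = 0" using deg by (cases "i = Suc d") (auto simp: P0_def \<gamma>_def coeff_eq_0)
    qed
    have split: "unit_exp (poly P (real n)) = (unit_exp (poly P0 (real n)) * unit_exp (\<theta> * real n ^ Suc d)) * unit_exp (of_int p / real q0 * real n ^ Suc d)" for n
      by (simp add: P0_def poly_monom gam algebra_simps flip: unit_exp_add)
    obtain b where b: "b < q0" and bl: "norm (\<Sum>n<x. unit_exp (poly P (real n))) \<le>
       real q0 * norm (\<Sum>n<x. (unit_exp (poly P0 (real n)) * unit_exp (\<theta> * real n ^ Suc d)) * unit_exp (real b / real q0 * real n))"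
      using remove_rational_monomial[OF q0(1), where x = x and p = p and d = "Suc d"
          and a = "\<lambda>n. unit_exp (poly P0 (real n)) * unit_exp (\<theta> * real n ^ Suc d)"]
      unfolding split by blast
    define P1 where "P1 = P0 + [:0, real b / real q0:]"
    have deg1: "degree P1 \<le> d"
      unfolding P1_def using deg0 Suc.hyps by (intro degree_add_le) (auto simp: degree_pCons_eq_if)
    have P1e: "(unit_exp (poly P0 (real n)) * unit_exp (\<theta> * real n ^ Suc d)) * unit_exp (real b / real q0 * real n)
        = unit_exp (poly P1 (real n)) * unit_exp (\<theta> * real n ^ Suc d)" for n
      by (simp add: P1_def mult_ac flip: unit_exp_add) (simp add: add_ac)
    define R' where "R' = R ^ (2 * C1 + 4)"
    have R': "R' \<ge> 2"
    proof -
      have "R ^ 1 \<le> R'" unfolding R'_def using R by (intro power_increasing) auto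
      then show ?thesis using R by simp
    qed
    have "\<exists>y\<le>x. norm (\<Sum>n<y. unit_exp (poly P1 (real n))) \<ge> real L / R'"
    proof (rule ccontr)
      assume "\<not> ?thesis"
      then have M: "norm (\<Sum>n<y. unit_exp (poly P1 (real n))) < real L / R'" if "y \<le> x" for y using that by auto
      have ex: "\<exists>M<real L / R'. \<forall>y\<le>x. norm (\<Sum>n<y. unit_exp (poly P1 (real n))) \<le> M"
      proof -
        let ?S = "(\<lambda>y. norm (\<Sum>n<y. unit_exp (poly P1 (real n)))) ` {..x}"
        have "Max ?S \<in> ?S" by (intro Max_in) auto
        then have "Max ?S < real L / R'" using M by auto
        moreover have "\<forall>y\<le>x. norm (\<Sum>n<y. unit_exp (poly P1 (real n))) \<le> Max ?S" by (auto intro!: Max_ge)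
        ultimately show ?thesis by blast
      qed
      then obtain M where Mlt: "M < real L / R'" and M: "\<And>y. y \<le> x \<Longrightarrow> norm (\<Sum>n<y. unit_exp (poly P1 (real n))) \<le> M" by blast
      have M0: "M \<ge> 0" using M[of 0] by simp
      have V: "(\<Sum>n<x. norm (unit_exp (\<theta> * real (Suc n) ^ Suc d) - unit_exp (\<theta> * real n ^ Suc d))) \<le> 7 * R ^ C1"
      proof -
        have "(\<Sum>n<x. norm (unit_exp (\<theta> * real (Suc n) ^ Suc d) - unit_exp (\<theta> * real n ^ Suc d))) \<le> 2 * pi * \<bar>\<theta>\<bar> * real x ^ Suc d"
          by (rule variation_slow_phase)
        also have "\<dots> \<le> 7 * (R ^ C1 / real L ^ Suc d) * real L ^ Suc d"
          using th x pi_less_4 pi_approx by (intro mult_mono power_mono) auto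
        also have "\<dots> = 7 * R ^ C1" using L by simp
        finally show ?thesis .
      qed
      have "norm (\<Sum>n<x. unit_exp (poly P1 (real n)) * unit_exp (\<theta> * real n ^ Suc d)) \<le> M * (1 + 7 * R ^ C1)"
        by (rule abel_summation_bound[OF M _ V]) auto
      then have "real q0 * norm (\<Sum>n<x. unit_exp (poly P1 (real n)) * unit_exp (\<theta> * real n ^ Suc d)) \<le> R ^ C1 * (M * (1 + 7 * R ^ C1))"
        using q0 R by (intro mult_mono) auto
      then have "real L / R \<le> R ^ C1 * (M * (1 + 7 * R ^ C1))" using large bl unfolding P1e by linarith
      also have "1 + 7 * R ^ C1 \<le> R ^ (C1 + 3)"
      proof -
        have "(2::real) ^ 3 \<le> R ^ 3" using R by (intro power_mono) auto
        moreover have "1 \<le> R ^ C1" using R by (intro one_le_power) auto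
        ultimately have "8 * R ^ C1 \<le> R ^ 3 * R ^ C1" by (intro mult_right_mono) auto
        moreover have "R ^ (C1 + 3) = R ^ 3 * R ^ C1" by (simp only: power_add mult.commute)
        ultimately show ?thesis using \<open>1 \<le> R ^ C1\<close> by linarith
      qed
      then have "R ^ C1 * (M * (1 + 7 * R ^ C1)) \<le> R ^ C1 * (M * R ^ (C1 + 3))"
        using M0 R by (intro mult_left_mono) auto
      finally have "real L / R * R \<le> R ^ C1 * (M * R ^ (C1 + 3)) * R" using R by (intro mult_right_mono) auto
      moreover have "R' = R ^ C1 * R ^ (C1 + 3) * R"
      proof -
        have "2 * C1 + 4 = C1 + (C1 + 3) + 1" by simp
        then show ?thesis unfolding R'_def by (simp only: power_add power_one_right)
      qed
      ultimately have "real L \<le> M * R'" using R by (simp add: mult_ac)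
      moreover have "M * R' < real L" using Mlt R' by (simp add: field_simps)
      ultimately show False by linarith
    qed
    then obtain y where y: "y \<le> x" "norm (\<Sum>n<y. unit_exp (poly P1 (real n))) \<ge> real L / R'" by blast
    obtain q' where q': "q' \<ge> 1" "real q' \<le> R' ^ C2" "\<And>j. j \<in> {1..d} \<Longrightarrow> dist_to_int (real q' * coeff P1 j) \<le> R' ^ C2 / real L ^ j"
      using C2[OF R' L deg1 _ y(2)] y(1) x by auto
    have RC: "R ^ C1 * R' ^ C2 = R ^ C" by (simp only: C_def R'_def power_add[of R C1 "(2 * C1 + 4) * C2"] power_mult)
    show "\<exists>q\<ge>1. real q \<le> R ^ C \<and> (\<forall>j\<in>{1..Suc d}. dist_to_int (real q * coeff P j) \<le> R ^ C / real L ^ j)"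
    proof (intro exI[of _ "q0 * q'"] conjI ballI)
      show "1 \<le> q0 * q'" using q0 q' by simp
      show "real (q0 * q') \<le> R ^ C" unfolding RC[symmetric] of_nat_mult using q0 q' R by (intro mult_mono) auto
      fix j assume j: "j \<in> {1..Suc d}"
      show "dist_to_int (real (q0 * q') * coeff P j) \<le> R ^ C / real L ^ j"
      proof (cases "j = Suc d")
        case True
        have "dist_to_int (real (q0 * q') * coeff P j) \<le> real q' * dist_to_int (real q0 * \<gamma>)"
          using dist_to_int_mult_nat[of q' "real q0 * \<gamma>"] by (simp add: True \<gamma>_def mult_ac)
        also have "\<dots> \<le> R' ^ C2 * (R ^ C1 / real L ^ Suc d)" using q0 q' R' by (intro mult_mono) auto
        finally show ?thesis by (simp add: RC[symmetric] True mult_ac)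
      next
        case False
        then have jd: "j \<in> {1..d}" using j by auto
        have "\<exists>k::int. real (q0 * q') * coeff P j = real q0 * (real q' * coeff P1 j) + of_int k"
        proof (cases "j = 1")
          case True
          have "coeff P1 j = coeff P j + real b / real q0" using jd by (simp add: P1_def P0_def True)
          then have "real (q0 * q') * coeff P j = real q0 * (real q' * coeff P1 j) + of_int (- (int q' * int b))"
            using q0 by (simp add: algebra_simps)
          then show ?thesis by blast
        next
          case j1: False
          then have "coeff P1 j = coeff P j" using jd by (auto simp: P1_def P0_def coeff_pCons split: nat.splits)
          then show ?thesis by (intro exI[of _ 0]) simp
        qed
        then have "dist_to_int (real (q0 * q') * coeff P j) = dist_to_int (real q0 * (real q' * coeff P1 j))" by auto
        also have "\<dots> \<le> real q0 * dist_to_int (real q' * coeff P1 j)" by (rule dist_to_int_mult_nat)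
        also have "\<dots> \<le> R ^ C1 * (R' ^ C2 / real L ^ j)" using q0 q'(3)[OF jd] R by (intro mult_mono) auto
        finally show ?thesis by (simp add: RC[symmetric])
      qed
    qed
  qed
qed

section \<open>Large exponential sums over boxes of dilates\<close>

text \<open>
For a good \<open>v\<close>, many \<open>u\<close> have many \<open>e\<close>. Recurrence in the variable \<open>e\<close> frees \<open>\<theta> (u\<^sup>j - v\<^sup>j)\<close> from the
factor \<open>e\<^sup>j\<close> at the cost of a bounded multiplier; after pigeonholing that multiplier, recurrence in \<open>u\<close>
with \<open>v\<close> frozen frees \<open>\<theta>\<close> itself.
\<close>
lemma triple_recurrence:
  assumes j: "j \<ge> 1"
  shows "\<exists>C::nat. \<forall>R E U B \<theta> \<epsilon>. R \<ge> (2::real) \<and> E \<ge> 1 \<and> U \<ge> 1 \<and>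
     B \<subseteq> {(e, u, v). e \<in> {1..E} \<and> u \<in> {1..U} \<and> v \<in> {1..U} \<and> u \<noteq> v} \<and>
     real (card B) \<ge> real E * real U ^ 2 / R \<and> \<epsilon> \<ge> 0 \<and> \<epsilon> * R ^ C \<le> 1 \<and>
     (\<forall>(e, u, v)\<in>B. dist_to_int (\<theta> * real e ^ j * (real u ^ j - real v ^ j)) \<le> \<epsilon>)
     \<longrightarrow> (\<exists>q\<ge>1. real q \<le> R ^ C \<and> dist_to_int (\<theta> * real q) \<le> R ^ C * \<epsilon> / (real E * real U) ^ j)"
proof -
  obtain M :: nat where M0: "\<forall>R A S \<theta> c \<epsilon>. R \<ge> 2 \<and> A \<ge> 1 \<and> S \<subseteq> {0..A} \<and> card S \<ge> 2 \<and> real (card S) \<ge> real A / R \<and>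
     \<epsilon> \<ge> 0 \<and> \<epsilon> * R ^ M \<le> (1::real) \<and> (\<forall>a\<in>S. dist_to_int (\<theta> * real a ^ j - c) \<le> \<epsilon>)
     \<longrightarrow> (\<exists>q\<ge>1. real q \<le> R ^ M \<and> dist_to_int (\<theta> * real q) \<le> R ^ M * \<epsilon> / real A ^ j)"
    using monomial_recurrence[OF j] by (rule exE)
  have M: "R \<ge> 2 \<Longrightarrow> A \<ge> 1 \<Longrightarrow> S \<subseteq> {0..A} \<Longrightarrow> card S \<ge> 2 \<Longrightarrow> real (card S) \<ge> real A / R \<Longrightarrow>
     \<epsilon> \<ge> 0 \<Longrightarrow> \<epsilon> * R ^ M \<le> (1::real) \<Longrightarrow> \<forall>a\<in>S. dist_to_int (\<theta> * real a ^ j - c) \<le> \<epsilon>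
     \<Longrightarrow> (\<exists>q\<ge>1. real q \<le> R ^ M \<and> dist_to_int (\<theta> * real q) \<le> R ^ M * \<epsilon> / real A ^ j)"
    for R A S \<theta> c \<epsilon>
    by (rule M0[THEN spec, THEN spec, THEN spec, THEN spec, THEN spec, THEN spec, THEN mp]) (intro conjI; assumption)
  define C where "C = 3 * M + 3 * (M + 1) * M"
  show ?thesis
  proof (rule exI[of _ C], intro allI impI)
    fix R \<theta> \<epsilon> :: real and E U :: nat and B
    assume "R \<ge> (2::real) \<and> E \<ge> 1 \<and> U \<ge> 1 \<and>
     B \<subseteq> {(e, u, v). e \<in> {1..E} \<and> u \<in> {1..U} \<and> v \<in> {1..U} \<and> u \<noteq> v} \<and>
     real (card B) \<ge> real E * real U ^ 2 / R \<and> \<epsilon> \<ge> 0 \<and> \<epsilon> * R ^ C \<le> 1 \<and>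
     (\<forall>(e, u, v)\<in>B. dist_to_int (\<theta> * real e ^ j * (real u ^ j - real v ^ j)) \<le> \<epsilon>)"
    then have R: "R \<ge> 2" and E: "E \<ge> 1" and U: "U \<ge> 1"
      and B: "B \<subseteq> {(e, u, v). e \<in> {1..E} \<and> u \<in> {1..U} \<and> v \<in> {1..U} \<and> u \<noteq> v}"
      and cB: "real (card B) \<ge> real E * real U ^ 2 / R" and e0: "\<epsilon> \<ge> 0" and small: "\<epsilon> * R ^ C \<le> 1"
      and near0: "\<forall>(e, u, v)\<in>B. dist_to_int (\<theta> * real e ^ j * (real u ^ j - real v ^ j)) \<le> \<epsilon>"
      by simp_all
    have near: "dist_to_int (\<theta> * real e ^ j * (real u ^ j - real v ^ j)) \<le> \<epsilon>" if "(e, u, v) \<in> B" for e u v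
      using bspec[OF near0 that] by simp
    have pw: "R ^ a \<le> R ^ b" if "a \<le> b" for a b using R that by (intro power_increasing) auto
    define R1 where "R1 = 4 * R"
    have R1: "R1 \<ge> 2" "R1 \<le> R ^ 3"
    proof -
      show "R1 \<ge> 2" using R by (simp add: R1_def)
      have "(2::real)^2 \<le> R^2" using R by (intro power_mono) auto
      then have "4 * R \<le> R^2 * R" using R by (intro mult_right_mono) auto
      then show "R1 \<le> R ^ 3" by (simp add: R1_def power3_eq_cube power2_eq_square)
    qed
    obtain v where v: "v \<in> {1..U}" and cv: "real (card {p \<in> {1..U} \<times> {1..E}. (snd p, fst p, v) \<in> B}) \<ge> real (card ({1..U} \<times> {1..E})) / (2 * R)"
    proof -
      have "bij_betw (\<lambda>(v, u, e). (e, u, v)) {(v, p). v \<in> {1..U} \<and> p \<in> {1..U} \<times> {1..E} \<and> (snd p, fst p, v) \<in> B} B"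
        by (rule bij_betw_byWitness[where f' = "\<lambda>(e, u, v). (v, u, e)"]) (use B in auto)
      then have "card {(v, p). v \<in> {1..U} \<and> p \<in> {1..U} \<times> {1..E} \<and> (snd p, fst p, v) \<in> B} = card B"
        by (rule bij_betw_same_card)
      then have "real (card {1..U}) * real (card ({1..U} \<times> {1..E})) / R \<le> real (card {(v, p). v \<in> {1..U} \<and> p \<in> {1..U} \<times> {1..E} \<and> (snd p, fst p, v) \<in> B})"
        using cB by (simp add: power2_eq_square mult_ac)
      then have "real (card {1..U}) / (2 * R) \<le> real (card {v \<in> {1..U}. real (card ({1..U} \<times> {1..E})) / (2 * R) \<le> real (card {p \<in> {1..U} \<times> {1..E}. (snd p, fst p, v) \<in> B})})"
        by (intro popular_fibres[where A = "{1..U}" and B = "{1..U} \<times> {1..E}" and P = "\<lambda>v p. (snd p, fst p, v) \<in> B"])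
           (use R E U in auto)
      moreover have "real (card {1..U}) / (2 * R) > 0" using R U by simp
      ultimately have "card {v \<in> {1..U}. real (card ({1..U} \<times> {1..E})) / (2 * R) \<le> real (card {p \<in> {1..U} \<times> {1..E}. (snd p, fst p, v) \<in> B})} \<noteq> 0"
        by linarith
      then have "{v \<in> {1..U}. real (card ({1..U} \<times> {1..E})) / (2 * R) \<le> real (card {p \<in> {1..U} \<times> {1..E}. (snd p, fst p, v) \<in> B})} \<noteq> {}"
        by (metis card.empty)
      then show ?thesis using that by blast
    qed
    define Us where "Us = {u \<in> {1..U}. real (card {e \<in> {1..E}. (e, u, v) \<in> B}) \<ge> real (card {1..E}) / (2 * (2 * R))}"
    have cUs: "real (card Us) \<ge> real (card {1..U}) / (2 * (2 * R))"
      unfolding Us_def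
    proof (rule popular_fibres[where P = "\<lambda>u e. (e, u, v) \<in> B"])
      have "{(a, b). a \<in> {1..U} \<and> b \<in> {1..E} \<and> (b, a, v) \<in> B} = {p \<in> {1..U} \<times> {1..E}. (snd p, fst p, v) \<in> B}" by auto
      then show "real (card {1..U}) * real (card {1..E}) / (2 * R) \<le> real (card {(a, b). a \<in> {1..U} \<and> b \<in> {1..E} \<and> (b, a, v) \<in> B})"
        using cv by (simp del: card_atLeastAtMost add: card_cartesian_product)
    qed (use R E in auto)
    have CR1: "R1 ^ M \<le> R ^ (3 * M)" using R1 by (simp add: power_mult power_mono)
    have "\<exists>q. 1 \<le> q \<and> real q \<le> R1 ^ M \<and> dist_to_int (\<theta> * (real u ^ j - real v ^ j) * real q) \<le> R1 ^ M * \<epsilon> / real E ^ j" if u: "u \<in> Us" for u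
    proof -
      \<comment> \<open>Adjoining 0, where the monomial vanishes, gives the two elements that the recurrence lemma asks for.\<close>
      define S where "S = {e \<in> {1..E}. (e, u, v) \<in> B}"
      have cS: "real (card S) \<ge> real E / R1" using u by (simp add: Us_def S_def R1_def)
      have fS: "finite S" by (simp add: S_def)
      have S0: "card (insert 0 S) = card S + 1" using fS by (subst card_insert_disjoint) (auto simp: S_def)
      have "real E / R1 > 0" using E R1 by simp
      then have "card S \<noteq> 0" using cS by linarith
      have "\<exists>q\<ge>1. real q \<le> R1 ^ M \<and> dist_to_int (\<theta> * (real u ^ j - real v ^ j) * real q) \<le> R1 ^ M * \<epsilon> / real E ^ j"
      proof (rule M[where S = "insert 0 S" and c = 0])
        show "insert 0 S \<subseteq> {0..E}" by (auto simp: S_def)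
        show "card (insert 0 S) \<ge> 2" using S0 \<open>card S \<noteq> 0\<close> by linarith
        show "real (card (insert 0 S)) \<ge> real E / R1" using S0 cS by linarith
        have "\<epsilon> * R1 ^ M \<le> \<epsilon> * R ^ (3 * M)" using CR1 e0 by (intro mult_left_mono)
        also have "\<dots> \<le> \<epsilon> * R ^ C" using e0 by (intro mult_left_mono pw) (auto simp: C_def)
        finally show "\<epsilon> * R1 ^ M \<le> 1" using small by linarith
        have "dist_to_int (\<theta> * (real u ^ j - real v ^ j) * real a ^ j - 0) \<le> \<epsilon>" if "a \<in> insert 0 S" for a
        proof (cases "a = 0")
          case False
          then have "dist_to_int (\<theta> * real a ^ j * (real u ^ j - real v ^ j)) \<le> \<epsilon>"
            using that near[of a u v] by (simp add: S_def)
          moreover have "\<theta> * (real u ^ j - real v ^ j) * real a ^ j - 0 = \<theta> * real a ^ j * (real u ^ j - real v ^ j)"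
            by (simp add: algebra_simps)
          ultimately show ?thesis by (simp only:)
        qed (use j e0 in \<open>simp add: power_0_left\<close>)
        then show "\<forall>a\<in>insert 0 S. dist_to_int (\<theta> * (real u ^ j - real v ^ j) * real a ^ j - 0) \<le> \<epsilon>" by blast
      qed (use R1 E e0 in auto)
      then show ?thesis by blast
    qed
    then obtain f where f: "\<And>u. u \<in> Us \<Longrightarrow> 1 \<le> f u \<and> real (f u) \<le> R1 ^ M \<and> dist_to_int (\<theta> * (real u ^ j - real v ^ j) * real (f u)) \<le> R1 ^ M * \<epsilon> / real E ^ j"
      by metis
    have fUs: "finite Us" unfolding Us_def by simp
    obtain q1 where q1: "1 \<le> q1" "real q1 \<le> R1 ^ M" "real (card {u \<in> Us. f u = q1}) \<ge> real (card Us) / R1 ^ M"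
      
    proof (rule pigeonhole_value[OF fUs, of f "R1 ^ M"])
      show "1 \<le> f u \<and> real (f u) \<le> R1 ^ M" if "u \<in> Us" for u using f[OF that] by blast
    qed (use R1 in \<open>auto intro!: one_le_power\<close>)
    define W where "W = {u \<in> Us. f u = q1}"
    define R2 where "R2 = R1 ^ (M + 1)"
    have R2: "R2 \<ge> 2" "R2 ^ M \<le> R ^ (3 * (M + 1) * M)"
    proof -
      have "R1 ^ 1 \<le> R2" unfolding R2_def using R1 by (intro power_increasing) auto
      then show "R2 \<ge> 2" using R1 by simp
      have "R2 \<le> (R ^ 3) ^ (M + 1)" unfolding R2_def using R1 by (intro power_mono) auto
      then have "R2 ^ M \<le> ((R ^ 3) ^ (M + 1)) ^ M" using \<open>R2 \<ge> 2\<close> by (intro power_mono) auto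
      then show "R2 ^ M \<le> R ^ (3 * (M + 1) * M)" by (simp only: power_mult)
    qed
    have cW: "real (card W) \<ge> real U / R2"
    proof -
      have "real U / R2 = real U / R1 / R1 ^ M" by (simp add: R2_def)
      also have "\<dots> \<le> real (card Us) / R1 ^ M" using cUs R1 by (intro divide_right_mono) (auto simp: R1_def)
      finally show ?thesis using q1 by (simp add: W_def)
    qed
    define \<epsilon>' where "\<epsilon>' = R1 ^ M * \<epsilon> / real E ^ j"
    have e'0: "\<epsilon>' \<ge> 0" using R1 e0 by (simp add: \<epsilon>'_def)
    have e'1: "\<epsilon>' \<le> R1 ^ M * \<epsilon>"
      unfolding \<epsilon>'_def using E R1 e0 divide_left_mono[of 1 "real E ^ j" "R1 ^ M * \<epsilon>"] by simp
    have RC: "R1 ^ M * R2 ^ M \<le> R ^ C"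
    proof -
      have "R1 ^ M * R2 ^ M \<le> R ^ (3 * M) * R ^ (3 * (M + 1) * M)" using CR1 R2 R1 R by (intro mult_mono) auto
      then show ?thesis by (simp only: C_def power_add)
    qed
    \<comment> \<open>At u = v the value is exactly c, so v may be adjoined to W; again this provides a second element.\<close>
    have vW: "v \<notin> W"
    proof
      assume "v \<in> W"
      then have "real (card {e \<in> {1..E}. (e, v, v) \<in> B}) \<ge> real (card {1..E}) / (2 * (2 * R))" by (auto simp: W_def Us_def)
      moreover have "{e \<in> {1..E}. (e, v, v) \<in> B} = {}" using B by auto
      ultimately have "real E / (2 * (2 * R)) \<le> 0" by (simp only: card.empty card_atLeastAtMost) simp
      then show False using E R by (simp add: field_simps)
    qed
    have fW: "finite W" unfolding W_def using fUs by simp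
    have cvW: "card (insert v W) = card W + 1" using fW vW by simp
    have "\<exists>q\<ge>1. real q \<le> R2 ^ M \<and> dist_to_int (\<theta> * real q1 * real q) \<le> R2 ^ M * \<epsilon>' / real U ^ j"
    proof (rule M[where S = "insert v W" and c = "\<theta> * real q1 * real v ^ j"])
      show "insert v W \<subseteq> {0..U}" using v by (auto simp: W_def Us_def)
      have "real U / R2 > 0" using U R2 by simp
      then have "card W \<noteq> 0" using cW by linarith
      then show "card (insert v W) \<ge> 2" using cvW by linarith
      show "real (card (insert v W)) \<ge> real U / R2" using cvW cW by linarith
      have "\<epsilon>' * R2 ^ M \<le> (R1 ^ M * \<epsilon>) * R2 ^ M" using e'1 R2 by (intro mult_right_mono) auto
      also have "\<dots> = \<epsilon> * (R1 ^ M * R2 ^ M)" by simp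
      also have "\<dots> \<le> \<epsilon> * R ^ C" using RC e0 by (intro mult_left_mono)
      finally show "\<epsilon>' * R2 ^ M \<le> 1" using small by linarith
      have "dist_to_int (\<theta> * real q1 * real a ^ j - \<theta> * real q1 * real v ^ j) \<le> \<epsilon>'" if "a \<in> insert v W" for a
      proof (cases "a = v")
        case False
        then have "a \<in> Us" "f a = q1" using that by (auto simp: W_def)
        from f[OF this(1)] this(2) have "dist_to_int (\<theta> * (real a ^ j - real v ^ j) * real q1) \<le> \<epsilon>'" by (simp add: \<epsilon>'_def)
        then show ?thesis by (simp add: algebra_simps)
      qed (simp add: e'0)
      then show "\<forall>a\<in>insert v W. dist_to_int (\<theta> * real q1 * real a ^ j - \<theta> * real q1 * real v ^ j) \<le> \<epsilon>'" by blast
    qed (use R2 U e'0 in auto)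
    then obtain q2 where q2: "q2 \<ge> 1" "real q2 \<le> R2 ^ M" "dist_to_int (\<theta> * real q1 * real q2) \<le> R2 ^ M * \<epsilon>' / real U ^ j" by blast
    show "\<exists>q\<ge>1. real q \<le> R ^ C \<and> dist_to_int (\<theta> * real q) \<le> R ^ C * \<epsilon> / (real E * real U) ^ j"
    proof (intro exI[of _ "q1 * q2"] conjI)
      show "1 \<le> q1 * q2" using q1 q2 by simp
      have "real (q1 * q2) \<le> R1 ^ M * R2 ^ M" unfolding of_nat_mult using q1 q2 R1 by (intro mult_mono) auto
      then show "real (q1 * q2) \<le> R ^ C" using RC by linarith
      have "dist_to_int (\<theta> * real (q1 * q2)) \<le> R2 ^ M * \<epsilon>' / real U ^ j" using q2(3) by (simp add: mult_ac)
      also have "\<dots> = (R1 ^ M * R2 ^ M) * \<epsilon> / (real E * real U) ^ j" by (simp add: \<epsilon>'_def power_mult_distrib)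
      also have "\<dots> \<le> R ^ C * \<epsilon> / (real E * real U) ^ j" using RC e0 by (intro divide_right_mono mult_right_mono) auto
      finally show "dist_to_int (\<theta> * real (q1 * q2)) \<le> R ^ C * \<epsilon> / (real E * real U) ^ j" .
    qed
  qed
qed

definition dilate_sum :: "real poly \<Rightarrow> nat \<Rightarrow> nat \<Rightarrow> nat \<Rightarrow> complex" where
  "dilate_sum g a b x = (\<Sum>n<x. unit_exp (poly g (real (a * n)) - poly g (real (b * n))))"

text \<open>
The phases along the multiples of \<open>e u\<close> and of \<open>e v\<close> correlate by more than the fraction \<open>1 / R\<close> of
their common length. Initial segments are admitted because the sums to be estimated run
over intervals and are differences of two of them.
\<close>
definition exceptional :: "real poly \<Rightarrow> nat \<Rightarrow> real \<Rightarrow> nat \<Rightarrow> nat \<Rightarrow> nat \<Rightarrow> bool" where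
  "exceptional g N R e u v \<longleftrightarrow> u \<noteq> v \<and> 1 \<le> e \<and> 1 \<le> u \<and> 1 \<le> v \<and> e * max u v \<le> N \<and>
     (\<exists>x \<le> N div (e * max u v) + 1. norm (dilate_sum g (e * u) (e * v) x) > real N / (R * real (e * max u v)))"

definition exceptional_box :: "real poly \<Rightarrow> nat \<Rightarrow> real \<Rightarrow> nat \<Rightarrow> nat \<Rightarrow> (nat \<times> nat \<times> nat) set" where
  "exceptional_box g N R E U = {(e, u, v). e \<in> {1..E} \<and> u \<in> {1..U} \<and> v \<in> {1..U} \<and> exceptional g N R e u v}"

lemma finite_exceptional_box [simp]: "finite (exceptional_box g N R E U)"
  by (rule finite_subset[of _ "{1..E} \<times> {1..U} \<times> {1..U}"]) (auto simp: exceptional_box_def)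

text \<open>
For an exceptional triple Weyl's inequality makes the coefficients \<open>\<beta>\<^sub>j e\<^sup>j (u\<^sup>j - v\<^sup>j)\<close> of the polynomial
\<open>g(e u l) - g(e v l)\<close> nearly rational, with an error of order \<open>(E U / N)\<^sup>j\<close>. One denominator works for a
positive proportion of the triples. The recurrence gains \<open>(E U)\<^sup>-\<^sup>j\<close>, which turns the error into
\<open>N\<^sup>-\<^sup>j\<close>; the product of the multipliers for the various \<open>j\<close> serves all coefficients at once.
\<close>
lemma box_inverse_theorem:
  assumes d: "d \<ge> 1"
  shows "\<exists>C::nat. \<forall>R N g E U. R \<ge> (2::real) \<and> degree g = d \<and> E \<ge> 1 \<and> U \<ge> 1 \<and> R ^ C * real E * real U \<le> real N \<and>
     real (card (exceptional_box g N R E U)) \<ge> real E * real U ^ 2 / R ^ 2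
     \<longrightarrow> (\<exists>q\<ge>1. real q \<le> R ^ C \<and> (\<forall>j\<in>{1..d}. dist_to_int (real q * coeff g j) \<le> R ^ C / real N ^ j))"
proof -
  obtain W where W: "\<And>R L P x. R \<ge> (2::real) \<Longrightarrow> L \<ge> 1 \<Longrightarrow> degree P \<le> d \<Longrightarrow> x \<le> L \<Longrightarrow>
     norm (\<Sum>n<x. unit_exp (poly P (real n))) \<ge> real L / R
     \<Longrightarrow> (\<exists>q\<ge>1. real q \<le> R ^ W \<and> (\<forall>j\<in>{1..d}. dist_to_int (real q * coeff P j) \<le> R ^ W / real L ^ j))"
    using weyl_all_coefficients[OF d] by blast
  define Rec where "Rec j C \<longleftrightarrow> (\<forall>R E U B \<theta> \<epsilon>. R \<ge> (2::real) \<and> E \<ge> 1 \<and> U \<ge> 1 \<and>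
     B \<subseteq> {(e, u, v). e \<in> {1..E} \<and> u \<in> {1..U} \<and> v \<in> {1..U} \<and> u \<noteq> v} \<and>
     real (card B) \<ge> real E * real U ^ 2 / R \<and> \<epsilon> \<ge> 0 \<and> \<epsilon> * R ^ C \<le> 1 \<and>
     (\<forall>(e, u, v)\<in>B. dist_to_int (\<theta> * real e ^ j * (real u ^ j - real v ^ j)) \<le> \<epsilon>)
     \<longrightarrow> (\<exists>q\<ge>1. real q \<le> R ^ C \<and> dist_to_int (\<theta> * real q) \<le> R ^ C * \<epsilon> / (real E * real U) ^ j))"
    for j C :: nat
  have "\<exists>C. Rec j C" if "j \<ge> 1" for j
    unfolding Rec_def by (rule triple_recurrence[OF that])
  then obtain K0 where "\<And>j. j \<ge> 1 \<Longrightarrow> Rec j (K0 j)" by metis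
  then obtain K where Rec: "\<And>j. j \<in> {1..d} \<Longrightarrow> Rec j (K j)" by (metis atLeastAtMost_iff)
  have K: "j \<in> {1..d} \<Longrightarrow> R \<ge> (2::real) \<Longrightarrow> E \<ge> 1 \<Longrightarrow> U \<ge> 1 \<Longrightarrow>
     B \<subseteq> {(e, u, v). e \<in> {1..E} \<and> u \<in> {1..U} \<and> v \<in> {1..U} \<and> u \<noteq> v} \<Longrightarrow>
     real (card B) \<ge> real E * real U ^ 2 / R \<Longrightarrow> \<epsilon> \<ge> 0 \<Longrightarrow> \<epsilon> * R ^ K j \<le> 1 \<Longrightarrow>
     (\<forall>(e, u, v)\<in>B. dist_to_int (\<theta> * real e ^ j * (real u ^ j - real v ^ j)) \<le> \<epsilon>) \<Longrightarrow>
     (\<exists>q\<ge>1. real q \<le> R ^ K j \<and> dist_to_int (\<theta> * real q) \<le> R ^ K j * \<epsilon> / (real E * real U) ^ j)"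
    for j R E U B \<theta> \<epsilon>
    using Rec[of j] unfolding Rec_def by blast
  define w where "w = 2 * W"
  define D where "D j = w + (2 + w) * K j" for j
  define C where "C = (\<Sum>j\<in>{1..d}. D j)"
  have DC: "D j \<le> C" if "j \<in> {1..d}" for j unfolding C_def using that by (intro member_le_sum) auto
  show ?thesis
  proof (rule exI[of _ C], intro allI impI)
    fix R :: real and N E U :: nat and g :: "real poly"
    let ?X = "exceptional_box g N R E U"
    assume "R \<ge> (2::real) \<and> degree g = d \<and> E \<ge> 1 \<and> U \<ge> 1 \<and> R ^ C * real E * real U \<le> real N \<and>
     real (card ?X) \<ge> real E * real U ^ 2 / R ^ 2"
    then have R: "R \<ge> 2" and deg: "degree g = d" and E: "E \<ge> 1" and U: "U \<ge> 1"
      and fit: "R ^ C * real E * real U \<le> real N" and cX: "real (card ?X) \<ge> real E * real U ^ 2 / R ^ 2" by auto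
    have pw: "R ^ a \<le> R ^ b" if "a \<le> b" for a b using R that by (intro power_increasing) auto
    have N: "N \<ge> 1"
    proof -
      have "1 * 1 * 1 \<le> R ^ C * real E * real U" using R E U by (intro mult_mono one_le_power) auto
      then show ?thesis using fit by linarith
    qed
    define \<epsilon> where "\<epsilon> j = R ^ w * (real E * real U / real N) ^ j" for j
    have "\<exists>q. 1 \<le> q \<and> real q \<le> R ^ w \<and> (\<forall>j\<in>{1..d}. dist_to_int (real q * coeff g j * real e ^ j * (real u ^ j - real v ^ j)) \<le> \<epsilon> j)"
      if t: "(e, u, v) \<in> ?X" for e u v
    proof -
      define m where "m = e * max u v"
      define L where "L = N div m + 1"
      obtain x where x: "x \<le> L" "norm (dilate_sum g (e * u) (e * v) x) > real N / (R * real m)"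
        and m: "1 \<le> m" "m \<le> N" and eu: "e \<in> {1..E}" "u \<in> {1..U}" "v \<in> {1..U}"
        using t by (auto simp: exceptional_box_def exceptional_def L_def m_def)
      have mEU: "real m \<le> real E * real U"
      proof -
        have "m \<le> E * U" unfolding m_def using eu by (intro mult_mono) auto
        then show ?thesis by (metis of_nat_le_iff of_nat_mult)
      qed
      have L1: "real N / real m \<le> real L"
      proof -
        have "N \<le> L * m" using dividend_less_div_times[of m N] m by (simp add: L_def)
        then have "real N \<le> real L * real m" by (metis of_nat_le_iff of_nat_mult)
        then show ?thesis using m by (simp add: field_simps)
      qed
      have L2: "real L \<le> 2 * (real N / real m)"
      proof -
        have "real (N div m) \<le> real N / real m" by (rule of_nat_div_le_of_nat)
        moreover have "1 \<le> real N / real m" using m by simp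
        ultimately show ?thesis by (simp add: L_def)
      qed
      define P where "P = pcompose g [:0, real (e * u):] - pcompose g [:0, real (e * v):]"
      have degP: "degree P \<le> d" unfolding P_def
        using degree_pcompose_le[of g "[:0, real (e * u):]"] degree_pcompose_le[of g "[:0, real (e * v):]"] deg
        by (intro degree_diff_le) (auto split: if_splits intro: order_trans)
      have coP: "coeff P j = coeff g j * real e ^ j * (real u ^ j - real v ^ j)" for j
        by (simp add: P_def coeff_pcompose_linear power_mult_distrib algebra_simps)
      have "dilate_sum g (e * u) (e * v) x = (\<Sum>n<x. unit_exp (poly P (real n)))"
        unfolding dilate_sum_def P_def by (simp add: poly_pcompose mult_ac)
      moreover have "real L / R ^ 2 \<le> real N / (R * real m)"
      proof -
        have "real L / R ^ 2 \<le> 2 * (real N / real m) / R ^ 2" using L2 by (intro divide_right_mono) auto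
        also have "\<dots> \<le> R * (real N / real m) / R ^ 2" using R by (intro divide_right_mono mult_right_mono) auto
        also have "\<dots> = real N / (R * real m)" using R by (simp add: power2_eq_square)
        finally show ?thesis .
      qed
      ultimately have "norm (\<Sum>n<x. unit_exp (poly P (real n))) \<ge> real L / R ^ 2" using x by simp
      moreover have "R ^ 2 \<ge> 2" using R pw[of 1 2] by simp
      ultimately obtain q where q: "q \<ge> 1" "real q \<le> (R ^ 2) ^ W" "\<And>j. j \<in> {1..d} \<Longrightarrow> dist_to_int (real q * coeff P j) \<le> (R ^ 2) ^ W / real L ^ j"
        using W[of "R ^ 2" L P x] degP x(1) by (auto simp: L_def)
      have Rw: "(R ^ 2) ^ W = R ^ w" by (simp add: w_def power_mult)
      have "dist_to_int (real q * coeff g j * real e ^ j * (real u ^ j - real v ^ j)) \<le> \<epsilon> j" if j: "j \<in> {1..d}" for j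
      proof -
        have "real q * coeff g j * real e ^ j * (real u ^ j - real v ^ j) = real q * coeff P j" by (simp add: coP)
        then have "dist_to_int (real q * coeff g j * real e ^ j * (real u ^ j - real v ^ j)) \<le> R ^ w / real L ^ j"
          using q(3)[OF j] by (simp only: Rw)
        also have "\<dots> = R ^ w * (1 / real L) ^ j" by (simp add: power_divide)
        also have "\<dots> \<le> \<epsilon> j" unfolding \<epsilon>_def
        proof (intro mult_left_mono power_mono)
          have "1 / real L \<le> real m / real N" using L1 m N by (simp add: field_simps L_def)
          also have "\<dots> \<le> real E * real U / real N" using mEU by (intro divide_right_mono) auto
          finally show "1 / real L \<le> real E * real U / real N" .
        qed (use R in auto)
        finally show ?thesis .
      qed
      then show ?thesis using q Rw by auto
    qed
    then have ex: "\<exists>q. 1 \<le> q \<and> real q \<le> R ^ w \<and> (\<forall>j\<in>{1..d}. dist_to_int (real q * coeff g j * real (fst t) ^ j * (real (fst (snd t)) ^ j - real (snd (snd t)) ^ j)) \<le> \<epsilon> j)"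
      if "t \<in> ?X" for t using that by (cases t) simp
    define f where "f t = (SOME q. 1 \<le> q \<and> real q \<le> R ^ w \<and> (\<forall>j\<in>{1..d}. dist_to_int (real q * coeff g j * real (fst t) ^ j * (real (fst (snd t)) ^ j - real (snd (snd t)) ^ j)) \<le> \<epsilon> j))"
      for t :: "nat \<times> nat \<times> nat"
    have f: "1 \<le> f t \<and> real (f t) \<le> R ^ w \<and> (\<forall>j\<in>{1..d}. dist_to_int (real (f t) * coeff g j * real (fst t) ^ j * (real (fst (snd t)) ^ j - real (snd (snd t)) ^ j)) \<le> \<epsilon> j)"
      if "t \<in> ?X" for t unfolding f_def by (rule someI_ex[OF ex[OF that]])
    have finX: "finite ?X" by simp
    have Rw1: "R ^ w \<ge> 1" using R by (intro one_le_power) auto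
    obtain q0 where q0: "1 \<le> q0" "real q0 \<le> R ^ w" "real (card {t \<in> ?X. f t = q0}) \<ge> real (card ?X) / R ^ w"
    proof (rule pigeonhole_value[OF finX, of f "R ^ w"])
      show "1 \<le> f t \<and> real (f t) \<le> R ^ w" if "t \<in> ?X" for t using f[OF that] by blast
    qed (use Rw1 in auto)
    define B where "B = {t \<in> ?X. f t = q0}"
    define R' where "R' = R ^ (2 + w)"
    have "R ^ 1 \<le> R'" unfolding R'_def by (rule pw) simp
    then have R': "R' \<ge> 2" using R by simp
    have RD: "R' ^ K j * R ^ w = R ^ D j" for j 
      unfolding R'_def D_def power_add[of R w] power_mult by (rule mult.commute)
    have small: "\<epsilon> j * R' ^ K j \<le> 1" if j: "j \<in> {1..d}" for j
    proof -
      have "\<epsilon> j * R' ^ K j = R ^ D j * (real E * real U / real N) ^ j" by (simp add: \<epsilon>_def flip: RD)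
      also have "\<dots> \<le> R ^ C * (real E * real U / real N) ^ 1"
      proof (rule mult_mono)
        show "R ^ D j \<le> R ^ C" by (rule pw[OF DC[OF j]])
        have "1 * (real E * real U) \<le> R ^ C * (real E * real U)" using R by (intro mult_right_mono one_le_power) auto
        then show "(real E * real U / real N) ^ j \<le> (real E * real U / real N) ^ 1"
          using fit N j by (intro power_decreasing) (auto simp: mult.assoc)
      qed (use R in auto)
      also have "\<dots> \<le> 1" using fit N by (simp add: mult.assoc)
      finally show ?thesis .
    qed
    have "\<exists>q. 1 \<le> q \<and> real q \<le> R ^ D j \<and> dist_to_int (real q * coeff g j) \<le> R ^ D j / real N ^ j" if j: "j \<in> {1..d}" for j
    proof -
      have "\<exists>q\<ge>1. real q \<le> R' ^ K j \<and> dist_to_int (real q0 * coeff g j * real q) \<le> R' ^ K j * \<epsilon> j / (real E * real U) ^ j"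
      proof (rule K[OF j R' E U])
        show "B \<subseteq> {(e, u, v). e \<in> {1..E} \<and> u \<in> {1..U} \<and> v \<in> {1..U} \<and> u \<noteq> v}"
          by (auto simp: B_def exceptional_box_def exceptional_def)
        have "real E * real U ^ 2 / R' = real E * real U ^ 2 / R ^ 2 / R ^ w" by (simp add: R'_def power_add power2_eq_square)
        also have "\<dots> \<le> real (card ?X) / R ^ w" using cX Rw1 by (intro divide_right_mono) auto
        finally show "real E * real U ^ 2 / R' \<le> real (card B)" using q0 unfolding B_def by linarith
        show "\<epsilon> j \<ge> 0" using R by (simp add: \<epsilon>_def)
        show "\<epsilon> j * R' ^ K j \<le> 1" by (rule small[OF j])
        show "\<forall>(e, u, v)\<in>B. dist_to_int (real q0 * coeff g j * real e ^ j * (real u ^ j - real v ^ j)) \<le> \<epsilon> j"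
        proof
          fix t assume t: "t \<in> B"
          then have "t \<in> ?X" "f t = q0" by (auto simp only: B_def)
          with f[OF this(1)] j have "dist_to_int (real q0 * coeff g j * real (fst t) ^ j * (real (fst (snd t)) ^ j - real (snd (snd t)) ^ j)) \<le> \<epsilon> j"
            by metis
          then show "case t of (e, u, v) \<Rightarrow> dist_to_int (real q0 * coeff g j * real e ^ j * (real u ^ j - real v ^ j)) \<le> \<epsilon> j"
            by (simp add: case_prod_unfold)
        qed
      qed
      then obtain q where q: "q \<ge> 1" "real q \<le> R' ^ K j" "dist_to_int (real q0 * coeff g j * real q) \<le> R' ^ K j * \<epsilon> j / (real E * real U) ^ j" by blast
      show ?thesis
      proof (intro exI[of _ "q * q0"] conjI)
        show "1 \<le> q * q0" using q q0 by simp
        show "real (q * q0) \<le> R ^ D j" unfolding RD[symmetric] of_nat_mult using q q0 R' by (intro mult_mono) auto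
        have "dist_to_int (real (q * q0) * coeff g j) \<le> R' ^ K j * \<epsilon> j / (real E * real U) ^ j" using q(3) by (simp add: mult_ac)
        also have "\<dots> = R ^ D j / real N ^ j" using E U unfolding RD[symmetric] \<epsilon>_def by (simp add: power_divide)
        finally show "dist_to_int (real (q * q0) * coeff g j) \<le> R ^ D j / real N ^ j" .
      qed
    qed
    then obtain Q where Q: "\<And>j. j \<in> {1..d} \<Longrightarrow> 1 \<le> Q j \<and> real (Q j) \<le> R ^ D j \<and> dist_to_int (real (Q j) * coeff g j) \<le> R ^ D j / real N ^ j"
      by metis
    show "\<exists>q\<ge>1. real q \<le> R ^ C \<and> (\<forall>j\<in>{1..d}. dist_to_int (real q * coeff g j) \<le> R ^ C / real N ^ j)"
    proof (intro exI[of _ "\<Prod>j\<in>{1..d}. Q j"] conjI ballI)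
      have "(\<Prod>j\<in>{1..d}. Q j) \<noteq> 0" using Q by (force simp: prod_zero_iff)
      then show "1 \<le> (\<Prod>j\<in>{1..d}. Q j)" by linarith
      have "real (\<Prod>j\<in>{1..d}. Q j) \<le> (\<Prod>j\<in>{1..d}. R ^ D j)"
        unfolding of_nat_prod using Q by (intro prod_mono) auto
      then show "real (\<Prod>j\<in>{1..d}. Q j) \<le> R ^ C" by (simp only: C_def power_sum)
      fix j assume j: "j \<in> {1..d}"
      have split: "(\<Prod>i\<in>{1..d}. Q i) = Q j * (\<Prod>i\<in>{1..d} - {j}. Q i)" using j by (simp add: prod.remove)
      have "real (\<Prod>i\<in>{1..d} - {j}. Q i) \<le> (\<Prod>i\<in>{1..d} - {j}. R ^ D i)"
        unfolding of_nat_prod using Q by (intro prod_mono) auto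
      then have rest: "real (\<Prod>i\<in>{1..d} - {j}. Q i) \<le> R ^ (\<Sum>i\<in>{1..d} - {j}. D i)" by (simp only: power_sum)
      have "dist_to_int (real (\<Prod>i\<in>{1..d}. Q i) * coeff g j) \<le> real (\<Prod>i\<in>{1..d} - {j}. Q i) * dist_to_int (real (Q j) * coeff g j)"
        using dist_to_int_mult_nat[of "\<Prod>i\<in>{1..d} - {j}. Q i" "real (Q j) * coeff g j"] unfolding split by (simp only: of_nat_mult mult_ac)
      also have "\<dots> \<le> R ^ (\<Sum>i\<in>{1..d} - {j}. D i) * (R ^ D j / real N ^ j)"
        using rest Q[OF j] R by (intro mult_mono) auto
      also have "\<dots> = R ^ C / real N ^ j"
      proof -
        have "C = D j + (\<Sum>i\<in>{1..d} - {j}. D i)" unfolding C_def using j by (intro sum.remove) auto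
        then show ?thesis by (simp add: power_add)
      qed
      finally show "dist_to_int (real (\<Prod>i\<in>{1..d}. Q i) * coeff g j) \<le> R ^ C / real N ^ j" .
    qed
  qed
qed

section \<open>Generalised divisor functions\<close>

text \<open>
The number of ordered factorizations of \<open>n\<close> into \<open>k\<close> factors, for \<open>n \<ge> 1\<close>.
\<close>
primrec tau :: "nat \<Rightarrow> nat \<Rightarrow> nat" where
  "tau 0 n = (if n = 1 then 1 else 0)"
| "tau (Suc k) n = (\<Sum>c | c dvd n. tau k (n div c))"

lemma finite_divisors [simp]: "n \<ge> 1 \<Longrightarrow> finite {c::nat. c dvd n}"
  by (rule finite_divisors_nat) simp

lemma dvd_ge_1: "c dvd n \<Longrightarrow> n \<ge> 1 \<Longrightarrow> c \<ge> (1::nat)"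
  by (auto intro!: Suc_leI Nat.gr0I)

lemma div_ge_1: "c dvd n \<Longrightarrow> n \<ge> 1 \<Longrightarrow> n div c \<ge> (1::nat)"
  by (auto simp: dvd_def)

lemma tau_one [simp]: "tau k (Suc 0) = 1"
  by (induction k) auto

lemma tau_1: "n \<ge> 1 \<Longrightarrow> tau 1 n = 1"
proof -
  assume n: "n \<ge> 1"
  have "tau 1 n = (\<Sum>c | c dvd n. if c = n then 1 else 0)"
    unfolding One_nat_def tau.simps using n by (intro sum.cong refl) (auto simp: dvd_def)
  then show ?thesis using n by simp
qed

text \<open>
A divisor \<open>c\<close> of \<open>x y\<close> is the product of \<open>gcd c x\<close> and a divisor of \<open>y\<close>.
\<close>
lemma tau_submult:
  assumes "x \<ge> 1" "y \<ge> 1"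
  shows "tau k (x * y) \<le> tau k x * tau k y"
  using assms
proof (induction k arbitrary: x y)
  case (Suc k)
  define \<phi> where "\<phi> c = (gcd c x, c div gcd c x)" for c :: nat
  define G where "G = (\<lambda>(a, b). tau k (x div a) * tau k (y div b))"
  have inj: "inj_on \<phi> {c. c dvd x * y}"
    by (rule inj_onI) (metis \<phi>_def dvd_mult_div_cancel gcd_dvd1 prod.inject)
  have key: "gcd c x dvd x \<and> c div gcd c x dvd y \<and> tau k (x * y div c) \<le> G (\<phi> c)" if c: "c dvd x * y" for c
  proof -
    define a where "a = gcd c x"
    define b where "b = c div a"
    have a0: "a > 0" using Suc.prems by (simp add: a_def)
    obtain x' where x': "x = a * x'" using a_def by (metis dvdE gcd_dvd2)
    have cab: "c = a * b" by (simp add: a_def b_def)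
    have x'0: "x' \<ge> 1" using x' Suc.prems by (cases x') auto
    have "a * gcd b x' = gcd c x" by (simp add: cab x' gcd_mult_distrib_nat)
    then have "a * gcd b x' = a" by (simp add: a_def)
    then have "gcd b x' = 1" using a0 by simp
    moreover have "b dvd x' * y" using c a0 unfolding cab x' by (simp add: mult.assoc)
    ultimately have bdy: "b dvd y" by (simp add: coprime_dvd_mult_right_iff coprime_iff_gcd_eq_1)
    then obtain y' where y': "y = b * y'" by blast
    have b0: "b > 0" "y' \<ge> 1" using y' Suc.prems by (auto simp: Suc_le_eq)
    have "x * y div c = x' * y'" using a0 b0 unfolding cab by (simp add: x' y' mult_ac) 
    then have "tau k (x * y div c) \<le> tau k x' * tau k y'" using Suc.IH[OF x'0 b0(2)] by simp
    moreover have "x div a = x'" "y div b = y'" using x' y' a0 b0 by auto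
    ultimately show ?thesis using bdy by (simp add: G_def \<phi>_def a_def[symmetric] b_def[symmetric]) (metis x' dvd_triv_left)
  qed
  have fin: "finite ({a. a dvd x} \<times> {b. b dvd y})" using Suc.prems by simp
  have "tau (Suc k) (x * y) \<le> (\<Sum>c | c dvd x * y. G (\<phi> c))"
    unfolding tau.simps using key by (intro sum_mono) auto
  also have "\<dots> = sum G (\<phi> ` {c. c dvd x * y})" by (simp add: sum.reindex[OF inj])
  also have "\<dots> \<le> sum G ({a. a dvd x} \<times> {b. b dvd y})"
    using key fin by (intro sum_mono2) (auto simp: \<phi>_def)
  also have "\<dots> = tau (Suc k) x * tau (Suc k) y"
    by (simp add: G_def sum_product sum.cartesian_product case_prod_unfold)
  finally show ?case .
qed auto

lemma tau_add:
  assumes "n \<ge> 1"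
  shows "tau (a + b) n = (\<Sum>c | c dvd n. tau a c * tau b (n div c))"
  using assms
proof (induction a arbitrary: n)
  case 0
  have "(\<Sum>c | c dvd n. tau 0 c * tau b (n div c)) = (\<Sum>c | c dvd n. if c = 1 then tau b n else 0)"
    by (intro sum.cong) auto
  then show ?case using 0 by simp
next
  case (Suc a)
  have "tau (Suc a + b) n = (\<Sum>c | c dvd n. \<Sum>e | e dvd n div c. tau a e * tau b (n div c div e))"
  proof -
    have "tau (a + b) (n div c) = (\<Sum>e | e dvd n div c. tau a e * tau b (n div c div e))" if "c dvd n" for c
      using that Suc.prems by (intro Suc.IH) (auto simp: dvd_def)
    then show ?thesis by simp
  qed
  also have "\<dots> = (\<Sum>(c, e)\<in>(SIGMA c:{c. c dvd n}. {e. e dvd n div c}). tau a e * tau b (n div c div e))"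
    using Suc.prems by (intro sum.Sigma ballI finite_divisors div_ge_1) auto
  also have "\<dots> = (\<Sum>(m, c)\<in>(SIGMA m:{m. m dvd n}. {c. c dvd m}). tau a (m div c) * tau b (n div m))"
  proof (rule sum.reindex_bij_witness[of _ "\<lambda>(m, c). (c, m div c)" "\<lambda>(c, e). (c * e, c)"], goal_cases)
    case (1 p)
    then obtain c e where p: "p = (c, e)" "c dvd n" "e dvd n div c" by auto
    then have "c > 0" using Suc.prems by (auto intro!: Nat.gr0I)
    then show ?case using p by simp
  next
    case (2 p)
    then obtain c e where p: "p = (c, e)" "c dvd n" "e dvd n div c" by auto
    then have "c > 0" using Suc.prems by (auto intro!: Nat.gr0I)
    then show ?case using p by (auto simp: dvd_def)
  next
    case (3 p)
    then show ?case by auto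
  next
    case (4 p)
    then obtain m c where p: "p = (m, c)" "m dvd n" "c dvd m" by auto
    then show ?case using Suc.prems by (auto simp: dvd_def)
  next
    case (5 p)
    then obtain c e where p: "p = (c, e)" "c dvd n" "e dvd n div c" by auto
    then have "c > 0" using Suc.prems by (auto intro!: Nat.gr0I)
    then show ?case using p by (simp add: div_mult2_eq)
  qed
  also have "\<dots> = (\<Sum>m | m dvd n. \<Sum>c | c dvd m. tau a (m div c) * tau b (n div m))"
    by (rule sum.Sigma[symmetric]) (use Suc.prems dvd_ge_1[of _ n] in auto)
  also have "\<dots> = (\<Sum>m | m dvd n. tau (Suc a) m * tau b (n div m))"
    by (simp add: sum_distrib_right)
  finally show ?case .
qed

text \<open>
Products and powers of divisor functions are thus controlled by divisor functions with more
factors, whose averages are bounded by powers of harmonic sums.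
\<close>
lemma tau_product_le:
  assumes "n \<ge> 1"
  shows "tau k n * tau l n \<le> tau (k * l) n"
  using assms
proof (induction k arbitrary: n)
  case (Suc k)
  have "tau (Suc k) n * tau l n = (\<Sum>c | c dvd n. tau k (n div c) * tau l n)"
    by (simp add: sum_distrib_right)
  also have "\<dots> \<le> (\<Sum>c | c dvd n. tau l c * tau (k * l) (n div c))"
  proof (rule sum_mono)
    fix c assume "c \<in> {c. c dvd n}"
    then obtain m where n: "n = c * m" by blast
    then have c: "c \<ge> 1" "m \<ge> 1" "n div c = m" using Suc.prems by (auto simp: Suc_le_eq)
    have "tau k m * tau l n \<le> tau k m * (tau l c * tau l m)"
      unfolding n using tau_submult[OF c(1,2)] by (intro mult_left_mono) auto
    also have "\<dots> = tau l c * (tau k m * tau l m)" by simp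
    also have "\<dots> \<le> tau l c * tau (k * l) m" using Suc.IH[OF c(2)] by (intro mult_left_mono) auto
    finally show "tau k (n div c) * tau l n \<le> tau l c * tau (k * l) (n div c)" using c by simp
  qed
  also have "\<dots> = tau (l + k * l) n" by (rule tau_add[symmetric]) (rule Suc.prems)
  finally show ?case by simp
qed auto

lemma tau_power_le:
  assumes "n \<ge> 1"
  shows "tau k n ^ r \<le> tau (k ^ r) n"
proof (induction r)
  case 0
  then show ?case using tau_1[OF assms] by simp
next
  case (Suc r)
  have "tau k n ^ Suc r \<le> tau k n * tau (k ^ r) n" using Suc by simp
  also have "\<dots> \<le> tau (k * k ^ r) n" by (rule tau_product_le[OF assms])
  finally show ?case by simp
qed

definition hsum :: "nat \<Rightarrow> real" where
  "hsum X = (\<Sum>a=1..X. 1 / real a)"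

lemma hsum_nonneg: "hsum X \<ge> 0"
  unfolding hsum_def by (intro sum_nonneg) auto

lemma hsum_mono: "X \<le> Y \<Longrightarrow> hsum X \<le> hsum Y"
  unfolding hsum_def by (intro sum_mono2) auto

lemma hsum_ge_1: "X \<ge> 1 \<Longrightarrow> hsum X \<ge> 1"
  using hsum_mono[of 1 X] by (simp add: hsum_def)

lemma hsum_le: "X \<ge> 1 \<Longrightarrow> hsum X \<le> 1 + ln (real X)"
proof (induction X rule: nat_induct_at_least)
  case base
  then show ?case by (simp add: hsum_def)
next
  case (Suc X)
  have "ln (real X / real (Suc X)) \<le> real X / real (Suc X) - 1"
    using Suc.hyps by (intro ln_le_minus_one) auto
  also have "\<dots> = - 1 / real (Suc X)" by (simp add: field_simps)
  finally have "1 / real (Suc X) \<le> ln (real (Suc X)) - ln (real X)"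
    using Suc.hyps by (subst (asm) ln_div) auto
  moreover have "hsum (Suc X) = hsum X + 1 / real (Suc X)" by (simp add: hsum_def)
  ultimately show ?case using Suc.IH by linarith
qed

lemma sum_tau_div_le: "(\<Sum>n=1..X. real (tau k n) / real n) \<le> hsum X ^ k"
proof (induction k)
  case 0
  have "(\<Sum>n=1..X. real (tau 0 n) / real n) = (\<Sum>n=1..X. if n = 1 then 1 else 0)"
    by (intro sum.cong) auto
  then show ?case by simp
next
  case (Suc k)
  have "(\<Sum>n=1..X. real (tau (Suc k) n) / real n) = (\<Sum>n=1..X. \<Sum>c | c dvd n. real (tau k (n div c)) / real n)"
    by (simp add: sum_divide_distrib)
  also have "\<dots> = (\<Sum>(n, c)\<in>(SIGMA n:{1..X}. {c. c dvd n}). real (tau k (n div c)) / real n)"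
    by (intro sum.Sigma) auto
  also have "\<dots> = (\<Sum>(c, m)\<in>(\<lambda>(n, c). (c, n div c)) ` (SIGMA n:{1..X}. {c. c dvd n}). (1 / real c) * (real (tau k m) / real m))"
  proof (subst sum.reindex)
    show "inj_on (\<lambda>(n, c). (c, n div c)) (SIGMA n:{1..X}. {c. c dvd n})"
      by (auto simp: inj_on_def dvd_def)
    have "real (tau k (n div c)) / real n = 1 / real c * (real (tau k (n div c)) / real (n div c))" if "c dvd n" for n c
      using that by (auto simp: dvd_def)
    then show "(\<Sum>(n, c)\<in>(SIGMA n:{1..X}. {c. c dvd n}). real (tau k (n div c)) / real n) =
       sum ((\<lambda>(c, m). 1 / real c * (real (tau k m) / real m)) \<circ> (\<lambda>(n, c). (c, n div c))) (SIGMA n:{1..X}. {c. c dvd n})"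
      by (intro sum.cong) auto
  qed
  also have "\<dots> \<le> (\<Sum>(c, m)\<in>{1..X} \<times> {1..X}. (1 / real c) * (real (tau k m) / real m))"
  proof (intro sum_mono2)
    show "(\<lambda>(n, c). (c, n div c)) ` (SIGMA n:{1..X}. {c. c dvd n}) \<subseteq> {1..X} \<times> {1..X}"
    proof (clarsimp)
      fix n c assume "Suc 0 \<le> n" "n \<le> X" "c dvd n"
      then show "Suc 0 \<le> c \<and> c \<le> X \<and> Suc 0 \<le> n div c \<and> n div c \<le> X"
        by (metis One_nat_def Suc_leI dvd_imp_le dvd_pos_nat div_le_dividend order.trans div_greater_zero_iff less_eq_Suc_le)
    qed
  qed (auto simp: case_prod_unfold)
  also have "\<dots> = hsum X * (\<Sum>n=1..X. real (tau k n) / real n)"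
    by (simp add: hsum_def sum_product sum.cartesian_product)
  also have "\<dots> \<le> hsum X * hsum X ^ k" by (intro mult_left_mono Suc hsum_nonneg)
  finally show ?case by simp
qed

lemma sum_tau_le: "(\<Sum>n=1..X. real (tau k n)) \<le> real X * hsum X ^ k"
proof -
  have "(\<Sum>n=1..X. real (tau k n)) \<le> (\<Sum>n=1..X. real X * (real (tau k n) / real n))"
  proof (rule sum_mono)
    fix n assume n: "n \<in> {1..X}"
    then have "real n * real (tau k n) \<le> real X * real (tau k n)" by (intro mult_right_mono) auto
    then show "real (tau k n) \<le> real X * (real (tau k n) / real n)" using n by (simp add: field_simps)
  qed
  also have "\<dots> = real X * (\<Sum>n=1..X. real (tau k n) / real n)" by (simp add: sum_distrib_left)
  also have "\<dots> \<le> real X * hsum X ^ k" by (intro mult_left_mono sum_tau_div_le) auto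
  finally show ?thesis .
qed

text \<open>
A single value is bounded by the sum over all values. Large \<open>r\<close> gives the usual divisor bound
\<open>O(n\<^sup>\<epsilon>)\<close>.
\<close>
lemma tau_power_bound:
  assumes "n \<ge> 1" "n \<le> X"
  shows "real (tau k n) ^ r \<le> real X * hsum X ^ (k ^ r)"
proof -
  have "real (tau k n) ^ r \<le> real (tau (k ^ r) n)"
    using tau_power_le[OF assms(1), of k r] by (metis of_nat_le_iff of_nat_power)
  also have "\<dots> \<le> (\<Sum>m=1..X. real (tau (k ^ r) m))" using assms by (intro member_le_sum) auto
  also have "\<dots> \<le> real X * hsum X ^ (k ^ r)" by (rule sum_tau_le)
  finally show ?thesis .
qed

lemma tau_2: "n \<ge> 1 \<Longrightarrow> tau 2 n = card {c. c dvd n}"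
proof -
  assume n: "n \<ge> 1"
  have "tau 1 (n div c) = 1" if "c dvd n" for c using that n by (intro tau_1) (auto simp: dvd_def)
  then have "(\<Sum>c | c dvd n. tau 1 (n div c)) = (\<Sum>c | c dvd n. 1)" by (intro sum.cong) auto
  then show ?thesis by (simp add: numeral_2_eq_2 del: tau.simps(1)) 
qed

lemma sum_tuples_prod_le:
  fixes \<Psi> :: "nat \<Rightarrow> real"
  assumes nn: "\<And>x. \<Psi> x \<ge> 0"
  shows "(\<Sum>ms\<in>tuples {1..N} k. \<Psi> (prod_list ms)) \<le> (\<Sum>x=1..N^k. real (tau k x) * \<Psi> x)"
  using nn
proof (induction k arbitrary: \<Psi>)
  case (Suc k)
  have "(\<Sum>ms\<in>tuples {1..N} (Suc k). \<Psi> (prod_list ms)) = (\<Sum>m=1..N. \<Sum>ms\<in>tuples {1..N} k. \<Psi> (m * prod_list ms))"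
    by (simp add: sum_tuples_Suc)
  also have "\<dots> \<le> (\<Sum>m=1..N. \<Sum>x=1..N^k. real (tau k x) * \<Psi> (m * x))"
    by (intro sum_mono Suc.IH Suc.prems)
  also have "\<dots> = (\<Sum>(m, x)\<in>{1..N} \<times> {1..N^k}. real (tau k x) * \<Psi> (m * x))"
    by (simp add: sum.cartesian_product)
  also have "\<dots> = (\<Sum>(y, c)\<in>(\<lambda>(m, x). (m * x, m)) ` ({1..N} \<times> {1..N^k}). real (tau k (y div c)) * \<Psi> y)"
    by (subst sum.reindex) (auto simp: inj_on_def intro!: sum.cong)
  also have "\<dots> \<le> (\<Sum>(y, c)\<in>(SIGMA y:{1..N^Suc k}. {c. c dvd y}). real (tau k (y div c)) * \<Psi> y)"
    by (intro sum_mono2) (auto simp: case_prod_unfold Suc.prems intro!: mult_le_mono)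
  also have "\<dots> = (\<Sum>y=1..N^Suc k. \<Sum>c | c dvd y. real (tau k (y div c)) * \<Psi> y)"
    by (intro sum.Sigma[symmetric]) auto
  also have "\<dots> = (\<Sum>y=1..N^Suc k. real (tau (Suc k) y) * \<Psi> y)"
    by (simp add: sum_distrib_right)
  finally show ?case .
qed simp

section \<open>Expanding a function of a gcd over divisors\<close>

lemma sum_Pow_minus_one:
  assumes "finite A"
  shows "(\<Sum>S\<in>Pow A. (-1) ^ card S) = (if A = {} then 1 else (0::real))"
  using assms
proof (induction A)
  case (insert x A)
  have "Pow (insert x A) = Pow A \<union> insert x ` Pow A" by (rule Pow_insert)
  moreover have "Pow A \<inter> insert x ` Pow A = {}" using insert.hyps by auto
  ultimately have "(\<Sum>S\<in>Pow (insert x A). (-1) ^ card S) = (\<Sum>S\<in>Pow A. (-1::real) ^ card S) + (\<Sum>S\<in>insert x ` Pow A. (-1) ^ card S)"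
    using insert.hyps by (simp add: sum.union_disjoint)
  also have "(\<Sum>S\<in>insert x ` Pow A. (-1::real) ^ card S) = (\<Sum>S\<in>Pow A. (-1) ^ card (insert x S))"
    by (subst sum.reindex) (use insert.hyps in \<open>auto simp: inj_on_def\<close>)
  also have "\<dots> = (\<Sum>S\<in>Pow A. - ((-1) ^ card S))"
    using insert.hyps by (intro sum.cong refl) (subst card_insert_disjoint, auto intro: finite_subset)
  finally show ?case by (simp add: sum_negf)
qed simp

lemma elem_dvd_prod: "finite S \<Longrightarrow> p \<in> S \<Longrightarrow> p dvd \<Prod>S" for p :: nat
  using dvd_prodI[of S p "\<lambda>x. x"] by simp

lemma prod_primes_dvd_iff:
  fixes n :: nat
  assumes "finite S" "\<And>p. p \<in> S \<Longrightarrow> prime p"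
  shows "\<Prod>S dvd n \<longleftrightarrow> (\<forall>p\<in>S. p dvd n)"
proof
  assume "\<Prod>S dvd n"
  then show "\<forall>p\<in>S. p dvd n" using dvd_trans[OF elem_dvd_prod[OF assms(1)]] by simp
next
  assume all: "\<forall>p\<in>S. p dvd n"
  show "\<Prod>S dvd n"
    using assms(1) all assms(2)
  proof (induction S rule: finite_induct)
    case (insert p S)
    have "coprime p (\<Prod>S)"
      using insert by (intro prod_coprime_right) (metis insertCI primes_coprime)
    then show ?case using insert by (simp add: divides_mult)
  qed simp
qed

lemma prime_factors_prod_primes:
  fixes S :: "nat set"
  assumes "finite S" "\<And>p. p \<in> S \<Longrightarrow> prime p"
  shows "prime_factors (\<Prod>S) = S"
proof -
  have "prime_factors (\<Prod>S) = (\<Union>p\<in>S. prime_factors p)"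
    using assms by (subst prime_factors_prod) (auto dest: prime_gt_0_nat)
  also have "\<dots> = S" using assms by (auto simp: prime_prime_factors)
  finally show ?thesis .
qed

text \<open>
Moebius inversion. The Moebius function appears in the form of a sum over the squarefree divisors,
that is, over the sets of prime factors.
\<close>
lemma divisor_expansion:
  fixes \<Phi> :: "nat \<Rightarrow> real"
  assumes \<Phi>: "\<And>n. \<bar>\<Phi> n\<bar> \<le> 1"
  obtains c :: "nat \<Rightarrow> real" where "\<And>e. e \<ge> 1 \<Longrightarrow> \<bar>c e\<bar> \<le> real (tau 2 e)"
    "\<And>n. n \<ge> 1 \<Longrightarrow> \<Phi> n = (\<Sum>e | e dvd n. c e)"
proof -
  define c where "c e = (\<Sum>S\<in>Pow (prime_factors e). (-1) ^ card S * \<Phi> (e div \<Prod>S))" for e :: nat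
  have 1: "\<bar>c e\<bar> \<le> real (tau 2 e)" if e: "e \<ge> 1" for e
  proof -
    have "\<bar>c e\<bar> \<le> (\<Sum>S\<in>Pow (prime_factors e). 1)"
      unfolding c_def by (rule order_trans[OF sum_abs], rule sum_mono) (simp add: abs_mult \<Phi>)
    also have "\<dots> = real (card (Pow (prime_factors e)))" by simp
    also have "card (Pow (prime_factors e)) \<le> card {c. c dvd e}"
    proof (rule card_inj_on_le)
      show "inj_on (\<lambda>S. \<Prod>S) (Pow (prime_factors e))"
      proof (rule inj_onI)
        fix S T assume "S \<in> Pow (prime_factors e)" "T \<in> Pow (prime_factors e)" "\<Prod>S = \<Prod>T"
        moreover have "prime_factors (\<Prod>X) = X" if "X \<in> Pow (prime_factors e)" for X
          using that by (intro prime_factors_prod_primes) (auto intro: finite_subset)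
        ultimately show "S = T" by metis
      qed
      show "(\<lambda>S. \<Prod>S) ` Pow (prime_factors e) \<subseteq> {c. c dvd e}"
      proof clarsimp
        fix S assume S: "S \<subseteq> prime_factors e"
        then have "finite S" by (rule finite_subset) simp
        then show "\<Prod>S dvd e" using S by (subst prod_primes_dvd_iff) auto
      qed
    qed (use e in simp)
    finally show ?thesis using tau_2[OF e] by simp
  qed
  have 2: "\<Phi> n = (\<Sum>e | e dvd n. c e)" if n: "n \<ge> 1" for n
  proof -
    have "(\<Sum>e | e dvd n. c e) = (\<Sum>(e, S)\<in>(SIGMA e:{e. e dvd n}. Pow (prime_factors e)). (-1) ^ card S * \<Phi> (e div \<Prod>S))"
      unfolding c_def using n by (intro sum.Sigma) auto
    also have "\<dots> = (\<Sum>(b, S)\<in>(SIGMA b:{b. b dvd n}. Pow (prime_factors (n div b))). (-1) ^ card S * \<Phi> b)"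
    proof (rule sum.reindex_bij_witness[of _ "\<lambda>(b, S). (b * \<Prod>S, S)" "\<lambda>(e, S). (e div \<Prod>S, S)"], goal_cases)
      case (1 p)
      then obtain e S where p: "p = (e, S)" "e dvd n" "S \<subseteq> prime_factors e" by auto
      have "finite S" using p(3) by (rule finite_subset) simp
      then have "\<Prod>S dvd e" using p by (subst prod_primes_dvd_iff) auto
      then show ?case using p by simp
    next
      case (2 p)
      then obtain e S where p: "p = (e, S)" "e dvd n" "S \<subseteq> prime_factors e" by auto
      have fS: "finite S" using p(3) by (rule finite_subset) simp
      have "\<Prod>S dvd e" using p fS by (subst prod_primes_dvd_iff) auto
      then obtain b where e: "e = \<Prod>S * b" by blast
      obtain n' where n': "n = e * n'" using p by blast
      have pos: "\<Prod>S > 0" "b > 0" "n' > 0" using n n' e by (auto intro!: Nat.gr0I)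
      have "n div b = \<Prod>S * n'" using pos by (simp add: n' e mult_ac)
      moreover have "p dvd \<Prod>S * n'" if "p \<in> S" for p using elem_dvd_prod[OF fS that] by simp
      ultimately have "S \<subseteq> prime_factors (n div b)" using p pos by (auto simp: in_prime_factors_iff)
      moreover have "e div \<Prod>S = b" "b dvd n" using pos by (auto simp: e n')
      ultimately show ?case using p by simp
    next
      case (3 p)
      then obtain b S where p: "p = (b, S)" "b dvd n" "S \<subseteq> prime_factors (n div b)" by auto
      have "\<Prod>S > 0" using p by (intro prod_pos) (auto dest!: subsetD in_prime_factors_imp_prime intro: prime_gt_0_nat)
      then show ?case using p by simp
    next
      case (4 p)
      then obtain b S where p: "p = (b, S)" "b dvd n" "S \<subseteq> prime_factors (n div b)" by auto
      have fS: "finite S" using p(3) by (rule finite_subset) simp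
      have "\<Prod>S dvd n div b" using p fS by (subst prod_primes_dvd_iff) auto
      then have "b * \<Prod>S dvd n" using p(2) by (metis dvd_div_iff_mult dvd_0_left_iff mult.commute n not_one_le_zero)
      moreover have "S \<subseteq> prime_factors (b * \<Prod>S)"
      proof
        fix x assume x: "x \<in> S"
        then have "x dvd b * \<Prod>S" using elem_dvd_prod[OF fS x] by simp
        moreover have "b * \<Prod>S \<noteq> 0" using \<open>b * \<Prod>S dvd n\<close> n by auto
        ultimately show "x \<in> prime_factors (b * \<Prod>S)" using x p by (auto simp: in_prime_factors_iff)
      qed
      ultimately show ?case using p by simp
    next
      case (5 p)
      then show ?case by auto
    qed
    also have "\<dots> = (\<Sum>b | b dvd n. \<Sum>S\<in>Pow (prime_factors (n div b)). (-1) ^ card S * \<Phi> b)"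
      using n by (intro sum.Sigma[symmetric]) auto
    also have "\<dots> = (\<Sum>b | b dvd n. if b = n then \<Phi> b else 0)"
    proof (rule sum.cong[OF refl])
      fix b assume "b \<in> {b. b dvd n}"
      then obtain m where m: "n = b * m" by blast
      then have pos: "b > 0" "m > 0" using n by (auto intro!: Nat.gr0I)
      have "prime_factors m = {} \<longleftrightarrow> m = 1" using pos prime_factorization_empty_iff[of m] by auto
      then have "(\<Sum>S\<in>Pow (prime_factors (n div b)). (-1) ^ card S) = (if m = 1 then 1 else (0::real))"
        using pos by (simp add: m sum_Pow_minus_one)
      moreover have "b = n \<longleftrightarrow> m = 1" using m pos by auto
      ultimately show "(\<Sum>S\<in>Pow (prime_factors (n div b)). (-1) ^ card S * \<Phi> b) = (if b = n then \<Phi> b else 0)"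
        by (simp flip: sum_distrib_right)
    qed
    also have "\<dots> = \<Phi> n" using n by simp
    finally show ?thesis by simp
  qed
  show ?thesis using that[OF 1 2] by blast
qed

section \<open>Orthogonality of the values of a Steinhaus function\<close>

lemma cnj_borel_measurable [measurable]: "cnj \<in> borel_measurable borel"
  by (intro borel_measurable_continuous_onI continuous_intros)

lemma unit_exp_diff_power: "unit_exp x ^ a * cnj (unit_exp x) ^ b = unit_exp (of_int (int a - int b) * x)"
proof -
  have "unit_exp x ^ a * cnj (unit_exp x) ^ b = unit_exp (real a * x) * unit_exp (real b * (- x))"
    by (simp only: unit_exp_of_nat_mult cnj_unit_exp)
  then show ?thesis by (simp add: algebra_simps flip: unit_exp_add)
qed

lemma integral_unit_exp_int:
  "(LINT x|lborel. indicator {0..1} x *\<^sub>R unit_exp (of_int m * x)) = (if m = 0 then 1 else 0)"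
proof (cases "m = 0")
  case True
  then show ?thesis by simp
next
  case False
  define c where "c = 2 * complex_of_real pi * \<i> * of_int m"
  have c0: "c \<noteq> 0" using False by (simp add: c_def)
  have e: "unit_exp (of_int m * x) = exp (c * of_real x)" for x
    by (simp add: unit_exp_def c_def mult_ac)
  have "has_bochner_integral lborel (\<lambda>x. indicator {0..1} x *\<^sub>R exp (c * of_real x)) (exp (c * of_real 1) / c - exp (c * of_real 0) / c)"
  proof (rule has_bochner_integral_FTC_Icc)
    fix x :: real
    have "((\<lambda>z. exp (c * z) / c) has_field_derivative exp (c * of_real x)) (at (of_real x))"
      using c0 by (auto intro!: derivative_eq_intros)
    from has_vector_derivative_real_field[OF this]
    show "((\<lambda>x. exp (c * of_real x) / c) has_vector_derivative exp (c * of_real x)) (at x within {0..1})"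
      by (simp add: o_def)
  qed (auto intro!: continuous_intros)
  then have "(LINT x|lborel. indicator {0..1} x *\<^sub>R unit_exp (of_int m * x)) = exp (c * of_real 1) / c - exp (c * of_real 0) / c"
    unfolding e by (rule has_bochner_integral_integral_eq)
  also have "exp (c * of_real 1) = 1" using unit_exp_of_int[of m] e[of 1] by simp
  finally show ?thesis using False by simp
qed

lemma integral_uniform_circle:
  fixes h :: "complex \<Rightarrow> complex"
  assumes h: "h \<in> borel_measurable borel"
  shows "integral\<^sup>L uniform_circle h = (LINT x|lborel. indicator {0..1} x *\<^sub>R h (unit_exp x))"
proof -
  have u: "uniform_measure lborel {0..<1::real} = density lborel (\<lambda>x. ennreal (indicator {0..<1} x))"
    unfolding uniform_measure_def by (intro density_cong) (auto split: split_indicator)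
  have [measurable]: "unit_exp \<in> borel_measurable borel" by (rule unit_exp_measurable)
  have "integral\<^sup>L uniform_circle h = (LINT x|uniform_measure lborel {0..<1}. h (unit_exp x))"
    unfolding uniform_circle_def using h by (intro integral_distr) auto
  also have "\<dots> = (LINT x|lborel. indicator {0..<1} x *\<^sub>R h (unit_exp x))"
    unfolding u using h by (intro integral_density) auto
  also have "\<dots> = (LINT x|lborel. indicator {0..1} x *\<^sub>R h (unit_exp x))"
  proof (rule integral_cong_AE)
    show "AE x in lborel. indicator {0..<1} x *\<^sub>R h (unit_exp x) = indicator {0..1} x *\<^sub>R h (unit_exp x)"
      using AE_lborel_singleton[of "1::real"] by eventually_elim (auto split: split_indicator)
  qed (use h in measurable)
  finally show ?thesis .
qed

lemma circle_monomial:
  "integral\<^sup>L uniform_circle (\<lambda>z. z ^ a * cnj z ^ b) = (if a = b then 1 else 0)"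
proof -
  have "integral\<^sup>L uniform_circle (\<lambda>z. z ^ a * cnj z ^ b)
    = (LINT x|lborel. indicator {0..1} x *\<^sub>R (unit_exp x ^ a * cnj (unit_exp x) ^ b))"
    by (rule integral_uniform_circle) measurable
  also have "\<dots> = (if int a - int b = 0 then 1 else 0)"
    unfolding unit_exp_diff_power by (rule integral_unit_exp_int)
  finally show ?thesis by simp
qed

lemma integrable_circle_monomial:
  "integrable uniform_circle (\<lambda>z. z ^ a * cnj z ^ b)"
proof -
  have [measurable]: "unit_exp \<in> borel_measurable borel" by (rule unit_exp_measurable)
  interpret U: prob_space "uniform_measure lborel {0..<1::real}"
    by (rule prob_space_uniform_measure) auto
  have "integrable (uniform_measure lborel {0..<1}) (\<lambda>x. unit_exp x ^ a * cnj (unit_exp x) ^ b)"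
  proof (rule U.integrable_const_bound[of _ 1])
    show "(\<lambda>x. unit_exp x ^ a * cnj (unit_exp x) ^ b) \<in> borel_measurable (uniform_measure lborel {0..<1})"
      by measurable
  qed (simp add: norm_mult norm_power)
  then show ?thesis unfolding uniform_circle_def
    by (subst integrable_distr_eq) (auto simp: measurable_def[symmetric])
qed

context
  fixes M :: "'a measure" and f :: "nat \<Rightarrow> 'a \<Rightarrow> complex"
  assumes st: "steinhaus M f"
begin

lemma st_prob: "prob_space M" using st by (simp add: steinhaus_def)

lemma st_measurable: "prime p \<Longrightarrow> f p \<in> borel_measurable M"
  using st prob_space.indep_vars_def[OF st_prob, of "\<lambda>_. borel" f "{p. prime p}"]
  by (auto simp: steinhaus_def)

lemma st_prod_over:
  assumes "n > 0" "\<omega> \<in> space M" "finite P" "prime_factors n \<subseteq> P" "\<And>p. p \<in> P \<Longrightarrow> prime p"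
  shows "f n \<omega> = (\<Prod>p\<in>P. f p \<omega> ^ multiplicity p n)"
proof -
  have "f n \<omega> = (\<Prod>p\<in>prime_factors n. f p \<omega> ^ multiplicity p n)"
    using st assms by (simp add: steinhaus_def)
  also have "\<dots> = (\<Prod>p\<in>P. f p \<omega> ^ multiplicity p n)"
    using assms by (intro prod.mono_neutral_left) (auto simp: prime_factors_multiplicity)
  finally show ?thesis .
qed

lemma st_mult:
  assumes "m > 0" "n > 0" "\<omega> \<in> space M"
  shows "f (m * n) \<omega> = f m \<omega> * f n \<omega>"
proof -
  define P where "P = prime_factors (m * n)"
  have P: "finite P" "\<And>p. p \<in> P \<Longrightarrow> prime p" "prime_factors m \<subseteq> P" "prime_factors n \<subseteq> P" "prime_factors (m * n) \<subseteq> P"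
    using assms by (auto simp: P_def prime_factors_product)
  have "multiplicity p (m * n) = multiplicity p m + multiplicity p n" if "p \<in> P" for p
    using assms P(2)[OF that] by (intro prime_elem_multiplicity_mult_distrib) auto
  then show ?thesis
    using assms P by (simp add: st_prod_over[where P = P] power_add prod.distrib)
qed

lemma st_one: "\<omega> \<in> space M \<Longrightarrow> f (Suc 0) \<omega> = 1"
  using st by (simp add: steinhaus_def)

lemma st_prod_list:
  assumes "\<omega> \<in> space M" "0 \<notin> set ms"
  shows "f (prod_list ms) \<omega> = (\<Prod>m\<leftarrow>ms. f m \<omega>)"
  using assms(2)
proof (induction ms)
  case (Cons m ms)
  have "prod_list ms > 0" using Cons.prems by (induction ms) auto
  then show ?case using Cons assms(1) by (simp add: st_mult)
qed (simp add: st_one[OF assms(1)])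

text \<open>
The product is a product of monomials in the independent values at primes. The mean of
\<open>z\<^sup>a\<close> times the conjugate of \<open>z\<^sup>b\<close> over the circle is \<open>0\<close> unless \<open>a = b\<close>, so it survives only when \<open>x\<close> and
\<open>y\<close> have the same factorization.
\<close>
lemma st_orthogonal:
  assumes x: "x > 0" and y: "y > 0"
  shows "integrable M (\<lambda>\<omega>. f x \<omega> * cnj (f y \<omega>))"
    and "(LINT \<omega>|M. f x \<omega> * cnj (f y \<omega>)) = (if x = y then 1 else 0)"
proof -
  interpret prob_space M by (rule st_prob)
  define P where "P = prime_factors (x * y)"
  have P: "finite P" "\<And>p. p \<in> P \<Longrightarrow> prime p" "prime_factors x \<subseteq> P" "prime_factors y \<subseteq> P"
    using x y by (auto simp: P_def prime_factors_product)
  define h where "h p z = z ^ multiplicity p x * cnj z ^ multiplicity p y" for p :: nat and z :: complex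
  have hm [measurable]: "h p \<in> borel_measurable borel" for p unfolding h_def by measurable
  have eq: "f x \<omega> * cnj (f y \<omega>) = (\<Prod>p\<in>P. h p (f p \<omega>))" if "\<omega> \<in> space M" for \<omega>
    using x y that P by (simp add: st_prod_over[where P = P] h_def prod.distrib)
  have ind: "indep_vars (\<lambda>_. borel) (\<lambda>p \<omega>. h p (f p \<omega>)) P"
  proof (rule indep_vars_compose2[where X = f and Y = h and M' = "\<lambda>_. borel"])
    have "indep_vars (\<lambda>_. borel) f {p. prime p}" using st by (simp add: steinhaus_def)
    then show "indep_vars (\<lambda>_. borel) f P" by (rule indep_vars_subset) (use P(2) in auto)
  qed simp
  have dist: "distr M borel (f p) = uniform_circle" if "p \<in> P" for p
    using st P(2)[OF that] by (simp add: steinhaus_def)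
  have int: "integrable M (\<lambda>\<omega>. h p (f p \<omega>))" if "p \<in> P" for p
  proof -
    have "integrable (distr M borel (f p)) (h p)"
      unfolding dist[OF that] h_def by (rule integrable_circle_monomial)
    then show ?thesis
      using st_measurable[OF P(2)[OF that]] by (subst (asm) integrable_distr_eq) auto
  qed
  have val: "(LINT \<omega>|M. h p (f p \<omega>)) = (if multiplicity p x = multiplicity p y then 1 else 0)" if "p \<in> P" for p
  proof -
    have "(LINT \<omega>|M. h p (f p \<omega>)) = integral\<^sup>L (distr M borel (f p)) (h p)"
      using st_measurable[OF P(2)[OF that]] by (intro integral_distr[symmetric]) auto
    then show ?thesis unfolding dist[OF that] h_def circle_monomial .
  qed
  have "integrable M (\<lambda>\<omega>. \<Prod>p\<in>P. h p (f p \<omega>))"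
    using indep_vars_integrable[OF P(1) ind int] .
  then show "integrable M (\<lambda>\<omega>. f x \<omega> * cnj (f y \<omega>))"
    by (subst Bochner_Integration.integrable_cong[OF refl eq]) auto
  have "(LINT \<omega>|M. f x \<omega> * cnj (f y \<omega>)) = (LINT \<omega>|M. (\<Prod>p\<in>P. h p (f p \<omega>)))"
    by (intro Bochner_Integration.integral_cong refl eq)
  also have "\<dots> = (\<Prod>p\<in>P. (LINT \<omega>|M. h p (f p \<omega>)))"
    by (rule indep_vars_lebesgue_integral[OF P(1) ind int])
  also have "\<dots> = (\<Prod>p\<in>P. if multiplicity p x = multiplicity p y then 1 else 0)"
    by (intro prod.cong refl val)
  also have "\<dots> = (if x = y then 1 else 0)"
  proof (cases "x = y")
    case False
    have "\<exists>p\<in>P. multiplicity p x \<noteq> multiplicity p y"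
    proof (rule ccontr)
      assume "\<not> ?thesis"
      then have inP: "multiplicity p x = multiplicity p y" if "p \<in> P" for p using that by blast
      have "multiplicity p x = multiplicity p y" if "prime p" for p
      proof (cases "p \<in> P")
        case False
        then have "p \<notin> prime_factors x" "p \<notin> prime_factors y" using P(3,4) by blast+
        then show ?thesis using that by (simp add: prime_factors_multiplicity)
      qed (rule inP)
      from multiplicity_eq_nat[OF x y this] have "x = y" .
      then show False using False by simp
    qed
    then show ?thesis using False P(1) by (auto simp: prod_zero_iff)
  qed simp
  finally show "(LINT \<omega>|M. f x \<omega> * cnj (f y \<omega>)) = (if x = y then 1 else 0)" .
qed

end

section \<open>Moments as weighted counts of multiplicative coincidences\<close>

definition weight :: "(nat \<Rightarrow> complex) \<Rightarrow> nat list \<Rightarrow> complex" where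
  "weight a ms = (\<Prod>m\<leftarrow>ms. a m)"

definition weighted_reps :: "(nat \<Rightarrow> complex) \<Rightarrow> nat \<Rightarrow> nat \<Rightarrow> nat \<Rightarrow> complex" where
  "weighted_reps a N k x = (\<Sum>ms\<in>tuples {1..N} k. if prod_list ms = x then weight a ms else 0)"

text \<open>
For unimodular coefficients \<open>a\<close> this is the \<open>2k\<close>-th absolute moment of \<open>\<Sum>\<^sub>n\<^sub>\<le>\<^sub>N a(n) f(n)\<close>, with \<open>f\<close> a
Steinhaus function.
\<close>
definition moment :: "(nat \<Rightarrow> complex) \<Rightarrow> nat \<Rightarrow> nat \<Rightarrow> complex" where
  "moment a N k = (\<Sum>ms\<in>tuples {1..N} k. cnj (weight a ms) * weighted_reps a N k (prod_list ms))"

lemma power_sum_tuples: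
  fixes b :: "'b \<Rightarrow> complex"
  shows "(\<Sum>n\<in>A. b n) ^ k = (\<Sum>ms\<in>tuples A k. \<Prod>m\<leftarrow>ms. b m)"
  by (induction k) (simp_all add: sum_tuples_Suc sum_product)

lemma zero_notin_tuples: "ms \<in> tuples {1..N} k \<Longrightarrow> 0 \<notin> set ms" for N :: nat
proof -
  assume "ms \<in> tuples {1..N} k"
  then have "set ms \<subseteq> {1..N}" by (simp add: tuples_def)
  moreover have "0 \<notin> {1..N}" by simp
  ultimately show ?thesis by blast
qed

lemma prod_list_pos: "0 \<notin> set ms \<Longrightarrow> prod_list ms > (0::nat)"
  by (induction ms) auto

lemma expectation_eq_moment:
  assumes st: "steinhaus M f" and N: "N \<ge> 1"
  shows "complex_of_real (LINT \<omega>|M. norm (normalized_sum f g N \<omega>) ^ (2 * s))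
    = moment (\<lambda>n. unit_exp (poly g (real n))) N s / of_nat N ^ s"
proof -
  interpret prob_space M using st by (simp add: steinhaus_def)
  define a where "a = (\<lambda>n. unit_exp (poly g (real n)))"
  define X where "X \<omega> = (\<Sum>n=1..N. f n \<omega> * a n)" for \<omega>
  have nX: "normalized_sum f g N \<omega> = of_real (1 / sqrt (real N)) * X \<omega>" for \<omega>
    by (simp add: normalized_sum_def X_def a_def)
  have Xs: "X \<omega> ^ s = (\<Sum>ms\<in>tuples {1..N} s. weight a ms * f (prod_list ms) \<omega>)" if "\<omega> \<in> space M" for \<omega>
  proof -
    have "(\<Prod>m\<leftarrow>ms. f m \<omega> * a m) = weight a ms * (\<Prod>m\<leftarrow>ms. f m \<omega>)" for ms
      by (induction ms) (auto simp: weight_def)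
    then show ?thesis unfolding X_def power_sum_tuples
      using st_prod_list[OF st that zero_notin_tuples] by (intro sum.cong) auto
  qed
  have pt: "complex_of_real (norm (normalized_sum f g N \<omega>) ^ (2 * s)) =
      (\<Sum>ns\<in>tuples {1..N} s. \<Sum>ms\<in>tuples {1..N} s. (weight a ns * cnj (weight a ms) / of_nat N ^ s) * (f (prod_list ns) \<omega> * cnj (f (prod_list ms) \<omega>)))"
    if "\<omega> \<in> space M" for \<omega>
  proof -
    have "complex_of_real (norm (normalized_sum f g N \<omega>) ^ (2 * s)) = (of_real ((norm (normalized_sum f g N \<omega>))\<^sup>2)) ^ s"
      by (simp add: power_mult)
    also have "of_real ((norm (normalized_sum f g N \<omega>))\<^sup>2) = normalized_sum f g N \<omega> * cnj (normalized_sum f g N \<omega>)"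
      by (simp add: complex_norm_square del: of_real_power)
    also have "\<dots> = X \<omega> * cnj (X \<omega>) / of_nat N"
    proof -
      define c where "c = complex_of_real (1 / sqrt (real N))"
      have "c * c = complex_of_real (1 / real N)" unfolding c_def by (simp flip: of_real_mult of_real_divide)
      then have cc: "c * c = 1 / of_nat N" by simp
      have "cnj c = c" by (simp only: c_def complex_cnj_complex_of_real)
      then have "normalized_sum f g N \<omega> * cnj (normalized_sum f g N \<omega>) = (c * c) * (X \<omega> * cnj (X \<omega>))"
        by (simp only: nX c_def[symmetric] complex_cnj_mult mult_ac)
      then show ?thesis by (simp add: cc)
    qed
    also have "\<dots> ^ s = X \<omega> ^ s * cnj (X \<omega> ^ s) / of_nat N ^ s"
      by (simp add: power_mult_distrib power_divide)
    also have "\<dots> = (\<Sum>ns\<in>tuples {1..N} s. \<Sum>ms\<in>tuples {1..N} s. (weight a ns * cnj (weight a ms) / of_nat N ^ s) * (f (prod_list ns) \<omega> * cnj (f (prod_list ms) \<omega>)))"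
      unfolding Xs[OF that] cnj_sum sum_product sum_divide_distrib by (simp add: mult_ac)
    finally show ?thesis .
  qed
  have pos: "prod_list ms > 0" if "ms \<in> tuples {1..N} s" for ms
    using prod_list_pos zero_notin_tuples that by blast
  have "complex_of_real (LINT \<omega>|M. norm (normalized_sum f g N \<omega>) ^ (2 * s)) =
      (LINT \<omega>|M. complex_of_real (norm (normalized_sum f g N \<omega>) ^ (2 * s)))"
    by (rule integral_complex_of_real[symmetric])
  also have "\<dots> = (LINT \<omega>|M. (\<Sum>ns\<in>tuples {1..N} s. \<Sum>ms\<in>tuples {1..N} s. (weight a ns * cnj (weight a ms) / of_nat N ^ s) * (f (prod_list ns) \<omega> * cnj (f (prod_list ms) \<omega>))))"
    by (intro Bochner_Integration.integral_cong refl pt)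
  also have "\<dots> = (\<Sum>ns\<in>tuples {1..N} s. \<Sum>ms\<in>tuples {1..N} s. (weight a ns * cnj (weight a ms) / of_nat N ^ s) * (LINT \<omega>|M. f (prod_list ns) \<omega> * cnj (f (prod_list ms) \<omega>)))"
    by (subst Bochner_Integration.integral_sum, (auto intro!: Bochner_Integration.integrable_sum integrable_mult_right st_orthogonal(1)[OF st] pos)[1],
        rule sum.cong[OF refl], subst Bochner_Integration.integral_sum,
        auto intro!: Bochner_Integration.integrable_sum integrable_mult_right st_orthogonal(1)[OF st] pos)
  also have "\<dots> = (\<Sum>ns\<in>tuples {1..N} s. \<Sum>ms\<in>tuples {1..N} s. (weight a ns * cnj (weight a ms) / of_nat N ^ s) * (if prod_list ns = prod_list ms then 1 else 0))"
    by (intro sum.cong refl) (simp add: st_orthogonal(2)[OF st] pos)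
  also have "\<dots> = moment a N s / of_nat N ^ s"
    unfolding moment_def weighted_reps_def sum_distrib_left sum_divide_distrib
    by (subst sum.swap) (intro sum.cong refl, auto)
  finally show ?thesis by (simp add: a_def)
qed

section \<open>A recurrence for the moments\<close>

lemma norm_weight:
  assumes "\<And>n. norm (a n) = 1"
  shows "norm (weight a ms) = 1"
  by (induction ms) (auto simp: weight_def assms norm_mult)

lemma weight_Cons [simp]: "weight a (m # ms) = a m * weight a ms"
  by (simp add: weight_def)

lemma tuples_prod_pos: "ms \<in> tuples {1..N} k \<Longrightarrow> prod_list ms > 0" for N :: nat
  using prod_list_pos zero_notin_tuples by blast

lemma tuples_prod_le: "ms \<in> tuples {1..N} k \<Longrightarrow> prod_list ms \<le> N ^ k" for N :: nat
proof (induction k arbitrary: ms)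
  case (Suc k)
  then obtain m ms' where "ms = m # ms'" "m \<in> {1..N}" "ms' \<in> tuples {1..N} k" by (auto simp: tuples_Suc)
  then show ?case using Suc.IH by (auto intro!: mult_le_mono)
qed simp

lemma norm_rep_le:
  assumes a: "\<And>n. norm (a n) = 1" and x: "x \<ge> 1"
  shows "norm (weighted_reps a N k x) \<le> (if x \<le> N ^ k then real (tau k x) else 0)"
proof -
  have "norm (weighted_reps a N k x) \<le> (\<Sum>ms\<in>tuples {1..N} k. if prod_list ms = x then 1 else 0)"
    unfolding weighted_reps_def by (rule sum_norm_le) (auto simp: norm_weight[OF a])
  also have "\<dots> \<le> (\<Sum>y=1..N^k. real (tau k y) * (if y = x then 1 else 0))"
    by (rule sum_tuples_prod_le[where \<Psi> = "\<lambda>y. if y = x then 1 else 0"]) auto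
  also have "\<dots> = (\<Sum>y=1..N^k. if y = x then real (tau k y) else 0)" by (intro sum.cong) auto
  also have "\<dots> = (if x \<le> N ^ k then real (tau k x) else 0)" using x by simp
  finally show ?thesis .
qed

lemma rep_Suc:
  assumes x: "x \<ge> 1"
  shows "weighted_reps a N (Suc k) x = (\<Sum>n=1..N. if n dvd x then a n * weighted_reps a N k (x div n) else 0)"
  unfolding weighted_reps_def sum_tuples_Suc
proof (rule sum.cong[OF refl])
  fix n assume "n \<in> {1..N}"
  then have "n * prod_list ms = x \<longleftrightarrow> n dvd x \<and> prod_list ms = x div n" for ms :: "nat list" by auto
  then show "(\<Sum>ms\<in>tuples {1..N} k. if prod_list (n # ms) = x then weight a (n # ms) else 0) =
      (if n dvd x then a n * (\<Sum>ms\<in>tuples {1..N} k. if prod_list ms = x div n then weight a ms else 0) else 0)"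
    by (simp add: sum_distrib_left if_distrib cong: if_cong)
qed

text \<open>
Marking an entry of a tuple amounts to choosing the entry and then the rest of the tuple in any
order. This puts a marked entry in first position without keeping track of where it was.
\<close>
lemma sum_tuples_symmetric:
  fixes \<phi> :: "nat \<Rightarrow> complex"
  shows "(\<Sum>ms\<in>tuples A (Suc k). (\<Sum>m\<leftarrow>ms. \<phi> m) * G (mset ms)) =
    of_nat (Suc k) * (\<Sum>m\<in>A. \<Sum>ms\<in>tuples A k. \<phi> m * G (add_mset m (mset ms)))"
proof (induction k arbitrary: G)
  case 0
  show ?case by (simp add: sum_tuples_Suc)
next
  case (Suc k)
  have "(\<Sum>ms\<in>tuples A (Suc (Suc k)). (\<Sum>m\<leftarrow>ms. \<phi> m) * G (mset ms))
     = (\<Sum>m\<in>A. \<Sum>ms\<in>tuples A (Suc k). \<phi> m * G (add_mset m (mset ms)) + (\<Sum>m\<leftarrow>ms. \<phi> m) * G (add_mset m (mset ms)))"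
    by (subst sum_tuples_Suc) (simp add: distrib_right)
  also have "\<dots> = (\<Sum>m\<in>A. \<Sum>ms\<in>tuples A (Suc k). \<phi> m * G (add_mset m (mset ms)))
      + (\<Sum>m\<in>A. \<Sum>ms\<in>tuples A (Suc k). (\<Sum>m\<leftarrow>ms. \<phi> m) * G (add_mset m (mset ms)))"
    by (simp add: sum.distrib)
  also have "(\<Sum>m\<in>A. \<Sum>ms\<in>tuples A (Suc k). (\<Sum>m\<leftarrow>ms. \<phi> m) * G (add_mset m (mset ms)))
     = (\<Sum>m\<in>A. of_nat (Suc k) * (\<Sum>m'\<in>A. \<Sum>ms\<in>tuples A k. \<phi> m' * G (add_mset m (add_mset m' (mset ms)))))"
    using Suc.IH[of "\<lambda>M. G (add_mset _ M)"] by (intro sum.cong refl)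
  also have "\<dots> = of_nat (Suc k) * (\<Sum>m'\<in>A. \<Sum>m\<in>A. \<Sum>ms\<in>tuples A k. \<phi> m' * G (add_mset m' (mset (m # ms))))"
  proof -
    have "add_mset m (add_mset m' (mset ms)) = add_mset m' (mset (m # ms))" for m m' :: nat and ms
      by (simp add: add_mset_commute)
    then show ?thesis
      by (simp only: sum_distrib_left[of "of_nat (Suc k)", symmetric]) (subst sum.swap, rule refl)
  qed
  also have "(\<Sum>m'\<in>A. \<Sum>m\<in>A. \<Sum>ms\<in>tuples A k. \<phi> m' * G (add_mset m' (mset (m # ms))))
     = (\<Sum>m'\<in>A. \<Sum>ms\<in>tuples A (Suc k). \<phi> m' * G (add_mset m' (mset ms)))"
    by (simp only: sum_tuples_Suc)
  finally show ?case by (simp add: algebra_simps del: of_nat_Suc) (simp add: algebra_simps)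
qed

lemma sum_tuples_sum_list:
  fixes \<phi> :: "nat \<Rightarrow> real"
  assumes "finite A"
  shows "(\<Sum>ms\<in>tuples A k. \<Sum>m\<leftarrow>ms. \<phi> m) = real k * real (card A) ^ (k - 1) * (\<Sum>m\<in>A. \<phi> m)"
proof (induction k)
  case (Suc k)
  have "(\<Sum>ms\<in>tuples A (Suc k). \<Sum>m\<leftarrow>ms. \<phi> m) = real (card A) ^ k * (\<Sum>m\<in>A. \<phi> m) + real (card A) * (real k * real (card A) ^ (k - 1) * (\<Sum>m\<in>A. \<phi> m))"
    using assms by (simp add: sum_tuples_Suc sum.distrib Suc card_tuples sum_distrib_left)
  also have "\<dots> = real (Suc k) * real (card A) ^ (Suc k - 1) * (\<Sum>m\<in>A. \<phi> m)"
    by (cases k) (auto simp: algebra_simps)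
  finally show ?case .
qed simp

definition large_gcd_count :: "nat \<Rightarrow> nat \<Rightarrow> nat list \<Rightarrow> nat" where
  "large_gcd_count Y n ms = (\<Sum>m\<leftarrow>ms. if Y \<le> gcd n m then 1 else 0)"

lemma large_gcd_count_eq_size: "large_gcd_count Y n ms = size {#m \<in># mset ms. Y \<le> gcd n m#}"
  by (induction ms) (auto simp: large_gcd_count_def)

lemma gcd_mult_dvd: "gcd n (x * y) dvd gcd n x * gcd n y" for n x y :: nat
proof -
  have "gcd n (x * y) dvd gcd (n * gcd n y) (x * gcd n y)"
  proof (rule gcd_greatest)
    show "gcd n (x * y) dvd n * gcd n y" by (simp add: dvd_mult2)
    have "x * gcd n y = gcd (x * n) (x * y)" by (simp add: gcd_mult_distrib_nat)
    then show "gcd n (x * y) dvd x * gcd n y" by (simp add: dvd_mult)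
  qed
  also have "gcd (n * gcd n y) (x * gcd n y) = gcd n x * gcd n y"
    using gcd_mult_distrib_nat[of "gcd n y" n x] by (simp add: mult.commute)
  finally show ?thesis .
qed

text \<open>
A divisor of a product divides the product of its gcds with the factors.
\<close>
lemma large_gcd_count_zero:
  assumes "large_gcd_count Y n ms = 0" "n dvd prod_list ms" "0 \<notin> set ms"
  shows "n \<le> Y ^ length ms"
proof -
  have "gcd n (prod_list ms) dvd (\<Prod>m\<leftarrow>ms. gcd n m)" for ms
  proof (induction ms)
    case (Cons m ms)
    have "gcd n (m * prod_list ms) dvd gcd n m * gcd n (prod_list ms)" by (rule gcd_mult_dvd)
    also have "\<dots> dvd gcd n m * (\<Prod>m\<leftarrow>ms. gcd n m)" using Cons by (intro mult_dvd_mono) auto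
    finally show ?case by simp
  qed simp
  then have "n dvd (\<Prod>m\<leftarrow>ms. gcd n m)" using assms(2) by (metis gcd_nat.absorb_iff1)
  moreover have "(\<Prod>m\<leftarrow>ms. gcd n m) > 0" using assms(3) by (induction ms) auto
  ultimately have "n \<le> (\<Prod>m\<leftarrow>ms. gcd n m)" by (rule dvd_imp_le)
  also have "\<dots> \<le> Y ^ length ms"
    using assms(1) by (induction ms) (auto simp: large_gcd_count_def intro!: mult_le_mono split: if_splits)
  finally show ?thesis .
qed

lemma prod_list_eq_prod_mset: "prod_list ms = prod_mset (mset ms)" for ms :: "'b::comm_monoid_mult list"
  by (simp add: prod_mset_prod_list)

text \<open>
The part of the count in which the entries \<open>n\<close> and \<open>m\<close> have been selected and the other entries are
summed over. The denominator is the number of entries that could have been selected in place of \<open>m\<close>,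
\<open>m\<close> included.
\<close>
definition coreterm :: "(nat \<Rightarrow> complex) \<Rightarrow> nat \<Rightarrow> nat \<Rightarrow> nat \<Rightarrow> nat \<Rightarrow> nat \<Rightarrow> complex" where
  "coreterm a N Y k n m = (\<Sum>ms\<in>tuples {1..N} k. (if n dvd m * prod_list ms then cnj (weight a ms) * weighted_reps a N k (m * prod_list ms div n) else 0) / (1 + of_nat (large_gcd_count Y n ms)))"

text \<open>
What is left of the count when no entry can be selected, which forces \<open>n\<close> to be small.
\<close>
definition smallterm :: "(nat \<Rightarrow> complex) \<Rightarrow> nat \<Rightarrow> nat \<Rightarrow> nat \<Rightarrow> complex" where
  "smallterm a N Y k = (\<Sum>n=1..N. a n * (\<Sum>ms\<in>tuples {1..N} (Suc k). if large_gcd_count Y n ms = 0 \<and> n dvd prod_list ms then cnj (weight a ms) * weighted_reps a N k (prod_list ms div n) else 0))"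

context
  fixes a :: "nat \<Rightarrow> complex" and N Y k :: nat
  assumes a: "\<And>n. norm (a n) = 1" and Y: "Y \<ge> 1" and N: "N \<ge> 1"
begin

text \<open>
A tuple with \<open>c > 0\<close> entries sharing a large gcd with \<open>n\<close> is distributed over these entries with
weight \<open>1 / c\<close> each, and the symmetry lemma moves the selected entry to the front.
\<close>
lemma moment_Suc_split:
  "moment a N (Suc k) = smallterm a N Y k + of_nat (Suc k) * (\<Sum>n=1..N. \<Sum>m=1..N. if Y \<le> gcd n m then a n * cnj (a m) * coreterm a N Y k n m else 0)"
proof -
  define H where "H n M = (if n dvd prod_mset M then cnj (prod_mset (image_mset a M)) * weighted_reps a N k (prod_mset M div n) else 0)" for n M
  have Hms: "H n (mset ms) = (if n dvd prod_list ms then cnj (weight a ms) * weighted_reps a N k (prod_list ms div n) else 0)" for n ms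
    by (simp add: H_def prod_list_eq_prod_mset weight_def flip: mset_map)
  have "moment a N (Suc k) = (\<Sum>ms\<in>tuples {1..N} (Suc k). \<Sum>n=1..N. a n * H n (mset ms))"
    unfolding moment_def
  proof (rule sum.cong[OF refl])
    fix ms assume "ms \<in> tuples {1..N} (Suc k)"
    then have "prod_list ms \<ge> 1" using tuples_prod_pos by (simp add: Suc_le_eq)
    then show "cnj (weight a ms) * weighted_reps a N (Suc k) (prod_list ms) = (\<Sum>n=1..N. a n * H n (mset ms))"
      unfolding Hms rep_Suc[OF \<open>prod_list ms \<ge> 1\<close>] sum_distrib_left by (intro sum.cong refl) auto
  qed
  also have "\<dots> = (\<Sum>n=1..N. a n * (\<Sum>ms\<in>tuples {1..N} (Suc k). H n (mset ms)))"
    by (subst sum.swap) (simp add: sum_distrib_left)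
  also have "\<dots> = (\<Sum>n=1..N. a n * ((\<Sum>ms\<in>tuples {1..N} (Suc k). if large_gcd_count Y n ms = 0 then H n (mset ms) else 0) +
      of_nat (Suc k) * (\<Sum>m=1..N. if Y \<le> gcd n m then cnj (a m) * coreterm a N Y k n m else 0)))"
  proof (rule sum.cong[OF refl])
    fix n assume n: "n \<in> {1..N}"
    define \<phi> :: "nat \<Rightarrow> complex" where "\<phi> m = (if Y \<le> gcd n m then 1 else 0)" for m
    define G where "G M = H n M / of_nat (size {#m \<in># M. Y \<le> gcd n m#})" for M
    have c: "of_nat (large_gcd_count Y n ms) = (\<Sum>m\<leftarrow>ms. \<phi> m)" for ms
      by (induction ms) (auto simp: large_gcd_count_def \<phi>_def)
    have "H n (mset ms) = (if large_gcd_count Y n ms = 0 then H n (mset ms) else 0) + (\<Sum>m\<leftarrow>ms. \<phi> m) * G (mset ms)" for ms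
      by (simp add: G_def c[symmetric] large_gcd_count_eq_size[symmetric])
    then have "(\<Sum>ms\<in>tuples {1..N} (Suc k). H n (mset ms)) = (\<Sum>ms\<in>tuples {1..N} (Suc k). if large_gcd_count Y n ms = 0 then H n (mset ms) else 0)
       + (\<Sum>ms\<in>tuples {1..N} (Suc k). (\<Sum>m\<leftarrow>ms. \<phi> m) * G (mset ms))"
      by (simp only: sum.distrib[symmetric])
    also have "(\<Sum>ms\<in>tuples {1..N} (Suc k). (\<Sum>m\<leftarrow>ms. \<phi> m) * G (mset ms)) =
       of_nat (Suc k) * (\<Sum>m=1..N. \<Sum>ms\<in>tuples {1..N} k. \<phi> m * G (add_mset m (mset ms)))"
      by (rule sum_tuples_symmetric)
    also have "(\<Sum>m=1..N. \<Sum>ms\<in>tuples {1..N} k. \<phi> m * G (add_mset m (mset ms))) =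
       (\<Sum>m=1..N. if Y \<le> gcd n m then cnj (a m) * coreterm a N Y k n m else 0)"
    proof (rule sum.cong[OF refl])
      fix m
      have "\<phi> m * G (add_mset m (mset ms)) = (if Y \<le> gcd n m then cnj (a m) * ((if n dvd m * prod_list ms then cnj (weight a ms) * weighted_reps a N k (m * prod_list ms div n) else 0) / (1 + of_nat (large_gcd_count Y n ms))) else 0)" for ms
        unfolding G_def using Hms[of n "m # ms"] by (simp add: \<phi>_def large_gcd_count_eq_size)
      then show "(\<Sum>ms\<in>tuples {1..N} k. \<phi> m * G (add_mset m (mset ms))) = (if Y \<le> gcd n m then cnj (a m) * coreterm a N Y k n m else 0)"
        by (simp add: coreterm_def sum_distrib_left)
    qed
    finally show "a n * (\<Sum>ms\<in>tuples {1..N} (Suc k). H n (mset ms)) = a n * ((\<Sum>ms\<in>tuples {1..N} (Suc k). if large_gcd_count Y n ms = 0 then H n (mset ms) else 0) +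
      of_nat (Suc k) * (\<Sum>m=1..N. if Y \<le> gcd n m then cnj (a m) * coreterm a N Y k n m else 0))" by simp
  qed
  also have "\<dots> = (\<Sum>n=1..N. a n * (\<Sum>ms\<in>tuples {1..N} (Suc k). if large_gcd_count Y n ms = 0 then H n (mset ms) else 0)) +
     of_nat (Suc k) * (\<Sum>n=1..N. a n * (\<Sum>m=1..N. if Y \<le> gcd n m then cnj (a m) * coreterm a N Y k n m else 0))"
    by (simp add: distrib_left sum.distrib sum_distrib_left mult.left_commute del: of_nat_Suc)
  also have "(\<Sum>n=1..N. a n * (\<Sum>m=1..N. if Y \<le> gcd n m then cnj (a m) * coreterm a N Y k n m else 0)) = (\<Sum>n=1..N. \<Sum>m=1..N. if Y \<le> gcd n m then a n * cnj (a m) * coreterm a N Y k n m else 0)"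
    unfolding sum_distrib_left by (intro sum.cong refl) auto
  also have "(\<Sum>n=1..N. a n * (\<Sum>ms\<in>tuples {1..N} (Suc k). if large_gcd_count Y n ms = 0 then H n (mset ms) else 0)) = smallterm a N Y k"
    unfolding smallterm_def Hms by (intro sum.cong refl arg_cong2[where f = "(*)"]) auto
  finally show ?thesis .
qed

context
  fixes D :: real
  assumes D: "\<And>j x. j \<le> Suc k \<Longrightarrow> 1 \<le> x \<Longrightarrow> x \<le> N ^ Suc k \<Longrightarrow> real (tau j x) \<le> D"
begin

lemma D_ge_1: "D \<ge> 1"
  using D[of 0 1] N by simp

lemma Nk_le: "N ^ k \<le> N ^ Suc k"
  using N by (intro power_increasing) auto

lemma norm_rep_le_D:
  assumes "x \<ge> 1"
  shows "norm (weighted_reps a N k x) \<le> (if x \<le> N ^ k then D else 0)"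
proof -
  have "norm (weighted_reps a N k x) \<le> (if x \<le> N ^ k then real (tau k x) else 0)"
    by (rule norm_rep_le[OF _ assms]) (rule a)
  moreover have "real (tau k x) \<le> D" if "x \<le> N ^ k"
    using D[of k x] assms that Nk_le by linarith
  ultimately show ?thesis by (auto split: if_splits)
qed

text \<open>
Only \<open>n \<le> Y\<^sup>k\<^sup>+\<^sup>1\<close> occur here; for each of them the divisor bound leaves \<open>N\<^sup>k\<close> products up to a factor
\<open>D\<^sup>2\<close>.
\<close>
lemma norm_smallterm: "norm (smallterm a N Y k) \<le> real Y ^ Suc k * real N ^ k * D ^ 2"
proof -
  define \<Psi> where "\<Psi> n x = (if n dvd x \<and> x div n \<le> N ^ k then D else 0)" for n x :: nat
  have D0: "D \<ge> 0" using D_ge_1 by simp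
  have row: "(\<Sum>ms\<in>tuples {1..N} (Suc k). \<Psi> n (prod_list ms)) \<le> real N ^ k * D ^ 2" if n: "n \<ge> 1" for n
  proof -
    have "(\<Sum>ms\<in>tuples {1..N} (Suc k). \<Psi> n (prod_list ms)) \<le> (\<Sum>x=1..N^Suc k. real (tau (Suc k) x) * \<Psi> n x)"
      by (rule sum_tuples_prod_le) (auto simp: \<Psi>_def D0)
    also have "\<dots> \<le> (\<Sum>x=1..N^Suc k. if n dvd x \<and> x div n \<le> N ^ k then D ^ 2 else 0)"
    proof (rule sum_mono)
      fix x assume x: "x \<in> {1..N^Suc k}"
      show "real (tau (Suc k) x) * \<Psi> n x \<le> (if n dvd x \<and> x div n \<le> N ^ k then D ^ 2 else 0)"
        using D[of "Suc k" x] x D0 by (auto simp: \<Psi>_def power2_eq_square simp del: tau.simps intro!: mult_right_mono)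
    qed
    also have "\<dots> = real (card {x \<in> {1..N^Suc k}. n dvd x \<and> x div n \<le> N ^ k}) * D ^ 2"
      by (simp add: sum.If_cases Int_def)
    also have "card {x \<in> {1..N^Suc k}. n dvd x \<and> x div n \<le> N ^ k} \<le> card {1..N ^ k}"
    proof (rule card_inj_on_le[of "\<lambda>x. x div n"])
      show "inj_on (\<lambda>x. x div n) {x \<in> {1..N^Suc k}. n dvd x \<and> x div n \<le> N ^ k}"
        by (rule inj_onI) (metis (mono_tags, lifting) dvd_div_mult_self mem_Collect_eq)
      show "(\<lambda>x. x div n) ` {x \<in> {1..N^Suc k}. n dvd x \<and> x div n \<le> N ^ k} \<subseteq> {1..N ^ k}"
        using n by (auto dest: div_ge_1)
    qed simp
    finally show ?thesis by (simp add: mult_right_mono)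
  qed
  have "norm (smallterm a N Y k) \<le> (\<Sum>n=1..N. if n \<le> Y ^ Suc k then real N ^ k * D ^ 2 else 0)"
    unfolding smallterm_def
  proof (rule sum_norm_le)
    fix n assume n: "n \<in> {1..N}"
    have "norm (a n * (\<Sum>ms\<in>tuples {1..N} (Suc k). if large_gcd_count Y n ms = 0 \<and> n dvd prod_list ms then cnj (weight a ms) * weighted_reps a N k (prod_list ms div n) else 0))
       \<le> (\<Sum>ms\<in>tuples {1..N} (Suc k). if n \<le> Y ^ Suc k then \<Psi> n (prod_list ms) else 0)"
      unfolding norm_mult a mult_1
    proof (rule sum_norm_le)
      fix ms assume ms: "ms \<in> tuples {1..N} (Suc k)"
      have len: "length ms = Suc k" using ms by (simp add: tuples_def)
      show "norm (if large_gcd_count Y n ms = 0 \<and> n dvd prod_list ms then cnj (weight a ms) * weighted_reps a N k (prod_list ms div n) else 0)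
        \<le> (if n \<le> Y ^ Suc k then \<Psi> n (prod_list ms) else 0)"
      proof (cases "large_gcd_count Y n ms = 0 \<and> n dvd prod_list ms")
        case True
        then have "n \<le> Y ^ Suc k" using large_gcd_count_zero[of Y n ms] zero_notin_tuples[OF ms] len by simp
        moreover have "prod_list ms div n \<ge> 1" using True tuples_prod_pos[OF ms] by (intro div_ge_1) auto
        ultimately show ?thesis using True norm_rep_le_D[of "prod_list ms div n"]
          by (simp add: norm_mult norm_weight[OF a] \<Psi>_def)
      qed (use D0 in \<open>auto simp: \<Psi>_def\<close>)
    qed
    also have "\<dots> \<le> (if n \<le> Y ^ Suc k then real N ^ k * D ^ 2 else 0)"
      using row[of n] n by auto
    finally show "norm (a n * (\<Sum>ms\<in>tuples {1..N} (Suc k). if large_gcd_count Y n ms = 0 \<and> n dvd prod_list ms then cnj (weight a ms) * weighted_reps a N k (prod_list ms div n) else 0))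
       \<le> (if n \<le> Y ^ Suc k then real N ^ k * D ^ 2 else 0)" .
  qed
  also have "\<dots> = real (card {n \<in> {1..N}. n \<le> Y ^ Suc k}) * (real N ^ k * D ^ 2)"
    by (simp add: sum.If_cases Int_def)
  also have "\<dots> \<le> real Y ^ Suc k * (real N ^ k * D ^ 2)"
  proof (rule mult_right_mono)
    have "card {n \<in> {1..N}. n \<le> Y ^ Suc k} \<le> card {1..Y ^ Suc k}" by (intro card_mono) auto
    then have "card {n \<in> {1..N}. n \<le> Y ^ Suc k} \<le> Y ^ Suc k" by simp
    then show "real (card {n \<in> {1..N}. n \<le> Y ^ Suc k}) \<le> real Y ^ Suc k" by (metis of_nat_le_iff of_nat_power)
  qed (use D0 in auto)
  finally show ?thesis by (simp add: mult.assoc)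
qed

lemma sum_large_gcd:
  "(\<Sum>n=1..N. \<Sum>m=1..N. if Y \<le> gcd n m then 1 else 0) \<le> D * real N ^ 2 / real Y"
  if "k \<ge> 1"
proof -
  have "(\<Sum>m=1..N. if Y \<le> gcd n m then 1 else (0::real)) \<le> D * (real N / real Y)" if n: "n \<in> {1..N}" for n
  proof -
    have "(\<Sum>m=1..N. if Y \<le> gcd n m then 1 else (0::real)) \<le> (\<Sum>m=1..N. \<Sum>h | h dvd n. if Y \<le> h \<and> h dvd m then 1 else 0)"
    proof (rule sum_mono)
      fix m assume "m \<in> {1..N}"
      have fin: "finite {h. h dvd n}" using n by simp
      show "(if Y \<le> gcd n m then 1 else (0::real)) \<le> (\<Sum>h | h dvd n. if Y \<le> h \<and> h dvd m then 1 else 0)"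
      proof (cases "Y \<le> gcd n m")
        case True
        have "(if Y \<le> gcd n m \<and> gcd n m dvd m then 1 else (0::real)) \<le> (\<Sum>h | h dvd n. if Y \<le> h \<and> h dvd m then 1 else 0)"
          by (rule member_le_sum[where i = "gcd n m" and f = "\<lambda>h. if Y \<le> h \<and> h dvd m then 1 else (0::real)"]) (use fin in auto)
        then show ?thesis using True by simp
      qed (auto intro: sum_nonneg)
    qed
    also have "\<dots> = (\<Sum>h | h dvd n. \<Sum>m=1..N. if Y \<le> h \<and> h dvd m then 1 else 0)" by (rule sum.swap)
    also have "\<dots> \<le> (\<Sum>h | h dvd n. real N / real Y)"
    proof (rule sum_mono)
      fix h assume h: "h \<in> {h. h dvd n}"
      show "(\<Sum>m=1..N. if Y \<le> h \<and> h dvd m then 1 else (0::real)) \<le> real N / real Y"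
      proof (cases "Y \<le> h")
        case True
        have "(\<Sum>m=1..N. if Y \<le> h \<and> h dvd m then 1 else (0::real)) = real (card {m \<in> {1..N}. h dvd m})"
          using True by (simp add: sum.If_cases Int_def)
        also have "card {m \<in> {1..N}. h dvd m} \<le> card {1..N div h}"
        proof (rule card_inj_on_le[of "\<lambda>x. x div h"])
          show "inj_on (\<lambda>x. x div h) {m \<in> {1..N}. h dvd m}"
            by (rule inj_onI) (metis (mono_tags, lifting) dvd_div_mult_self mem_Collect_eq)
          show "(\<lambda>x. x div h) ` {m \<in> {1..N}. h dvd m} \<subseteq> {1..N div h}"
            using div_ge_1[of h] by (auto intro!: div_le_mono)
        qed simp
        also have "real (card {1..N div h}) \<le> real N / real h" using of_nat_div_le_of_nat[of N h] by simp
        also have "\<dots> \<le> real N / real Y" using True Y by (intro divide_left_mono) auto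
        finally show ?thesis by simp
      qed (simp add: Y)
    qed
    also have "\<dots> = real (tau 2 n) * (real N / real Y)" using n by (simp add: tau_2)
    also have "\<dots> \<le> D * (real N / real Y)"
    proof (rule mult_right_mono)
      have "N ^ 1 \<le> N ^ Suc k" using N by (intro power_increasing) auto
      then show "real (tau 2 n) \<le> D" using D[of 2 n] that n \<open>k \<ge> 1\<close> by (simp del: power_Suc)
    qed auto
    finally show ?thesis .
  qed
  then have "(\<Sum>n=1..N. \<Sum>m=1..N. if Y \<le> gcd n m then 1 else 0) \<le> (\<Sum>n=1..N. D * (real N / real Y))"
    by (rule sum_mono)
  then show ?thesis by (simp add: power2_eq_square mult_ac)
qed

lemma norm_moment_le: "norm (moment a N k) \<le> real N ^ k * D"
proof -
  have "norm (moment a N k) \<le> (\<Sum>ms\<in>tuples {1..N} k. D)"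
    unfolding moment_def
  proof (rule sum_norm_le)
    fix ms assume ms: "ms \<in> tuples {1..N} k"
    then have "prod_list ms \<ge> 1" "prod_list ms \<le> N ^ k" using tuples_prod_pos tuples_prod_le by (auto simp: Suc_le_eq)
    then show "norm (cnj (weight a ms) * weighted_reps a N k (prod_list ms)) \<le> D"
      using norm_rep_le_D[of "prod_list ms"] by (simp add: norm_mult norm_weight[OF a])
  qed
  then show ?thesis by (simp add: card_tuples)
qed

text \<open>
On the diagonal the denominator is \<open>1\<close> unless some other entry has a large gcd with \<open>n\<close>. Such
coincidences are rarer by a factor of about \<open>Y\<close>, and \<open>n < Y\<close> is rare as well.
\<close>
lemma diagonal_estimate:
  "norm ((\<Sum>n=1..N. if Y \<le> n then coreterm a N Y k n n else 0) - of_nat N * moment a N k)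
    \<le> real Y * real N ^ k * D + real k * D ^ 2 * real N ^ Suc k / real Y"
proof -
  have D0: "D \<ge> 0" using D_ge_1 by simp
  have diff: "norm (coreterm a N Y k n n - moment a N k) \<le> D * (\<Sum>ms\<in>tuples {1..N} k. real (large_gcd_count Y n ms))" if n: "n \<in> {1..N}" for n
  proof -
    have "coreterm a N Y k n n - moment a N k = (\<Sum>ms\<in>tuples {1..N} k. cnj (weight a ms) * weighted_reps a N k (prod_list ms) * (1 / (1 + of_nat (large_gcd_count Y n ms)) - 1))"
      unfolding coreterm_def moment_def sum_subtractf[symmetric] using n by (intro sum.cong refl) (simp add: algebra_simps)
    also have "norm \<dots> \<le> (\<Sum>ms\<in>tuples {1..N} k. D * real (large_gcd_count Y n ms))"
    proof (rule sum_norm_le)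
      fix ms assume ms: "ms \<in> tuples {1..N} k"
      then have x: "prod_list ms \<ge> 1" "prod_list ms \<le> N ^ k" using tuples_prod_pos tuples_prod_le by (auto simp: Suc_le_eq)
      define c where "c = large_gcd_count Y n ms"
      have "(1 / (1 + of_nat c) - 1 :: complex) = of_real (1 / (1 + real c) - 1)" by simp
      then have "norm (1 / (1 + of_nat c) - 1 :: complex) = \<bar>1 / (1 + real c) - 1\<bar>"
        by (simp only: norm_of_real)
      also have "\<dots> = real c / (1 + real c)"
      proof -
        have "1 / (1 + real c) - 1 = - (real c / (1 + real c))" by (simp add: field_simps)
        then show ?thesis by simp
      qed
      also have "\<dots> \<le> real c" by (simp add: divide_le_eq mult_le_cancel_left1)
      finally have "norm (1 / (1 + of_nat c) - 1 :: complex) \<le> real c" .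
      then show "norm (cnj (weight a ms) * weighted_reps a N k (prod_list ms) * (1 / (1 + of_nat (large_gcd_count Y n ms)) - 1)) \<le> D * real (large_gcd_count Y n ms)"
        unfolding norm_mult c_def[symmetric] using norm_rep_le_D[OF x(1)] x D0 by (intro mult_mono) (auto simp: norm_weight[OF a])
    qed
    finally show ?thesis by (simp add: sum_distrib_left)
  qed
  have cnts: "(\<Sum>n=1..N. \<Sum>ms\<in>tuples {1..N} k. real (large_gcd_count Y n ms)) \<le> real k * D * real N ^ Suc k / real Y"
  proof (cases "k = 0")
    case True
    then show ?thesis by (simp add: large_gcd_count_def)
  next
    case False
    have "real (large_gcd_count Y n ms) = (\<Sum>m\<leftarrow>ms. if Y \<le> gcd n m then 1 else 0)" for n ms
      by (induction ms) (auto simp: large_gcd_count_def)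
    then have "(\<Sum>n=1..N. \<Sum>ms\<in>tuples {1..N} k. real (large_gcd_count Y n ms)) = (\<Sum>n=1..N. real k * real N ^ (k - 1) * (\<Sum>m=1..N. if Y \<le> gcd n m then 1 else 0))"
      by (simp add: sum_tuples_sum_list)
    also have "\<dots> = real k * real N ^ (k - 1) * (\<Sum>n=1..N. \<Sum>m=1..N. if Y \<le> gcd n m then 1 else 0)"
      by (simp only: sum_distrib_left)
    also have "\<dots> \<le> real k * real N ^ (k - 1) * (D * real N ^ 2 / real Y)"
      using sum_large_gcd False by (intro mult_left_mono) auto
    also have "\<dots> = real k * D * real N ^ Suc k / real Y"
      using False by (cases k) (auto simp: power2_eq_square)
    finally show ?thesis .
  qed
  have "(\<Sum>n=1..N. if Y \<le> n then coreterm a N Y k n n else 0) - of_nat N * moment a N k = (\<Sum>n=1..N. (if Y \<le> n then coreterm a N Y k n n else 0) - moment a N k)"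
    by (simp add: sum_subtractf)
  then have "norm ((\<Sum>n=1..N. if Y \<le> n then coreterm a N Y k n n else 0) - of_nat N * moment a N k)
      = norm (\<Sum>n=1..N. (if Y \<le> n then coreterm a N Y k n n else 0) - moment a N k)" by (rule arg_cong)
  also have "norm (\<Sum>n=1..N. (if Y \<le> n then coreterm a N Y k n n else 0) - moment a N k) \<le> (\<Sum>n=1..N. (if n < Y then real N ^ k * D else 0) + D * (\<Sum>ms\<in>tuples {1..N} k. real (large_gcd_count Y n ms)))"
  proof (rule sum_norm_le)
    fix n assume n: "n \<in> {1..N}"
    have "0 \<le> D * (\<Sum>ms\<in>tuples {1..N} k. real (large_gcd_count Y n ms))" using D0 by (intro mult_nonneg_nonneg sum_nonneg) auto
    then show "norm ((if Y \<le> n then coreterm a N Y k n n else 0) - moment a N k) \<le> (if n < Y then real N ^ k * D else 0) + D * (\<Sum>ms\<in>tuples {1..N} k. real (large_gcd_count Y n ms))"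
      using diff[OF n] norm_moment_le by auto
  qed
  also have "\<dots> = real (card {n \<in> {1..N}. n < Y}) * (real N ^ k * D) + D * (\<Sum>n=1..N. \<Sum>ms\<in>tuples {1..N} k. real (large_gcd_count Y n ms))"
    by (simp add: sum.distrib sum.If_cases Int_def sum_distrib_left)
  also have "\<dots> \<le> real Y * (real N ^ k * D) + D * (real k * D * real N ^ Suc k / real Y)"
  proof (intro add_mono mult_right_mono mult_left_mono cnts D0)
    have "card {n \<in> {1..N}. n < Y} \<le> card {..<Y}" by (intro card_mono) auto
    then show "real (card {n \<in> {1..N}. n < Y}) \<le> real Y" by simp
  qed (use D0 in auto)
  finally show ?thesis by (simp add: power2_eq_square mult_ac)
qed

end

end

section \<open>The off-diagonal contribution\<close>

lemma member_dvd_prod_list: "m \<in> set ms \<Longrightarrow> m dvd prod_list ms" for m :: nat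
  by (induction ms) auto

lemma large_gcd_count_gcd: "large_gcd_count Y (u * gcd h (prod_list ms)) ms = large_gcd_count Y (u * h) ms"
proof -
  have "gcd (u * gcd h (prod_list ms)) m = gcd (u * h) m" if "m \<in> set ms" for m
  proof -
    have "m dvd u * prod_list ms" using member_dvd_prod_list[OF that] by simp
    then have "gcd (u * prod_list ms) m = m" by (simp add: gcd_nat.absorb2)
    then show ?thesis by (simp add: gcd_mult_distrib_nat gcd.assoc)
  qed
  then show ?thesis unfolding large_gcd_count_def by (intro arg_cong[where f = sum_list] map_cong) auto
qed

text \<open>
The denominator depends on \<open>h\<close> only through \<open>gcd h Q\<close>, where \<open>Q\<close> is the product of the entries \<open>ms\<close>.
Expanding over the divisors \<open>e\<close> of \<open>Q\<close> turns the sum into sums over \<open>h = e l\<close>. For \<open>e \<le> Z\<close> each of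
these is a difference of two initial segments; for \<open>e > Z\<close> it has at most \<open>N / (Z max u v)\<close> terms,
and there are few such \<open>e\<close>.
\<close>
lemma inner_sum_bound:
  fixes a :: "nat \<Rightarrow> complex" and N Y Z u v :: nat and D :: real and J :: "nat \<Rightarrow> real"
  assumes a: "\<And>n. norm (a n) = 1" and Y: "Y \<ge> 1" and Z: "Z \<ge> 1" and u: "u \<ge> 1" and v: "v \<ge> 1"
    and ms: "0 \<notin> set ms"
    and D: "\<And>x. 1 \<le> x \<Longrightarrow> x \<le> prod_list ms \<Longrightarrow> real (tau 2 x) \<le> D"
    and J0: "\<And>e. J e \<ge> 0"
    and J: "\<And>e x. 1 \<le> e \<Longrightarrow> e \<le> Z \<Longrightarrow> e * max u v \<le> N \<Longrightarrow> x \<le> N div (e * max u v) + 1 \<Longrightarrow> norm (\<Sum>l<x. a (u * (e * l)) * cnj (a (v * (e * l)))) \<le> J e"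
  shows "norm (\<Sum>h=Y..N div max u v. a (u * h) * cnj (a (v * h)) / (1 + of_nat (large_gcd_count Y (u * h) ms)))
    \<le> (\<Sum>e=1..Z. 2 * real (tau 2 e) * J e) + D ^ 2 * (real N / real (max u v)) / real Z"
proof -
  define Q where "Q = prod_list ms"
  have Q: "Q \<ge> 1" using prod_list_pos[OF ms] by (simp add: Q_def Suc_le_eq)
  define K where "K = N div max u v"
  define A where "A h = a (u * h) * cnj (a (v * h))" for h
  have nA: "norm (A h) = 1" for h by (simp add: A_def norm_mult a)
  define \<Phi> where "\<Phi> b = 1 / (1 + real (large_gcd_count Y (u * b) ms))" for b
  have \<Phi>1: "\<bar>\<Phi> b\<bar> \<le> 1" for b by (simp add: \<Phi>_def)
  obtain c where c: "\<And>e. e \<ge> 1 \<Longrightarrow> \<bar>c e\<bar> \<le> real (tau 2 e)"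
    and \<Phi>: "\<And>n. n \<ge> 1 \<Longrightarrow> \<Phi> n = (\<Sum>e | e dvd n. c e)"
    by (rule divisor_expansion[of \<Phi>, OF \<Phi>1]) (rule that)
  define W where "W e = (\<Sum>h=Y..K. if e dvd h then A h else 0)" for e
  have finQ: "finite {e. e dvd Q}" using Q by simp
  have "(\<Sum>h=Y..K. a (u * h) * cnj (a (v * h)) / (1 + of_nat (large_gcd_count Y (u * h) ms))) = (\<Sum>h=Y..K. \<Sum>e | e dvd Q. of_real (c e) * (if e dvd h then A h else 0))"
  proof (rule sum.cong[OF refl])
    fix h assume h: "h \<in> {Y..K}"
    have g: "gcd h Q \<ge> 1" using Q by (simp add: Suc_le_eq)
    have "a (u * h) * cnj (a (v * h)) / (1 + of_nat (large_gcd_count Y (u * h) ms)) = of_real (\<Phi> (gcd h Q)) * A h"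
      by (simp add: \<Phi>_def Q_def large_gcd_count_gcd A_def)
    also have "\<Phi> (gcd h Q) = (\<Sum>e | e dvd gcd h Q. c e)" by (rule \<Phi>[OF g])
    also have "\<dots> = (\<Sum>e | e dvd Q. if e dvd h then c e else 0)"
    proof -
      have "{e. e dvd gcd h Q} = {e \<in> {e. e dvd Q}. e dvd h}" by auto
      then show ?thesis by (simp only: sum.inter_filter[OF finQ])
    qed
    also have "of_real (\<Sum>e | e dvd Q. if e dvd h then c e else 0) * A h = (\<Sum>e | e dvd Q. of_real (c e) * (if e dvd h then A h else 0))"
      by (simp add: sum_distrib_right if_distrib cong: if_cong) (intro sum.cong, auto)
    finally show "a (u * h) * cnj (a (v * h)) / (1 + of_nat (large_gcd_count Y (u * h) ms)) = (\<Sum>e | e dvd Q. of_real (c e) * (if e dvd h then A h else 0))" .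
  qed
  also have "\<dots> = (\<Sum>e | e dvd Q. of_real (c e) * W e)"
    unfolding W_def sum_distrib_left by (rule sum.swap)
  finally have main: "(\<Sum>h=Y..K. a (u * h) * cnj (a (v * h)) / (1 + of_nat (large_gcd_count Y (u * h) ms))) = (\<Sum>e | e dvd Q. of_real (c e) * W e)" .
  have m1: "max u v \<ge> 1" using u by simp
  \<comment> \<open>(Y - 1) div e + 1 is the least l with e l at least Y.\<close>
  have Wform: "W e = (\<Sum>l\<in>{(Y - 1) div e + 1..K div e}. A (e * l))" if e: "e \<ge> 1" for e
  proof -
    have "W e = (\<Sum>h\<in>{h \<in> {Y..K}. e dvd h}. A h)" unfolding W_def by (rule sum.inter_filter[symmetric]) simp
    also have "{h \<in> {Y..K}. e dvd h} = (\<lambda>l. e * l) ` {(Y - 1) div e + 1..K div e}"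
    proof (intro equalityI subsetI)
      fix h assume "h \<in> {h \<in> {Y..K}. e dvd h}"
      then obtain l where l: "h = e * l" "Y \<le> e * l" "e * l \<le> K" by auto
      have "(Y - 1) div e < l" using l e Y by (subst div_less_iff_less_mult) (auto simp: mult.commute)
      moreover have "l \<le> K div e" using l e by (subst less_eq_div_iff_mult_less_eq) (auto simp: mult.commute)
      ultimately show "h \<in> (\<lambda>l. e * l) ` {(Y - 1) div e + 1..K div e}" using l by auto
    next
      fix h assume "h \<in> (\<lambda>l. e * l) ` {(Y - 1) div e + 1..K div e}"
      then obtain l where lS: "l \<in> {(Y - 1) div e + 1..K div e}" "h = e * l" by blast
      then have l: "h = e * l" "(Y - 1) div e < l" "l \<le> K div e" by simp_all
      have "Y - 1 < l * e" using l e by (subst div_less_iff_less_mult[symmetric]) auto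
      moreover have "l * e \<le> K" using l e by (subst less_eq_div_iff_mult_less_eq[symmetric]) auto
      ultimately show "h \<in> {h \<in> {Y..K}. e dvd h}" using l Y by (auto simp: mult.commute)
    qed
    also have "(\<Sum>h\<in>(\<lambda>l. e * l) ` {(Y - 1) div e + 1..K div e}. A h) = (\<Sum>l\<in>{(Y - 1) div e + 1..K div e}. A (e * l))"
      using e by (subst sum.reindex) (auto simp: inj_on_def)
    finally show ?thesis .
  qed
  have W1: "norm (W e) \<le> 2 * J e" if e: "e \<ge> 1" "e \<le> Z" for e
  proof (cases "(Y - 1) div e + 1 \<le> K div e")
    case False
    then show ?thesis using J0[of e] by (simp add: Wform[OF e(1)])
  next
    case True
    have KN: "K div e = N div (e * max u v)" by (simp only: K_def mult.commute[of e] div_mult2_eq)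
    have fit: "e * max u v \<le> N"
    proof (rule ccontr)
      assume "\<not> e * max u v \<le> N"
      then have "K div e = 0" unfolding KN by simp
      then show False using True by simp
    qed
    define y where "y = (Y - 1) div e + 1"
    have "(\<Sum>l<K div e + 1. A (e * l)) = (\<Sum>l<y. A (e * l)) + (\<Sum>l\<in>{y..K div e}. A (e * l))"
    proof -
      have "{..<K div e + 1} = {..<y} \<union> {y..K div e}" using True by (auto simp: y_def)
      moreover have "{..<y} \<inter> {y..K div e} = {}" by auto
      ultimately show ?thesis by (simp add: sum.union_disjoint)
    qed
    then have "W e = (\<Sum>l<K div e + 1. A (e * l)) - (\<Sum>l<y. A (e * l))" by (simp add: Wform[OF e(1)] y_def)
    then have "norm (W e) \<le> norm (\<Sum>l<K div e + 1. A (e * l)) + norm (\<Sum>l<y. A (e * l))"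
      by (simp add: norm_triangle_ineq4)
    also have "\<dots> \<le> J e + J e"
      unfolding A_def using True by (intro add_mono J e fit) (auto simp: KN y_def)
    finally show ?thesis by simp
  qed
  have W2: "norm (W e) \<le> (real N / real (max u v)) / real Z" if e: "e > Z" for e
  proof -
    have e1: "e \<ge> 1" using e by simp
    have "norm (W e) \<le> (\<Sum>l\<in>{(Y - 1) div e + 1..K div e}. 1)"
      unfolding Wform[OF e1] by (rule sum_norm_le) (simp add: nA)
    also have "\<dots> \<le> real (K div e)" by simp
    also have "\<dots> \<le> real K / real e" by (rule of_nat_div_le_of_nat)
    also have "\<dots> \<le> real K / real Z" using e Z by (intro divide_left_mono) auto
    also have "\<dots> \<le> (real N / real (max u v)) / real Z" unfolding K_def by (intro divide_right_mono of_nat_div_le_of_nat) auto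
    finally show ?thesis .
  qed
  have D0: "D \<ge> 0" using D[of 1] Q by (simp add: Q_def)
  have "norm (\<Sum>e | e dvd Q. of_real (c e) * W e) \<le> (\<Sum>e | e dvd Q. (if e \<le> Z then 2 * real (tau 2 e) * J e else 0) + D * ((real N / real (max u v)) / real Z))"
  proof (rule sum_norm_le)
    fix e assume "e \<in> {e. e dvd Q}"
    then have e: "e \<ge> 1" "e \<le> Q" using dvd_ge_1[of e Q] dvd_imp_le[of e Q] Q by auto
    have n: "norm (of_real (c e) * W e) = \<bar>c e\<bar> * norm (W e)" by (simp add: norm_mult)
    have pos: "0 \<le> D * ((real N / real (max u v)) / real Z)" using D0 by simp
    show "norm (of_real (c e) * W e) \<le> (if e \<le> Z then 2 * real (tau 2 e) * J e else 0) + D * ((real N / real (max u v)) / real Z)"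
    proof (cases "e \<le> Z")
      case True
      have "\<bar>c e\<bar> * norm (W e) \<le> real (tau 2 e) * (2 * J e)" using c[OF e(1)] W1[OF e(1) True] by (intro mult_mono) auto
      then show ?thesis using True n pos by simp
    next
      case False
      have "\<bar>c e\<bar> \<le> D" using c[OF e(1)] D[OF e(1)] e(2) by (simp add: Q_def)
      then have "\<bar>c e\<bar> * norm (W e) \<le> D * ((real N / real (max u v)) / real Z)" using W2[of e] False D0 by (intro mult_mono) auto
      then show ?thesis using False n by simp
    qed
  qed
  also have "\<dots> = (\<Sum>e | e dvd Q. if e \<le> Z then 2 * real (tau 2 e) * J e else 0) + real (tau 2 Q) * (D * ((real N / real (max u v)) / real Z))"
    using Q by (simp add: sum.distrib tau_2)
  also have "\<dots> \<le> (\<Sum>e=1..Z. 2 * real (tau 2 e) * J e) + D * (D * ((real N / real (max u v)) / real Z))"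
  proof (intro add_mono mult_right_mono)
    have "(\<Sum>e | e dvd Q. if e \<le> Z then 2 * real (tau 2 e) * J e else 0) = (\<Sum>e\<in>{e \<in> {e. e dvd Q}. e \<le> Z}. 2 * real (tau 2 e) * J e)"
      by (rule sum.inter_filter[symmetric]) (rule finQ)
    also have "\<dots> \<le> (\<Sum>e=1..Z. 2 * real (tau 2 e) * J e)"
      using J0 Q by (intro sum_mono2) (auto dest: dvd_ge_1)
    finally show "(\<Sum>e | e dvd Q. if e \<le> Z then 2 * real (tau 2 e) * J e else 0) \<le> (\<Sum>e=1..Z. 2 * real (tau 2 e) * J e)" .
    show "real (tau 2 Q) \<le> D" using D[of Q] Q by (simp add: Q_def)
  qed (use D0 in auto)
  finally show ?thesis unfolding main[symmetric] K_def[symmetric] by (simp add: power2_eq_square)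
qed

text \<open>
The products of the two tuples are \<open>u t\<close> and \<open>v t\<close> with \<open>t \<le> N\<^sup>k / max u v\<close>, so the count is at most
the sum of \<open>\<tau>\<^sub>k(u t) \<tau>\<^sub>k(v t)\<close>, and submultiplicativity separates \<open>u\<close> and \<open>v\<close> from \<open>t\<close>.
\<close>
lemma ratio_solution_count:
  assumes a: "\<And>n. norm (a n) = 1" and u: "u \<ge> 1" and v: "v \<ge> 1"
  shows "(\<Sum>ms\<in>tuples {1..N} k. if u dvd prod_list ms then norm (weighted_reps a N k (v * (prod_list ms div u))) else 0)
    \<le> real (tau k u) * real (tau k v) * (real N ^ k / real (max u v)) * hsum (N ^ k) ^ (k * k)"
proof -
  define \<Psi> where "\<Psi> x = (if u dvd x \<and> v * (x div u) \<le> N ^ k then real (tau k (v * (x div u))) else 0)" for x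
  define P where "P = N ^ k div max u v"
  have m: "max u v \<ge> 1" using u by simp
  have "(\<Sum>ms\<in>tuples {1..N} k. if u dvd prod_list ms then norm (weighted_reps a N k (v * (prod_list ms div u))) else 0) \<le> (\<Sum>ms\<in>tuples {1..N} k. \<Psi> (prod_list ms))"
  proof (rule sum_mono)
    fix ms assume ms: "ms \<in> tuples {1..N} k"
    show "(if u dvd prod_list ms then norm (weighted_reps a N k (v * (prod_list ms div u))) else 0) \<le> \<Psi> (prod_list ms)"
    proof (cases "u dvd prod_list ms")
      case True
      then have "prod_list ms div u \<ge> 1" using tuples_prod_pos[OF ms] by (intro div_ge_1) auto
      then have x: "v * (prod_list ms div u) \<ge> 1" using v by (simp add: Suc_le_eq)
      have "norm (weighted_reps a N k (v * (prod_list ms div u))) \<le> (if v * (prod_list ms div u) \<le> N ^ k then real (tau k (v * (prod_list ms div u))) else 0)"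
        by (rule norm_rep_le[OF _ x]) (rule a)
      then show ?thesis using True by (simp add: \<Psi>_def)
    qed (simp add: \<Psi>_def)
  qed
  also have "\<dots> \<le> (\<Sum>x=1..N^k. real (tau k x) * \<Psi> x)"
    by (rule sum_tuples_prod_le) (simp add: \<Psi>_def)
  also have "\<dots> = (\<Sum>x\<in>{x \<in> {1..N^k}. u dvd x \<and> v * (x div u) \<le> N ^ k}. real (tau k x) * real (tau k (v * (x div u))))"
    by (subst sum.inter_filter) (auto simp: \<Psi>_def intro!: sum.cong)
  also have "{x \<in> {1..N^k}. u dvd x \<and> v * (x div u) \<le> N ^ k} = (\<lambda>t. u * t) ` {1..P}"
  proof (intro equalityI subsetI)
    fix x assume "x \<in> {x \<in> {1..N^k}. u dvd x \<and> v * (x div u) \<le> N ^ k}"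
    then obtain t where t: "x = u * t" "1 \<le> u * t" "u * t \<le> N ^ k" "v * t \<le> N ^ k" using u by auto
    have "t * max u v \<le> N ^ k" using t by (auto simp: max_def mult.commute)
    then have "t \<le> P" unfolding P_def using m by (subst less_eq_div_iff_mult_less_eq) auto
    moreover have "t \<ge> 1" using t by (cases t) auto
    ultimately show "x \<in> (\<lambda>t. u * t) ` {1..P}" using t by auto
  next
    fix x assume "x \<in> (\<lambda>t. u * t) ` {1..P}"
    then obtain t where tP: "t \<in> {1..P}" "x = u * t" by blast
    then have t: "x = u * t" "1 \<le> t" "t \<le> P" by simp_all
    have "t * max u v \<le> N ^ k" using t(3) unfolding P_def using m by (subst less_eq_div_iff_mult_less_eq[symmetric]) auto
    moreover have "u * t \<le> t * max u v" "v * t \<le> t * max u v" by (auto simp: mult.commute)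
    ultimately have "u * t \<le> N ^ k" "v * t \<le> N ^ k" by linarith+
    then show "x \<in> {x \<in> {1..N^k}. u dvd x \<and> v * (x div u) \<le> N ^ k}" using t u by (auto simp: Suc_le_eq)
  qed
  also have "(\<Sum>x\<in>(\<lambda>t. u * t) ` {1..P}. real (tau k x) * real (tau k (v * (x div u)))) = (\<Sum>t=1..P. real (tau k (u * t)) * real (tau k (v * t)))"
    using u by (subst sum.reindex) (auto simp: inj_on_def)
  also have "\<dots> \<le> (\<Sum>t=1..P. (real (tau k u) * real (tau k v)) * real (tau (k * k) t))"
  proof (rule sum_mono)
    fix t assume t: "t \<in> {1..P}"
    have "tau k (u * t) * tau k (v * t) \<le> (tau k u * tau k t) * (tau k v * tau k t)"
      using t u v by (intro mult_le_mono tau_submult) auto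
    also have "\<dots> = tau k u * tau k v * (tau k t * tau k t)" by simp
    also have "\<dots> \<le> tau k u * tau k v * tau (k * k) t" using t by (intro mult_le_mono tau_product_le) auto
    finally show "real (tau k (u * t)) * real (tau k (v * t)) \<le> (real (tau k u) * real (tau k v)) * real (tau (k * k) t)"
      by (metis of_nat_le_iff of_nat_mult)
  qed
  also have "\<dots> = real (tau k u) * real (tau k v) * (\<Sum>t=1..P. real (tau (k * k) t))" by (rule sum_distrib_left[symmetric])
  also have "\<dots> \<le> real (tau k u) * real (tau k v) * ((real N ^ k / real (max u v)) * hsum (N ^ k) ^ (k * k))"
  proof (rule mult_left_mono)
    have "(\<Sum>t=1..P. real (tau (k * k) t)) \<le> real P * hsum P ^ (k * k)" by (rule sum_tau_le)
    also have "\<dots> \<le> (real N ^ k / real (max u v)) * hsum (N ^ k) ^ (k * k)"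
    proof (intro mult_mono power_mono hsum_mono hsum_nonneg zero_le_power)
      show "real P \<le> real N ^ k / real (max u v)" unfolding P_def using of_nat_div_le_of_nat[of "N ^ k" "max u v"] by simp
      show "P \<le> N ^ k" unfolding P_def by (rule div_le_dividend)
    qed auto
    finally show "(\<Sum>t=1..P. real (tau (k * k) t)) \<le> (real N ^ k / real (max u v)) * hsum (N ^ k) ^ (k * k)" .
  qed auto
  finally show ?thesis by (simp add: mult.assoc)
qed

lemma sum_pairs_by_gcd:
  fixes F :: "nat \<Rightarrow> nat \<Rightarrow> complex"
  assumes Y: "Y \<ge> 1"
  shows "(\<Sum>n=1..N. \<Sum>m=1..N. if Y \<le> gcd n m \<and> n \<noteq> m then F n m else 0) =
    (\<Sum>(u, v)\<in>{(u, v). u \<in> {1..N} \<and> v \<in> {1..N} \<and> coprime u v \<and> u \<noteq> v}. \<Sum>h=Y..N div max u v. F (u * h) (v * h))"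
proof -
  let ?C = "{(u, v). u \<in> {1..N} \<and> v \<in> {1..N} \<and> coprime u v \<and> u \<noteq> v}"
  have finC: "finite ?C" by (rule finite_subset[of _ "{1..N} \<times> {1..N}"]) auto
  have hK: "h \<le> N div max u v \<longleftrightarrow> u * h \<le> N \<and> v * h \<le> N" if "u \<ge> 1" for u v h :: nat
  proof -
    have "max u v \<ge> 1" using that by simp
    then have "h \<le> N div max u v \<longleftrightarrow> h * max u v \<le> N" by (subst less_eq_div_iff_mult_less_eq) auto
    also have "\<dots> \<longleftrightarrow> u * h \<le> N \<and> v * h \<le> N"
    proof (cases "u \<le> v")
      case True
      then show ?thesis using order_trans[OF mult_le_mono2[OF True, of h], of N] by (auto simp: max_def mult.commute)
    next
      case False
      then have "v \<le> u" by simp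
      from order_trans[OF mult_le_mono2[OF this, of h], of N] show ?thesis using False by (auto simp: max_def mult.commute)
    qed
    finally show ?thesis .
  qed
  have "(\<Sum>n=1..N. \<Sum>m=1..N. if Y \<le> gcd n m \<and> n \<noteq> m then F n m else 0) = (\<Sum>(n, m)\<in>{1..N} \<times> {1..N}. if Y \<le> gcd n m \<and> n \<noteq> m then F n m else 0)"
    by (simp add: sum.cartesian_product)
  also have "\<dots> = (\<Sum>(n, m)\<in>{p \<in> {1..N} \<times> {1..N}. Y \<le> gcd (fst p) (snd p) \<and> fst p \<noteq> snd p}. F n m)"
    by (subst sum.inter_filter) (auto intro!: sum.cong)
  also have "\<dots> = (\<Sum>(p, h)\<in>(SIGMA p:?C. {Y..N div max (fst p) (snd p)}). F (fst p * h) (snd p * h))"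
  proof (rule sum.reindex_bij_witness[of _ "\<lambda>(p, h). (fst p * h, snd p * h)" "\<lambda>(n, m). ((n div gcd n m, m div gcd n m), gcd n m)"], goal_cases)
    case (1 x)
    then show ?case by auto
  next
    case (2 x)
    then obtain n m where x: "x = (n, m)" "n \<in> {1..N}" "m \<in> {1..N}" "Y \<le> gcd n m" "n \<noteq> m" by auto
    define g where "g = gcd n m"
    have g: "g \<ge> 1" using x by (simp add: g_def Suc_le_eq)
    obtain u v where uv: "n = u * g" "m = v * g" "coprime u v"
    proof -
      have "gcd n m \<noteq> 0" using g unfolding g_def by linarith
      from gcd_coprime_exists[OF this] show ?thesis using that unfolding g_def by blast
    qed
    have p1: "u \<ge> 1" "v \<ge> 1" using x uv by (auto simp: Suc_le_eq)
    have p2: "u \<le> N" "v \<le> N"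
    proof -
      have "u \<le> u * g" "v \<le> v * g" using g by simp_all
      moreover have "u * g \<le> N" "v * g \<le> N" using x(2,3) uv(1,2) by (simp_all only: atLeastAtMost_iff)
      ultimately show "u \<le> N" "v \<le> N" by (blast intro: order_trans)+
    qed
    have p3: "u \<noteq> v" using x uv by auto
    have p4: "g \<le> N div max u v" using x uv p1 by (subst hK) auto
    have p5: "Y \<le> g" using x(4) by (simp only: g_def)
    have nm: "n div g = u" "m div g = v" using g uv by auto
    have "((u, v), g) \<in> (SIGMA p:?C. {Y..N div max (fst p) (snd p)})"
      using p1 p2 p3 p4 p5 uv(3) by simp
    then show ?case by (simp only: x(1) case_prod_conv g_def[symmetric] nm)
  next
    case (3 x)
    then obtain u v h where x: "x = ((u, v), h)" "u \<in> {1..N}" "v \<in> {1..N}" "coprime u v" "u \<noteq> v" "Y \<le> h" "h \<le> N div max u v" by auto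
    have "gcd (u * h) (v * h) = h" using x(4) gcd_mult_distrib_nat[of h u v] by (simp add: mult.commute)
    then show ?case using x Y by simp
  next
    case (4 x)
    then obtain u v h where x: "x = ((u, v), h)" "u \<in> {1..N}" "v \<in> {1..N}" "coprime u v" "u \<noteq> v" "Y \<le> h" "h \<le> N div max u v" by auto
    have g: "gcd (u * h) (v * h) = h" using x(4) gcd_mult_distrib_nat[of h u v] by (simp add: mult.commute)
    have "u * h \<le> N" "v * h \<le> N" using x hK[of u h v] by auto
    then show ?case using x Y g by (auto simp: Suc_le_eq)
  next
    case (5 x)
    then obtain n m where x: "x = (n, m)" by (cases x)
    have "n div gcd n m * gcd n m = n" "m div gcd n m * gcd n m = m" by simp_all
    then show ?case using x by simp
  qed
  also have "\<dots> = (\<Sum>p\<in>?C. \<Sum>h=Y..N div max (fst p) (snd p). F (fst p * h) (snd p * h))"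
    by (rule sum.Sigma[symmetric]) (use finC in auto)
  finally show ?thesis by (simp add: case_prod_unfold)
qed

lemma coreterm_scaled:
  assumes "coprime u v" "h \<ge> 1"
  shows "coreterm a N Y k (u * h) (v * h) = (\<Sum>ms\<in>tuples {1..N} k.
    (if u dvd prod_list ms then cnj (weight a ms) * weighted_reps a N k (v * (prod_list ms div u)) else 0) / (1 + of_nat (large_gcd_count Y (u * h) ms)))"
  unfolding coreterm_def
proof (rule sum.cong[OF refl])
  fix ms :: "nat list"
  have d: "u * h dvd v * h * prod_list ms \<longleftrightarrow> u dvd prod_list ms"
  proof -
    have "u * h dvd v * h * prod_list ms \<longleftrightarrow> h * u dvd h * (v * prod_list ms)" by (simp add: mult_ac)
    also have "\<dots> \<longleftrightarrow> u dvd v * prod_list ms" using assms by simp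
    also have "\<dots> \<longleftrightarrow> u dvd prod_list ms" using assms by (simp add: coprime_dvd_mult_right_iff)
    finally show ?thesis .
  qed
  have "v * h * prod_list ms div (u * h) = v * (prod_list ms div u)" if "u dvd prod_list ms"
  proof -
    have "v * h * prod_list ms div (u * h) = h * (v * prod_list ms) div (h * u)" by (simp add: mult_ac)
    also have "\<dots> = v * prod_list ms div u" using assms by simp
    finally show ?thesis using that by (simp add: div_mult_swap)
  qed
  then show "(if u * h dvd v * h * prod_list ms then cnj (weight a ms) * weighted_reps a N k (v * h * prod_list ms div (u * h)) else 0) / (1 + of_nat (large_gcd_count Y (u * h) ms))
    = (if u dvd prod_list ms then cnj (weight a ms) * weighted_reps a N k (v * (prod_list ms div u)) else 0) / (1 + of_nat (large_gcd_count Y (u * h) ms))"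
    by (simp add: d)
qed

text \<open>
The pairs \<open>(n, m)\<close> are parametrized as \<open>(u h, v h)\<close> with \<open>h\<close> their gcd. The sum over \<open>h\<close> is the inner sum,
and the remaining sum over tuples is bounded in absolute value by the number of solutions.
\<close>
lemma off_diagonal_bound:
  fixes a :: "nat \<Rightarrow> complex" and N Y Z k :: nat and D :: real and J :: "nat \<Rightarrow> nat \<Rightarrow> nat \<Rightarrow> real"
  assumes a: "\<And>n. norm (a n) = 1" and Y: "Y \<ge> 1" and Z: "Z \<ge> 1" and N: "N \<ge> 1"
    and D: "\<And>x. 1 \<le> x \<Longrightarrow> x \<le> N ^ k \<Longrightarrow> real (tau 2 x) \<le> D"
    and J0: "\<And>e u v. J e u v \<ge> 0"
    and J: "\<And>e u v x. 1 \<le> e \<Longrightarrow> e \<le> Z \<Longrightarrow> 1 \<le> u \<Longrightarrow> 1 \<le> v \<Longrightarrow> u \<noteq> v \<Longrightarrow> e * max u v \<le> N \<Longrightarrow> x \<le> N div (e * max u v) + 1 \<Longrightarrow>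
      norm (\<Sum>l<x. a (u * (e * l)) * cnj (a (v * (e * l)))) \<le> J e u v"
  shows "norm (\<Sum>n=1..N. \<Sum>m=1..N. if Y \<le> gcd n m \<and> n \<noteq> m then a n * cnj (a m) * coreterm a N Y k n m else 0)
    \<le> real N ^ k * hsum (N ^ k) ^ (k * k) *
      (\<Sum>(u, v)\<in>{(u, v). u \<in> {1..N} \<and> v \<in> {1..N} \<and> u \<noteq> v \<and> Y * max u v \<le> N}.
        real (tau k u) * real (tau k v) / real (max u v) *
        ((\<Sum>e=1..Z. 2 * real (tau 2 e) * J e u v) + D ^ 2 * (real N / real (max u v)) / real Z))"
proof -
  let ?C = "{(u, v). u \<in> {1..N} \<and> v \<in> {1..N} \<and> coprime u v \<and> u \<noteq> v}"
  let ?P = "{(u, v). u \<in> {1..N} \<and> v \<in> {1..N} \<and> u \<noteq> v \<and> Y * max u v \<le> N}"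
  define B where "B u v = (\<Sum>e=1..Z. 2 * real (tau 2 e) * J e u v) + D ^ 2 * (real N / real (max u v)) / real Z" for u v
  have B0: "B u v \<ge> 0" for u v unfolding B_def by (intro add_nonneg_nonneg sum_nonneg) (auto simp: J0)
  define T where "T u v = (real N ^ k * hsum (N ^ k) ^ (k * k)) * (real (tau k u) * real (tau k v) / real (max u v) * B u v)" for u v
  have T0: "T u v \<ge> 0" for u v unfolding T_def using B0 hsum_nonneg by simp
  have finC: "finite ?C" by (rule finite_subset[of _ "{1..N} \<times> {1..N}"]) auto
  have finP: "finite ?P" by (rule finite_subset[of _ "{1..N} \<times> {1..N}"]) auto
  have each: "norm (\<Sum>h=Y..N div max u v. a (u * h) * cnj (a (v * h)) * coreterm a N Y k (u * h) (v * h)) \<le> (if Y * max u v \<le> N then T u v else 0)"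
    if uv: "u \<in> {1..N}" "v \<in> {1..N}" "coprime u v" "u \<noteq> v" for u v
  proof (cases "Y * max u v \<le> N")
    case False
    have "max u v > 0" using uv by auto
    then have "\<not> Y \<le> N div max u v" using False by (subst less_eq_div_iff_mult_less_eq) auto
    then show ?thesis using False by simp
  next
    case True
    define X where "X ms = (if u dvd prod_list ms then cnj (weight a ms) * weighted_reps a N k (v * (prod_list ms div u)) else 0)" for ms
    define I where "I ms = (\<Sum>h=Y..N div max u v. a (u * h) * cnj (a (v * h)) / (1 + of_nat (large_gcd_count Y (u * h) ms)))" for ms
    have "(\<Sum>h=Y..N div max u v. a (u * h) * cnj (a (v * h)) * coreterm a N Y k (u * h) (v * h)) =
       (\<Sum>h=Y..N div max u v. \<Sum>ms\<in>tuples {1..N} k. X ms * (a (u * h) * cnj (a (v * h)) / (1 + of_nat (large_gcd_count Y (u * h) ms))))"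
    proof (rule sum.cong[OF refl])
      fix h assume "h \<in> {Y..N div max u v}"
      then have "h \<ge> 1" using Y by simp
      from coreterm_scaled[OF uv(3) this]
      show "a (u * h) * cnj (a (v * h)) * coreterm a N Y k (u * h) (v * h) = (\<Sum>ms\<in>tuples {1..N} k. X ms * (a (u * h) * cnj (a (v * h)) / (1 + of_nat (large_gcd_count Y (u * h) ms))))"
        by (simp only: X_def[symmetric] sum_distrib_left) (intro sum.cong refl, simp)
    qed
    also have "\<dots> = (\<Sum>ms\<in>tuples {1..N} k. X ms * I ms)"
      unfolding I_def sum_distrib_left by (rule sum.swap)
    finally have eq: "(\<Sum>h=Y..N div max u v. a (u * h) * cnj (a (v * h)) * coreterm a N Y k (u * h) (v * h)) = (\<Sum>ms\<in>tuples {1..N} k. X ms * I ms)" .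
    have "norm (\<Sum>ms\<in>tuples {1..N} k. X ms * I ms) \<le> (\<Sum>ms\<in>tuples {1..N} k. (if u dvd prod_list ms then norm (weighted_reps a N k (v * (prod_list ms div u))) else 0) * B u v)"
    proof (rule sum_norm_le)
      fix ms assume ms: "ms \<in> tuples {1..N} k"
      have nX: "norm (X ms) = (if u dvd prod_list ms then norm (weighted_reps a N k (v * (prod_list ms div u))) else 0)"
      proof -
        have "norm (weight a ms) = 1" by (rule norm_weight) (rule a)
        then show ?thesis by (simp add: X_def norm_mult)
      qed
      have nI: "norm (I ms) \<le> B u v"
        unfolding I_def B_def
      proof (rule inner_sum_bound)
        show "0 \<notin> set ms" by (rule zero_notin_tuples[OF ms])
        show "real (tau 2 x) \<le> D" if "1 \<le> x" "x \<le> prod_list ms" for x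
          using D[of x] that tuples_prod_le[OF ms] by linarith
        show "norm (\<Sum>l<x. a (u * (e * l)) * cnj (a (v * (e * l)))) \<le> J e u v"
          if "1 \<le> e" "e \<le> Z" "e * max u v \<le> N" "x \<le> N div (e * max u v) + 1" for e x
          using J[of e u v x] that uv by simp
      qed (use a Y Z uv J0 in auto)
      show "norm (X ms * I ms) \<le> (if u dvd prod_list ms then norm (weighted_reps a N k (v * (prod_list ms div u))) else 0) * B u v"
        unfolding norm_mult nX using nI by (intro mult_left_mono) auto
    qed
    also have "\<dots> = (\<Sum>ms\<in>tuples {1..N} k. if u dvd prod_list ms then norm (weighted_reps a N k (v * (prod_list ms div u))) else 0) * B u v"
      by (rule sum_distrib_right[symmetric])
    also have "\<dots> \<le> (real (tau k u) * real (tau k v) * (real N ^ k / real (max u v)) * hsum (N ^ k) ^ (k * k)) * B u v"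
      by (intro mult_right_mono B0 ratio_solution_count) (use a uv in auto)
    also have "\<dots> = T u v" by (simp add: T_def)
    finally show ?thesis using True eq by simp
  qed
  have "norm (\<Sum>n=1..N. \<Sum>m=1..N. if Y \<le> gcd n m \<and> n \<noteq> m then a n * cnj (a m) * coreterm a N Y k n m else 0)
     \<le> (\<Sum>p\<in>?C. if Y * max (fst p) (snd p) \<le> N then T (fst p) (snd p) else 0)"
    unfolding sum_pairs_by_gcd[OF Y]
  proof (rule sum_norm_le)
    fix p assume "p \<in> ?C"
    show "norm (case p of (u, v) \<Rightarrow> \<Sum>h=Y..N div max u v. a (u * h) * cnj (a (v * h)) * coreterm a N Y k (u * h) (v * h))
        \<le> (if Y * max (fst p) (snd p) \<le> N then T (fst p) (snd p) else 0)"
    proof (cases p)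
      case (Pair u v)
      with \<open>p \<in> ?C\<close> have "u \<in> {1..N}" "v \<in> {1..N}" "coprime u v" "u \<noteq> v" by auto
      from each[OF this] show ?thesis by (simp only: Pair case_prod_conv fst_conv snd_conv)
    qed
  qed
  also have "\<dots> = (\<Sum>p\<in>{p \<in> ?C. Y * max (fst p) (snd p) \<le> N}. T (fst p) (snd p))"
    using finC by (rule sum.inter_filter[symmetric])
  also have "\<dots> \<le> (\<Sum>p\<in>?P. T (fst p) (snd p))"
    using finP T0 by (intro sum_mono2) auto
  also have "\<dots> = real N ^ k * hsum (N ^ k) ^ (k * k) * (\<Sum>p\<in>?P. real (tau k (fst p)) * real (tau k (snd p)) / real (max (fst p) (snd p)) * B (fst p) (snd p))"
    unfolding T_def by (rule sum_distrib_left[symmetric])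
  finally show ?thesis unfolding B_def by (simp only: case_prod_unfold)
qed

section \<open>Summing over the exceptional triples\<close>

definition max_dilate_sum :: "real poly \<Rightarrow> nat \<Rightarrow> nat \<Rightarrow> nat \<Rightarrow> nat \<Rightarrow> real" where
  "max_dilate_sum g N e u v = Max ((\<lambda>x. norm (dilate_sum g (e * u) (e * v) x)) ` {..N div (e * max u v) + 1})"

lemma max_dilate_sum_ge: "x \<le> N div (e * max u v) + 1 \<Longrightarrow> norm (dilate_sum g (e * u) (e * v) x) \<le> max_dilate_sum g N e u v"
  unfolding max_dilate_sum_def by (intro Max_ge) auto

lemma max_dilate_sum_nonneg: "max_dilate_sum g N e u v \<ge> 0"
  using max_dilate_sum_ge[of 0 N e u v g] by (auto intro: order_trans[OF norm_ge_zero])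

lemma max_dilate_sum_attained:
  obtains x where "x \<le> N div (e * max u v) + 1" "max_dilate_sum g N e u v = norm (dilate_sum g (e * u) (e * v) x)"
proof -
  have "max_dilate_sum g N e u v \<in> (\<lambda>x. norm (dilate_sum g (e * u) (e * v) x)) ` {..N div (e * max u v) + 1}"
    unfolding max_dilate_sum_def by (intro Max_in) auto
  then show ?thesis using that by auto
qed

lemma max_dilate_sum_trivial:
  assumes "1 \<le> e" "1 \<le> u" "e * max u v \<le> N"
  shows "max_dilate_sum g N e u v \<le> 2 * real N / real (e * max u v)"
proof -
  obtain x where x: "x \<le> N div (e * max u v) + 1" "max_dilate_sum g N e u v = norm (dilate_sum g (e * u) (e * v) x)"
    by (rule max_dilate_sum_attained)
  have m: "e * max u v \<ge> 1" using assms by (simp add: Suc_le_eq)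
  have "norm (dilate_sum g (e * u) (e * v) x) \<le> (\<Sum>n<x. 1)"
    unfolding dilate_sum_def by (rule sum_norm_le) simp
  also have "\<dots> \<le> real (N div (e * max u v)) + 1" using x by simp
  also have "\<dots> \<le> real N / real (e * max u v) + 1" using of_nat_div_le_of_nat[of N "e * max u v"] by simp
  also have "1 \<le> real N / real (e * max u v)"
    using assms(3) m by (metis of_nat_le_iff of_nat_0_less_iff le_divide_eq_1_pos less_le_trans zero_less_one)
  finally show ?thesis using x by simp
qed

lemma max_dilate_sum_ordinary:
  assumes "\<not> exceptional g N R e u v" "u \<noteq> v" "1 \<le> e" "1 \<le> u" "1 \<le> v" "e * max u v \<le> N"
  shows "max_dilate_sum g N e u v \<le> real N / (R * real (e * max u v))"
proof -
  obtain x where x: "x \<le> N div (e * max u v) + 1" "max_dilate_sum g N e u v = norm (dilate_sum g (e * u) (e * v) x)"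
    by (rule max_dilate_sum_attained)
  have "\<not> norm (dilate_sum g (e * u) (e * v) x) > real N / (R * real (e * max u v))"
    using assms x(1) unfolding exceptional_def by blast
  then show ?thesis using x(2) by linarith
qed

text \<open>
The pairs \<open>(u, v)\<close> whose ray contains points with \<open>h \<ge> Y\<close>.
\<close>
definition admissible_pairs :: "nat \<Rightarrow> nat \<Rightarrow> (nat \<times> nat) set" where
  "admissible_pairs N Y = {(u, v). u \<in> {1..N} \<and> v \<in> {1..N} \<and> u \<noteq> v \<and> Y * max u v \<le> N}"

definition exceptional_triples :: "real poly \<Rightarrow> nat \<Rightarrow> nat \<Rightarrow> nat \<Rightarrow> real \<Rightarrow> (nat \<times> nat \<times> nat) set" where
  "exceptional_triples g N Y Z R = {(e, u, v). e \<in> {1..Z} \<and> (u, v) \<in> admissible_pairs N Y \<and> exceptional g N R e u v}"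

lemma finite_admissible_pairs [simp]: "finite (admissible_pairs N Y)"
  unfolding admissible_pairs_def by (rule finite_subset[of _ "{1..N} \<times> {1..N}"]) auto

lemma exceptional_triples_subset: "exceptional_triples g N Y Z R \<subseteq> {1..Z} \<times> {1..N} \<times> {1..N}"
  unfolding exceptional_triples_def admissible_pairs_def by auto

lemma finite_exceptional_triples [simp]: "finite (exceptional_triples g N Y Z R)"
  by (rule finite_subset[OF exceptional_triples_subset]) auto

text \<open>
Dyadic decomposition: there are \<open>B\<^sup>2\<close> boxes, and in each of them the weight is constant up to a factor
\<open>8\<close>.
\<close>
lemma exceptional_weight_bound:
  fixes R :: real
  assumes R: "R > 0" and NB: "N < 2 ^ B" and ZN: "Z \<le> N"
    and dens: "\<And>E U. 1 \<le> E \<Longrightarrow> 1 \<le> U \<Longrightarrow> E \<le> 2 * Z \<Longrightarrow> U * Y \<le> 2 * N \<Longrightarrow>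
      real (card (exceptional_box g N R E U)) \<le> real E * real U ^ 2 / R ^ 2"
  shows "(\<Sum>(e, u, v)\<in>exceptional_triples g N Y Z R. 1 / (real e * real (max u v) ^ 2)) \<le> 8 * real B ^ 2 / R ^ 2"
proof -
  define lg where "lg n = (SOME i. 2 ^ i \<le> n \<and> n < 2 ^ (i + 1))" for n :: nat
  have lg: "2 ^ lg n \<le> n \<and> n < 2 ^ (lg n + 1)" if "n \<ge> 1" for n
    unfolding lg_def by (rule someI_ex) (rule ex_power_ivl1, use that in auto)
  have lgB: "lg n < B" if "n \<ge> 1" "n \<le> N" for n
  proof -
    have "(2::nat) ^ lg n < 2 ^ B" using lg[OF that(1)] that(2) NB by linarith
    then show ?thesis by (simp add: power_strict_increasing_iff)
  qed
  define X where "X = exceptional_triples g N Y Z R"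
  define w where "w = (\<lambda>(e, u, v). 1 / (real e * real (max u v) ^ 2))"
  define \<phi> where "\<phi> = (\<lambda>(e, u, v). (lg e, lg (max u v)))"
  have X: "1 \<le> e" "e \<le> Z" "1 \<le> u" "1 \<le> v" "u \<le> N" "v \<le> N" "Y * max u v \<le> N" "exceptional g N R e u v" if "(e, u, v) \<in> X" for e u v
    using that by (auto simp: X_def exceptional_triples_def admissible_pairs_def)
  have img: "\<phi> ` X \<subseteq> {..<B} \<times> {..<B}"
  proof
    fix p assume "p \<in> \<phi> ` X"
    then obtain e u v where t: "(e, u, v) \<in> X" "p = (lg e, lg (max u v))" by (auto simp: \<phi>_def)
    then show "p \<in> {..<B} \<times> {..<B}" using X[OF t(1)] ZN by (auto intro!: lgB)
  qed
  have "(\<Sum>t\<in>X. w t) = (\<Sum>p\<in>{..<B} \<times> {..<B}. \<Sum>t\<in>{t \<in> X. \<phi> t = p}. w t)"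
    by (rule sum.group[symmetric, OF _ _ img]) (auto simp: X_def)
  also have "\<dots> \<le> (\<Sum>p\<in>{..<B} \<times> {..<B}. 8 / R ^ 2)"
  proof (rule sum_mono)
    fix p assume "p \<in> {..<B} \<times> {..<B}"
    obtain i j where p: "p = (i, j)" by (cases p)
    define F where "F = {t \<in> X. \<phi> t = p}"
    show "(\<Sum>t\<in>{t \<in> X. \<phi> t = p}. w t) \<le> 8 / R ^ 2"
    proof (cases "F = {}")
      case True
      then show ?thesis unfolding F_def by (simp only: sum.empty) simp
    next
      case False
      have F: "2 ^ i \<le> e" "e \<le> 2 ^ (i + 1)" "2 ^ j \<le> max u v" "max u v \<le> 2 ^ (j + 1)" "(e, u, v) \<in> X" if "(e, u, v) \<in> F" for e u v
      proof -
        have t: "(e, u, v) \<in> X" "lg e = i" "lg (max u v) = j" using that by (auto simp: F_def \<phi>_def p)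
        show "(e, u, v) \<in> X" by (rule t)
        show "2 ^ i \<le> e" "e \<le> 2 ^ (i + 1)" using lg[of e] X[OF t(1)] t(2) by auto
        have "max u v \<ge> 1" using X[OF t(1)] by simp
        then show "2 ^ j \<le> max u v" "max u v \<le> 2 ^ (j + 1)" using lg[of "max u v"] t(3) by auto
      qed
      define E where "E = (2::nat) ^ (i + 1)"
      define U where "U = (2::nat) ^ (j + 1)"
      obtain e0 u0 v0 where t0: "(e0, u0, v0) \<in> F" using False by auto
      have "E \<le> 2 * Z" using F(1)[OF t0] X(2)[OF F(5)[OF t0]] by (simp add: E_def)
      moreover have "U * Y \<le> 2 * N"
      proof -
        have "2 ^ j * Y \<le> max u0 v0 * Y" using F(3)[OF t0] by (intro mult_le_mono1)
        also have "\<dots> \<le> N" using X(7)[OF F(5)[OF t0]] by (simp add: mult.commute)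
        finally show ?thesis by (simp add: U_def)
      qed
      ultimately have d: "real (card (exceptional_box g N R E U)) \<le> real E * real U ^ 2 / R ^ 2"
        by (intro dens) (auto simp: E_def U_def)
      have "F \<subseteq> exceptional_box g N R E U"
      proof
        fix t assume t: "t \<in> F"
        obtain e u v where eq: "t = (e, u, v)" by (cases t)
        show "t \<in> exceptional_box g N R E U"
          using F[of e u v] X[of e u v] t unfolding eq exceptional_box_def E_def U_def by auto
      qed
      from card_mono[OF finite_exceptional_box this] have cF: "real (card F) \<le> real E * real U ^ 2 / R ^ 2"
        using d by linarith
      have "(\<Sum>t\<in>F. w t) \<le> (\<Sum>t\<in>F. 1 / (2 ^ i * (2 ^ j) ^ 2))"
      proof (rule sum_mono)
        fix t assume t: "t \<in> F"
        obtain e u v where eq: "t = (e, u, v)" by (cases t)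
        have r: "(2::real) ^ i \<le> real e" "(2::real) ^ j \<le> real (max u v)"
          using F(1,3)[of e u v] t unfolding eq by (metis of_nat_le_iff of_nat_numeral of_nat_power)+
        have "(2::real) ^ i * (2 ^ j) ^ 2 \<le> real e * real (max u v) ^ 2"
          using r by (intro mult_mono power_mono) auto
        then show "w t \<le> 1 / (2 ^ i * (2 ^ j) ^ 2)"
          unfolding eq w_def case_prod_conv by (intro frac_le) auto
      qed
      also have "\<dots> = real (card F) / (2 ^ i * (2 ^ j) ^ 2)" by simp
      also have "\<dots> \<le> (real E * real U ^ 2 / R ^ 2) / (2 ^ i * (2 ^ j) ^ 2)" using cF by (intro divide_right_mono) auto
      also have "\<dots> = 8 / R ^ 2" by (simp add: E_def U_def power_mult_distrib field_simps)
      finally show ?thesis by (simp only: F_def)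
    qed
  qed
  also have "\<dots> = 8 * real B ^ 2 / R ^ 2" by (simp add: power2_eq_square)
  finally show ?thesis by (simp add: X_def w_def)
qed

text \<open>
Replacing \<open>(max u v)\<^sup>2\<close> by \<open>u v\<close> decouples the variables and costs no more than logarithms.
\<close>
lemma triple_sum_le:
  fixes f1 f2 f3 :: "nat \<Rightarrow> real"
  assumes nn: "\<And>n. f1 n \<ge> 0" "\<And>n. f2 n \<ge> 0" "\<And>n. f3 n \<ge> 0" and X: "X \<subseteq> {1..N} \<times> {1..N} \<times> {1..N}"
    and s: "(\<Sum>n=1..N. f1 n / real n) \<le> A1" "(\<Sum>n=1..N. f2 n / real n) \<le> A2" "(\<Sum>n=1..N. f3 n / real n) \<le> A3"
  shows "(\<Sum>(e, u, v)\<in>X. f1 e * f2 u * f3 v / (real e * real (max u v) ^ 2)) \<le> A1 * A2 * A3"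
proof -
  have "(\<Sum>(e, u, v)\<in>X. f1 e * f2 u * f3 v / (real e * real (max u v) ^ 2))
     \<le> (\<Sum>(e, u, v)\<in>X. (f1 e / real e) * ((f2 u / real u) * (f3 v / real v)))"
  proof (rule sum_mono)
    fix t assume t: "t \<in> X"
    obtain e u v where eq: "t = (e, u, v)" by (cases t)
    have pos: "e \<ge> 1" "u \<ge> 1" "v \<ge> 1" using t X eq by auto
    have "real u * real v \<le> real (max u v) * real (max u v)" by (intro mult_mono) auto
    then have "f1 e * f2 u * f3 v / (real e * real (max u v) ^ 2) \<le> f1 e * f2 u * f3 v / (real e * (real u * real v))"
      using pos nn by (intro divide_left_mono mult_left_mono mult_pos_pos mult_nonneg_nonneg) (auto simp: power2_eq_square)
    then show "(case t of (e, u, v) \<Rightarrow> f1 e * f2 u * f3 v / (real e * real (max u v) ^ 2)) \<le> (case t of (e, u, v) \<Rightarrow> (f1 e / real e) * ((f2 u / real u) * (f3 v / real v)))"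
      unfolding eq by (simp add: mult_ac)
  qed
  also have "\<dots> \<le> (\<Sum>(e, u, v)\<in>{1..N} \<times> {1..N} \<times> {1..N}. (f1 e / real e) * ((f2 u / real u) * (f3 v / real v)))"
    using X nn by (intro sum_mono2) (auto simp: case_prod_unfold)
  also have "\<dots> = (\<Sum>n=1..N. f1 n / real n) * ((\<Sum>n=1..N. f2 n / real n) * (\<Sum>n=1..N. f3 n / real n))"
  proof -
    have "(\<Sum>n=1..N. f1 n / real n) * ((\<Sum>n=1..N. f2 n / real n) * (\<Sum>n=1..N. f3 n / real n))
       = (\<Sum>n=1..N. f1 n / real n) * (\<Sum>u=1..N. \<Sum>v=1..N. (f2 u / real u) * (f3 v / real v))"
      by (simp only: sum_product)
    also have "\<dots> = (\<Sum>e=1..N. \<Sum>u=1..N. (f1 e / real e) * (\<Sum>v=1..N. (f2 u / real u) * (f3 v / real v)))"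
      by (rule sum_product)
    also have "\<dots> = (\<Sum>e=1..N. \<Sum>u=1..N. \<Sum>v=1..N. (f1 e / real e) * ((f2 u / real u) * (f3 v / real v)))"
      by (simp only: sum_distrib_left)
    also have "\<dots> = (\<Sum>(e, u, v)\<in>{1..N} \<times> {1..N} \<times> {1..N}. (f1 e / real e) * ((f2 u / real u) * (f3 v / real v)))"
      by (simp only: sum.cartesian_product)
    finally show ?thesis by (rule sym)
  qed
  also have "\<dots> \<le> A1 * (A2 * A3)"
  proof -
    have n: "0 \<le> (\<Sum>n=1..N. f1 n / real n)" "0 \<le> (\<Sum>n=1..N. f2 n / real n)" "0 \<le> (\<Sum>n=1..N. f3 n / real n)"
      using nn by (simp_all add: sum_nonneg)
    have "A1 \<ge> 0" "A2 \<ge> 0" using n s by linarith+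
    then show ?thesis by (intro mult_mono s n mult_nonneg_nonneg)
  qed
  finally show ?thesis by (simp only: mult.assoc)
qed

text \<open>
The three terms come from the ordinary triples, which save the factor \<open>R\<close>, from the exceptional
ones, where the Cauchy-Schwarz inequality separates their rarity (giving \<open>B / R\<close>) from the divisor
functions, and from the divisors \<open>e > Z\<close>.
\<close>
lemma pair_sum_estimate:
  fixes R D :: real and g :: "real poly"
  assumes R: "R > 0" and NB: "N < 2 ^ B" and Z1: "1 \<le> Z" and ZY: "Z \<le> Y" and ZN: "Z \<le> N" and N: "N \<ge> 1"
    and dens: "\<And>E U. 1 \<le> E \<Longrightarrow> 1 \<le> U \<Longrightarrow> E \<le> 2 * Z \<Longrightarrow> U * Y \<le> 2 * N \<Longrightarrow>
      real (card (exceptional_box g N R E U)) \<le> real E * real U ^ 2 / R ^ 2"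
  shows "(\<Sum>(u, v)\<in>admissible_pairs N Y. real (tau k u) * real (tau k v) / real (max u v) *
        ((\<Sum>e=1..Z. 2 * real (tau 2 e) * max_dilate_sum g N e u v) + D ^ 2 * (real N / real (max u v)) / real Z))
    \<le> real N * (2 / R * hsum N ^ (2 + 2 * k) + 12 * real B / R * hsum N ^ (2 + k * k) + D ^ 2 / real Z * hsum N ^ (2 * k))"
proof -
  define P where "P = admissible_pairs N Y"
  define h where "h = hsum N"
  define X where "X = exceptional_triples g N Y Z R"
  define J where "J = max_dilate_sum g N"
  have h1: "h \<ge> 1" unfolding h_def using N by (rule hsum_ge_1)
  have tk: "(\<Sum>n=1..N. real (tau j n) / real n) \<le> h ^ j" for j unfolding h_def by (rule sum_tau_div_le)
  have P: "1 \<le> u" "1 \<le> v" "u \<noteq> v" "u \<le> N" "v \<le> N" "Y * max u v \<le> N" if "(u, v) \<in> P" for u v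
    using that by (auto simp: P_def admissible_pairs_def)
  have fit: "e * max u v \<le> N" if "(u, v) \<in> P" "e \<in> {1..Z}" for e u v
  proof -
    have "e * max u v \<le> Y * max u v" using that ZY by (intro mult_le_mono1) auto
    then show ?thesis using P(6)[OF that(1)] by linarith
  qed
  define W where "W = (\<lambda>(e, u, v). real (tau 2 e) * real (tau k u) * real (tau k v))"
  define m where "m = (\<lambda>(e, u, v). real e * real (max u v) ^ 2)"
  define T where "T = {1..Z} \<times> P"
  have TN: "T \<subseteq> {1..N} \<times> {1..N} \<times> {1..N}" unfolding T_def using P ZN by auto
  have XT: "X \<subseteq> T" unfolding X_def T_def P_def exceptional_triples_def by auto
  have finT: "finite T" unfolding T_def P_def by simp
  have finX: "finite X" unfolding X_def by simp
  have W0: "W t \<ge> 0" for t by (simp add: W_def case_prod_unfold)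
  have m0: "m t \<ge> 0" for t by (simp add: m_def case_prod_unfold)
  have split: "(\<Sum>(u, v)\<in>P. real (tau k u) * real (tau k v) / real (max u v) *
        ((\<Sum>e=1..Z. 2 * real (tau 2 e) * J e u v) + D ^ 2 * (real N / real (max u v)) / real Z))
     = (\<Sum>t\<in>T. case t of (e, u, v) \<Rightarrow> real (tau k u) * real (tau k v) / real (max u v) * (2 * real (tau 2 e) * J e u v))
       + D ^ 2 * real N / real Z * (\<Sum>(u, v)\<in>P. real (tau k u) * real (tau k v) / real (max u v) ^ 2)"
  proof -
    have "(\<Sum>(u, v)\<in>P. real (tau k u) * real (tau k v) / real (max u v) *
        ((\<Sum>e=1..Z. 2 * real (tau 2 e) * J e u v) + D ^ 2 * (real N / real (max u v)) / real Z))
      = (\<Sum>(u, v)\<in>P. (\<Sum>e=1..Z. real (tau k u) * real (tau k v) / real (max u v) * (2 * real (tau 2 e) * J e u v)) + D ^ 2 * real N / real Z * (real (tau k u) * real (tau k v) / real (max u v) ^ 2))"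
      by (intro sum.cong refl) (simp add: case_prod_unfold distrib_left sum_distrib_left power2_eq_square mult_ac)
    also have "\<dots> = (\<Sum>p\<in>P. \<Sum>e=1..Z. real (tau k (fst p)) * real (tau k (snd p)) / real (max (fst p) (snd p)) * (2 * real (tau 2 e) * J e (fst p) (snd p)))
        + D ^ 2 * real N / real Z * (\<Sum>(u, v)\<in>P. real (tau k u) * real (tau k v) / real (max u v) ^ 2)"
      by (simp only: case_prod_unfold sum.distrib sum_distrib_left)
    also have "(\<Sum>p\<in>P. \<Sum>e=1..Z. real (tau k (fst p)) * real (tau k (snd p)) / real (max (fst p) (snd p)) * (2 * real (tau 2 e) * J e (fst p) (snd p)))
       = (\<Sum>t\<in>T. case t of (e, u, v) \<Rightarrow> real (tau k u) * real (tau k v) / real (max u v) * (2 * real (tau 2 e) * J e u v))"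
      unfolding T_def by (subst sum.swap) (simp only: sum.cartesian_product case_prod_unfold)
    finally show ?thesis .
  qed
  have third: "(\<Sum>(u, v)\<in>P. real (tau k u) * real (tau k v) / real (max u v) ^ 2) \<le> h ^ (2 * k)"
  proof -
    have "(\<Sum>(u, v)\<in>P. real (tau k u) * real (tau k v) / real (max u v) ^ 2)
       = (\<Sum>(e, u, v)\<in>{1} \<times> P. real (tau 0 e) * real (tau k u) * real (tau k v) / (real e * real (max u v) ^ 2))"
      by (rule sum.reindex_bij_witness[of _ snd "\<lambda>p. (1, p)"]) auto
    also have "\<dots> \<le> h ^ 0 * h ^ k * h ^ k"
      by (rule triple_sum_le[OF _ _ _ _ tk tk tk]) (use P N in auto)
    finally show ?thesis by (simp add: mult_2 power_add)
  qed
  have tri: "(case t of (e, u, v) \<Rightarrow> real (tau k u) * real (tau k v) / real (max u v) * (2 * real (tau 2 e) * J e u v))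
      \<le> 2 * real N / R * (W t / m t) + (if t \<in> X then 4 * real N * (W t / m t) else 0)" if t: "t \<in> T" for t
  proof -
    obtain e u v where eq: "t = (e, u, v)" by (cases t)
    have tP: "(u, v) \<in> P" "e \<in> {1..Z}" using t eq by (auto simp: T_def)
    note uv = P[OF tP(1)] and ft = fit[OF tP]
    define M where "M = real (max u v)"
    have M: "M > 0" and e: "real e > 0" using uv tP by (auto simp: M_def)
    have ratio: "W t / m t = real (tau k u) * real (tau k v) / M * (real (tau 2 e) / (real e * M))"
      by (simp add: eq W_def m_def M_def power2_eq_square mult_ac)
    have pre: "real (tau k u) * real (tau k v) / M * (2 * real (tau 2 e) * J e u v) \<le> real (tau k u) * real (tau k v) / M * (2 * real (tau 2 e) * B')"
      if "J e u v \<le> B'" for B'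
      using that M by (intro mult_left_mono) auto
    have nn: "2 * real N / R * (W t / m t) \<ge> 0" using R W0 m0 by simp
    show ?thesis
    proof (cases "t \<in> X")
      case True
      have "J e u v \<le> 2 * real N / (real e * M)"
        using max_dilate_sum_trivial[of e u v N g] uv tP ft by (simp add: J_def M_def)
      from pre[OF this] have "real (tau k u) * real (tau k v) / M * (2 * real (tau 2 e) * J e u v) \<le> 4 * real N * (W t / m t)"
        unfolding ratio by (simp add: mult_ac)
      then show ?thesis using True nn by (simp add: eq M_def)
    next
      case False
      have "\<not> exceptional g N R e u v"
        using False tP by (auto simp: X_def exceptional_triples_def P_def eq)
      from max_dilate_sum_ordinary[OF this uv(3) _ uv(1) uv(2) ft] have "J e u v \<le> real N / (R * (real e * M))"
        using tP by (simp add: J_def M_def)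
      from pre[OF this] have "real (tau k u) * real (tau k v) / M * (2 * real (tau 2 e) * J e u v) \<le> 2 * real N / R * (W t / m t)"
        unfolding ratio by (simp add: mult_ac)
      then show ?thesis using False by (simp add: eq M_def)
    qed
  qed
  have all: "(\<Sum>t\<in>T. W t / m t) \<le> h ^ (2 + 2 * k)"
  proof -
    have "(\<Sum>t\<in>T. W t / m t) = (\<Sum>(e, u, v)\<in>T. real (tau 2 e) * real (tau k u) * real (tau k v) / (real e * real (max u v) ^ 2))"
      by (simp add: W_def m_def case_prod_unfold)
    also have "\<dots> \<le> h ^ 2 * h ^ k * h ^ k"
      by (rule triple_sum_le[OF _ _ _ TN tk tk tk]) auto
    also have "\<dots> = h ^ (2 + 2 * k)" by (simp only: power_add mult_2 mult.assoc)
    finally show ?thesis .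
  qed
  have exc: "(\<Sum>t\<in>X. W t / m t) \<le> 3 * real B / R * h ^ (2 + k * k)"
  proof -
    have mp: "m t > 0" if "t \<in> X" for t
      using that XT TN by (cases t) (force simp: m_def)
    have S: "(\<Sum>t\<in>X. (1 / sqrt (m t))\<^sup>2) \<le> 8 * real B ^ 2 / R ^ 2"
    proof -
      have "(\<Sum>t\<in>X. (1 / sqrt (m t))\<^sup>2) = (\<Sum>(e, u, v)\<in>X. 1 / (real e * real (max u v) ^ 2))"
        by (intro sum.cong refl) (simp add: power_divide m0, simp add: m_def case_prod_unfold)
      then show ?thesis using exceptional_weight_bound[OF R NB ZN dens] by (simp add: X_def)
    qed
    have V: "(\<Sum>t\<in>X. (W t / sqrt (m t))\<^sup>2) \<le> h ^ 4 * h ^ (k * k) * h ^ (k * k)"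
    proof -
      have "(\<Sum>t\<in>X. (W t / sqrt (m t))\<^sup>2) = (\<Sum>(e, u, v)\<in>X. real (tau 2 e) ^ 2 * real (tau k u) ^ 2 * real (tau k v) ^ 2 / (real e * real (max u v) ^ 2))"
        by (intro sum.cong refl) (simp add: power_divide m0, simp add: m_def W_def case_prod_unfold power_mult_distrib)
      also have "\<dots> \<le> (\<Sum>(e, u, v)\<in>X. real (tau 4 e) * real (tau (k * k) u) * real (tau (k * k) v) / (real e * real (max u v) ^ 2))"
      proof (rule sum_mono)
        fix t assume t: "t \<in> X"
        obtain e u v where eq: "t = (e, u, v)" by (cases t)
        have pos: "e \<ge> 1" "u \<ge> 1" "v \<ge> 1" using t XT TN eq by auto
        have sq: "real (tau j n) ^ 2 \<le> real (tau (j * j) n)" if "n \<ge> 1" for j n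
          using tau_product_le[OF that, of j j] by (metis of_nat_le_iff of_nat_mult power2_eq_square)
        have "real (tau 2 e) ^ 2 * real (tau k u) ^ 2 * real (tau k v) ^ 2 \<le> real (tau 4 e) * real (tau (k * k) u) * real (tau (k * k) v)"
          using sq[OF pos(1), of 2] sq[OF pos(2), of k] sq[OF pos(3), of k] by (intro mult_mono) auto
        then show "(case t of (e, u, v) \<Rightarrow> real (tau 2 e) ^ 2 * real (tau k u) ^ 2 * real (tau k v) ^ 2 / (real e * real (max u v) ^ 2))
          \<le> (case t of (e, u, v) \<Rightarrow> real (tau 4 e) * real (tau (k * k) u) * real (tau (k * k) v) / (real e * real (max u v) ^ 2))"
          unfolding eq case_prod_conv by (rule divide_right_mono) simp
      qed
      also have "\<dots> \<le> h ^ 4 * h ^ (k * k) * h ^ (k * k)"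
        by (rule triple_sum_le[OF _ _ _ order_trans[OF XT TN] tk tk tk]) auto
      finally show ?thesis .
    qed
    have "(\<Sum>t\<in>X. W t / m t) = (\<Sum>t\<in>X. (1 / sqrt (m t)) * (W t / sqrt (m t)))"
    proof (rule sum.cong[OF refl])
      fix t assume "t \<in> X"
      have "sqrt (m t) * sqrt (m t) = m t" using m0 by simp
      then show "W t / m t = (1 / sqrt (m t)) * (W t / sqrt (m t))" by simp
    qed
    then have "(\<Sum>t\<in>X. W t / m t)\<^sup>2 \<le> (\<Sum>t\<in>X. (1 / sqrt (m t))\<^sup>2) * (\<Sum>t\<in>X. (W t / sqrt (m t))\<^sup>2)"
      using Cauchy_Schwarz_ineq_sum[of "\<lambda>t. 1 / sqrt (m t)" "\<lambda>t. W t / sqrt (m t)" X] by simp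
    also have "\<dots> \<le> (8 * real B ^ 2 / R ^ 2) * (h ^ 4 * h ^ (k * k) * h ^ (k * k))"
      using S V by (intro mult_mono) (auto intro!: sum_nonneg)
    also have "\<dots> \<le> (9 * real B ^ 2 / R ^ 2) * (h ^ 4 * h ^ (k * k) * h ^ (k * k))"
      using h1 R by (intro mult_right_mono divide_right_mono) auto
    also have "\<dots> = (3 * real B / R * h ^ (2 + k * k))\<^sup>2"
    proof -
      have "h ^ 4 = (h\<^sup>2)\<^sup>2" by simp
      then show ?thesis by (simp only: power_mult_distrib power_divide power_add power2_eq_square) (simp add: field_simps)
    qed
    finally show ?thesis
      by (rule power2_le_imp_le) (use h1 R in simp)
  qed
  have "(\<Sum>t\<in>T. case t of (e, u, v) \<Rightarrow> real (tau k u) * real (tau k v) / real (max u v) * (2 * real (tau 2 e) * J e u v))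
     \<le> (\<Sum>t\<in>T. 2 * real N / R * (W t / m t) + (if t \<in> X then 4 * real N * (W t / m t) else 0))"
    by (rule sum_mono) (rule tri)
  also have "\<dots> = 2 * real N / R * (\<Sum>t\<in>T. W t / m t) + 4 * real N * (\<Sum>t\<in>X. W t / m t)"
  proof -
    have "(\<Sum>t\<in>T. if t \<in> X then 4 * real N * (W t / m t) else 0) = (\<Sum>t\<in>X. 4 * real N * (W t / m t))"
      using XT finT by (simp add: sum.If_cases Int_absorb1)
    then show ?thesis by (simp only: sum.distrib sum_distrib_left)
  qed
  also have "\<dots> \<le> 2 * real N / R * h ^ (2 + 2 * k) + 4 * real N * (3 * real B / R * h ^ (2 + k * k))"
    using all exc R by (intro add_mono mult_left_mono) auto
  finally have part1: "(\<Sum>t\<in>T. case t of (e, u, v) \<Rightarrow> real (tau k u) * real (tau k v) / real (max u v) * (2 * real (tau 2 e) * J e u v))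
     \<le> 2 * real N / R * h ^ (2 + 2 * k) + 4 * real N * (3 * real B / R * h ^ (2 + k * k))" .
  have part2: "D ^ 2 * real N / real Z * (\<Sum>(u, v)\<in>P. real (tau k u) * real (tau k v) / real (max u v) ^ 2) \<le> D ^ 2 * real N / real Z * h ^ (2 * k)"
    using third by (intro mult_left_mono) auto
  have "2 * real N / R * h ^ (2 + 2 * k) + 4 * real N * (3 * real B / R * h ^ (2 + k * k)) + D ^ 2 * real N / real Z * h ^ (2 * k)
     = real N * (2 / R * h ^ (2 + 2 * k) + 12 * real B / R * h ^ (2 + k * k) + D ^ 2 / real Z * h ^ (2 * k))"
    by (simp add: algebra_simps)
  then show ?thesis using part1 part2 split unfolding P_def[symmetric] h_def[symmetric] J_def[symmetric] by linarith
qed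

section \<open>Asymptotics of the moments\<close>

text \<open>
The exponent \<open>r = 32 s\<^sup>2\<close> makes the target to the power \<open>r\<close> equal to \<open>N\<^sup>2\<^sup>s\<close>, while \<open>\<tau>\<^sub>j(x)\<^sup>r\<close> is at most \<open>N\<^sup>s\<close>
times a power of \<open>log N\<close>.
\<close>
lemma tau_eventually_small:
  assumes s: "s \<ge> 1"
  shows "\<exists>N0. \<forall>N\<ge>N0. \<forall>j\<le>s. \<forall>x. 1 \<le> x \<longrightarrow> x \<le> N ^ s \<longrightarrow> real (tau j x) \<le> real N powr (1 / (16 * real s))"
proof -
  define r where "r = 32 * s * s"
  define p where "p = s ^ r"
  define c where "c = 1 + 2 * real p * real s"
  have p: "p \<ge> 1" using s by (simp add: p_def)
  have c1: "c \<ge> 1" by (simp add: c_def)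
  define N0 where "N0 = nat \<lceil>c ^ (2 * p)\<rceil>"
  show ?thesis
  proof (intro exI[of _ "max 1 N0"] allI impI)
    fix N j x assume N: "max 1 N0 \<le> N" and j: "j \<le> s" and x: "1 \<le> x" "x \<le> N ^ s"
    have N1: "real N \<ge> 1" "N \<ge> 1" and Nc: "c ^ (2 * p) \<le> real N" using N unfolding N0_def by linarith+
    define b where "b = 1 / (2 * real p)"
    have b0: "b > 0" using p by (simp add: b_def)
    define X where "X = real N powr b"
    have X1: "X \<ge> 1" unfolding X_def using N1 b0 by (intro ge_one_powr_ge_zero) auto
    have Xp: "X ^ (2 * p) = real N"
    proof -
      have "X ^ (2 * p) = real N powr (b * real (2 * p))" unfolding X_def using N1 by (subst powr_realpow[symmetric]) (auto simp: powr_powr)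
      also have "b * real (2 * p) = 1" using p by (simp add: b_def)
      finally show ?thesis using N1 by simp
    qed
    have cX: "c \<le> X"
    proof (rule power_le_imp_le_base)
      have "c ^ Suc (2 * p - 1) = c ^ (2 * p)" "X ^ Suc (2 * p - 1) = X ^ (2 * p)" using p by (simp_all del: power_Suc)
      then show "c ^ Suc (2 * p - 1) \<le> X ^ Suc (2 * p - 1)" using Nc Xp by simp
    qed (use X1 in simp)
    have "hsum (N ^ s) \<le> 1 + ln (real (N ^ s))" using N1 by (intro hsum_le) (simp add: one_le_power)
    also have "\<dots> = 1 + real s * ln (real N)" using N1 by (simp add: ln_realpow)
    also have "\<dots> \<le> 1 + real s * (X / b)"
    proof -
      have "ln (real N) \<le> X / b" unfolding X_def using N1 b0 by (intro ln_powr_bound) auto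
      then show ?thesis by (intro add_left_mono mult_left_mono) auto
    qed
    also have "1 + real s * (X / b) \<le> c * X"
      using X1 p by (simp add: b_def c_def algebra_simps)
    finally have h: "hsum (N ^ s) \<le> c * X" .
    have h1: "hsum (N ^ s) \<ge> 1" using N1 by (intro hsum_ge_1) (simp add: one_le_power)
    have "real (tau j x) ^ r \<le> real (N ^ s) * hsum (N ^ s) ^ (j ^ r)" by (rule tau_power_bound[OF x])
    also have "\<dots> \<le> real (N ^ s) * hsum (N ^ s) ^ p"
      unfolding p_def using h1 j by (intro mult_left_mono power_increasing power_mono) auto
    also have "\<dots> \<le> real (N ^ s) * (X * X) ^ p"
    proof (intro mult_left_mono power_mono)
      have "c * X \<le> X * X" using cX X1 by (intro mult_right_mono) auto
      then show "hsum (N ^ s) \<le> X * X" using h by linarith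
    qed (use h1 in auto)
    also have "(X * X) ^ p = real N" using Xp by (simp add: power_mult power2_eq_square)
    also have "real (N ^ s) * real N \<le> real (N ^ s) * real N ^ s"
      using N1 s by (intro mult_left_mono self_le_power) auto
    also have "\<dots> = real N powr (2 * real s)"
    proof -
      have "real N ^ s = real N powr real s" using N1 by (intro powr_realpow[symmetric]) auto
      then show ?thesis by (simp flip: powr_add)
    qed
    also have "\<dots> = (real N powr (1 / (16 * real s))) ^ r"
    proof -
      have "(real N powr (1 / (16 * real s))) ^ r = real N powr (1 / (16 * real s) * real r)"
        using N1 by (subst powr_realpow[symmetric]) (auto simp: powr_powr)
      also have "1 / (16 * real s) * real r = 2 * real s" using s by (simp add: r_def)
      finally show ?thesis by simp
    qed
    finally have "real (tau j x) ^ r \<le> (real N powr (1 / (16 * real s))) ^ r" .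
    moreover have "r = Suc (r - 1)" using s by (simp add: r_def)
    ultimately show "real (tau j x) \<le> real N powr (1 / (16 * real s))"
      by (metis power_le_imp_le_base powr_ge_zero)
  qed
qed

lemma moment_0: "moment a N 0 = 1"
  by (simp add: moment_def weighted_reps_def weight_def)

lemma off_diagonal_phase_bound:
  fixes g :: "real poly" and N Y Z k B :: nat and R D :: real
  assumes R: "R > 0" and NB: "N < 2 ^ B" and Y: "Y \<ge> 1" and Z1: "1 \<le> Z" and ZY: "Z \<le> Y" and ZN: "Z \<le> N" and N: "N \<ge> 1"
    and D: "\<And>x. 1 \<le> x \<Longrightarrow> x \<le> N ^ k \<Longrightarrow> real (tau 2 x) \<le> D"
    and dens: "\<And>E U. 1 \<le> E \<Longrightarrow> 1 \<le> U \<Longrightarrow> E \<le> 2 * Z \<Longrightarrow> U * Y \<le> 2 * N \<Longrightarrow>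
      real (card (exceptional_box g N R E U)) \<le> real E * real U ^ 2 / R ^ 2"
    and a_def: "a = (\<lambda>n. unit_exp (poly g (real n)))"
  shows "norm (\<Sum>n=1..N. \<Sum>m=1..N. if Y \<le> gcd n m \<and> n \<noteq> m then a n * cnj (a m) * coreterm a N Y k n m else 0)
    \<le> real N ^ k * hsum (N ^ k) ^ (k * k) *
      (real N * (2 / R * hsum N ^ (2 + 2 * k) + 12 * real B / R * hsum N ^ (2 + k * k) + D ^ 2 / real Z * hsum N ^ (2 * k)))"
proof -
  have "norm (\<Sum>n=1..N. \<Sum>m=1..N. if Y \<le> gcd n m \<and> n \<noteq> m then a n * cnj (a m) * coreterm a N Y k n m else 0)
    \<le> real N ^ k * hsum (N ^ k) ^ (k * k) *
      (\<Sum>(u, v)\<in>{(u, v). u \<in> {1..N} \<and> v \<in> {1..N} \<and> u \<noteq> v \<and> Y * max u v \<le> N}.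
        real (tau k u) * real (tau k v) / real (max u v) *
        ((\<Sum>e=1..Z. 2 * real (tau 2 e) * max_dilate_sum g N e u v) + D ^ 2 * (real N / real (max u v)) / real Z))"
  proof (rule off_diagonal_bound)
    show "norm (a n) = 1" for n by (simp add: a_def)
    show "norm (\<Sum>l<x. a (u * (e * l)) * cnj (a (v * (e * l)))) \<le> max_dilate_sum g N e u v"
      if "x \<le> N div (e * max u v) + 1" for e u v x
    proof -
      have "(\<Sum>l<x. a (u * (e * l)) * cnj (a (v * (e * l)))) = dilate_sum g (e * u) (e * v) x"
        unfolding dilate_sum_def a_def unit_exp_mult_cnj by (simp add: mult_ac)
      then show ?thesis using max_dilate_sum_ge[OF that, of g] by simp
    qed
  qed (use Y Z1 N D max_dilate_sum_nonneg in auto)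
  also have "\<dots> \<le> real N ^ k * hsum (N ^ k) ^ (k * k) *
      (real N * (2 / R * hsum N ^ (2 + 2 * k) + 12 * real B / R * hsum N ^ (2 + k * k) + D ^ 2 / real Z * hsum N ^ (2 * k)))"
    unfolding admissible_pairs_def[symmetric]
    by (intro mult_left_mono pair_sum_estimate R NB Z1 ZY ZN N dens) (auto simp: hsum_nonneg)
  finally show ?thesis .
qed

lemma moment_recurrence_error:
  fixes g :: "real poly" and N Y Z k B :: nat and R D :: real
  assumes R: "R > 0" and NB: "N < 2 ^ B" and Y: "Y \<ge> 1" and Z1: "1 \<le> Z" and ZY: "Z \<le> Y" and ZN: "Z \<le> N" and N: "N \<ge> 1"
    and D: "\<And>j x. j \<le> Suc k \<or> j = 2 \<Longrightarrow> 1 \<le> x \<Longrightarrow> x \<le> N ^ Suc k \<Longrightarrow> real (tau j x) \<le> D"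
    and dens: "\<And>E U. 1 \<le> E \<Longrightarrow> 1 \<le> U \<Longrightarrow> E \<le> 2 * Z \<Longrightarrow> U * Y \<le> 2 * N \<Longrightarrow>
      real (card (exceptional_box g N R E U)) \<le> real E * real U ^ 2 / R ^ 2"
    and a_def: "a = (\<lambda>n. unit_exp (poly g (real n)))"
  shows "norm (moment a N (Suc k) - of_nat (Suc k) * of_nat N * moment a N k) \<le>
     real Y ^ Suc k * real N ^ k * D ^ 2 + real (Suc k) * (real Y * real N ^ k * D + real k * D ^ 2 * real N ^ Suc k / real Y +
       real N ^ k * hsum (N ^ k) ^ (k * k) *
      (real N * (2 / R * hsum N ^ (2 + 2 * k) + 12 * real B / R * hsum N ^ (2 + k * k) + D ^ 2 / real Z * hsum N ^ (2 * k))))"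
proof -
  have au: "norm (a n) = 1" for n by (simp add: a_def)
  have aa: "a n * cnj (a n) = 1" for n by (simp add: a_def unit_exp_mult_cnj)
  define O' where "O' = (\<Sum>n=1..N. \<Sum>m=1..N. if Y \<le> gcd n m \<and> n \<noteq> m then a n * cnj (a m) * coreterm a N Y k n m else 0)"
  define S where "S = (\<Sum>n=1..N. if Y \<le> n then coreterm a N Y k n n else 0)"
  have "(\<Sum>m=1..N. if Y \<le> gcd n m then a n * cnj (a m) * coreterm a N Y k n m else 0) =
      (if Y \<le> n then coreterm a N Y k n n else 0) + (\<Sum>m=1..N. if Y \<le> gcd n m \<and> n \<noteq> m then a n * cnj (a m) * coreterm a N Y k n m else 0)"
    if n: "n \<in> {1..N}" for n
  proof -
    have "(\<Sum>m=1..N. if Y \<le> gcd n m then a n * cnj (a m) * coreterm a N Y k n m else 0) =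
      (\<Sum>m=1..N. (if m = n then (if Y \<le> n then coreterm a N Y k n n else 0) else 0) + (if Y \<le> gcd n m \<and> n \<noteq> m then a n * cnj (a m) * coreterm a N Y k n m else 0))"
      by (intro sum.cong refl) (auto simp: aa)
    also have "\<dots> = (if Y \<le> n then coreterm a N Y k n n else 0) + (\<Sum>m=1..N. if Y \<le> gcd n m \<and> n \<noteq> m then a n * cnj (a m) * coreterm a N Y k n m else 0)"
      using n unfolding sum.distrib by (subst sum.delta) auto
    finally show ?thesis .
  qed
  then have dec: "(\<Sum>n=1..N. \<Sum>m=1..N. if Y \<le> gcd n m then a n * cnj (a m) * coreterm a N Y k n m else 0) = S + O'"
    unfolding S_def O'_def sum.distrib[symmetric] by (rule sum.cong[OF refl])
  have "moment a N (Suc k) = smallterm a N Y k + of_nat (Suc k) * (S + O')"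
    unfolding dec[symmetric] by (rule moment_Suc_split[OF au Y N])
  then have "moment a N (Suc k) - of_nat (Suc k) * of_nat N * moment a N k = smallterm a N Y k + of_nat (Suc k) * ((S - of_nat N * moment a N k) + O')"
    by (simp add: algebra_simps del: of_nat_Suc)
  then have "norm (moment a N (Suc k) - of_nat (Suc k) * of_nat N * moment a N k) \<le> norm (smallterm a N Y k) + norm (of_nat (Suc k) * ((S - of_nat N * moment a N k) + O'))"
    by (simp only: norm_triangle_ineq)
  also have "norm (of_nat (Suc k) * ((S - of_nat N * moment a N k) + O')) = real (Suc k) * norm ((S - of_nat N * moment a N k) + O')"
    by (simp only: norm_mult norm_of_nat)
  also have "\<dots> \<le> real (Suc k) * (norm (S - of_nat N * moment a N k) + norm O')"
    by (intro mult_left_mono norm_triangle_ineq) simp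
  finally have tri: "norm (moment a N (Suc k) - of_nat (Suc k) * of_nat N * moment a N k) \<le> norm (smallterm a N Y k) + real (Suc k) * (norm (S - of_nat N * moment a N k) + norm O')"
    by simp
  have D': "real (tau j x) \<le> D" if "j \<le> Suc k" "1 \<le> x" "x \<le> N ^ Suc k" for j x using D[of j x] that by blast
  have s: "norm (smallterm a N Y k) \<le> real Y ^ Suc k * real N ^ k * D ^ 2"
    by (rule norm_smallterm[OF au Y N D'])
  have dg: "norm (S - of_nat N * moment a N k) \<le> real Y * real N ^ k * D + real k * D ^ 2 * real N ^ Suc k / real Y"
    unfolding S_def by (rule diagonal_estimate[OF au Y N D'])
  have o: "norm O' \<le> real N ^ k * hsum (N ^ k) ^ (k * k) *
      (real N * (2 / R * hsum N ^ (2 + 2 * k) + 12 * real B / R * hsum N ^ (2 + k * k) + D ^ 2 / real Z * hsum N ^ (2 * k)))"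
    unfolding O'_def
  proof (rule off_diagonal_phase_bound[OF R NB Y Z1 ZY ZN N _ dens a_def])
    fix x assume x: "1 \<le> x" "x \<le> N ^ k"
    have "N ^ k \<le> N ^ Suc k" using N by (intro power_increasing) auto
    then show "real (tau 2 x) \<le> D" using D[of 2 x] x by linarith
  qed
  have "real (Suc k) * (norm (S - of_nat N * moment a N k) + norm O') \<le> real (Suc k) * (real Y * real N ^ k * D + real k * D ^ 2 * real N ^ Suc k / real Y +
       real N ^ k * hsum (N ^ k) ^ (k * k) *
      (real N * (2 / R * hsum N ^ (2 + 2 * k) + 12 * real B / R * hsum N ^ (2 + k * k) + D ^ 2 / real Z * hsum N ^ (2 * k))))"
    using dg o by (intro mult_left_mono) auto
  then show ?thesis using tri s by linarith
qed

text \<open>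
Here \<open>N = M\<^sup>1\<^sup>6\<^sup>s\<close>, \<open>Y\<close> and \<open>Z\<close> are close to \<open>M\<^sup>8\<close> and \<open>M\<^sup>4\<close>, and divisor functions are at most \<open>M\<close>. Thus
\<open>Y\<^sup>s\<close> is at most the square root of \<open>N\<close>, and both \<open>Y\<close> and \<open>Z\<close> exceed the losses \<open>M\<^sup>2\<close> by at least another
factor \<open>M \<ge> R\<close>. Every error in the recurrence is then a saving of \<open>R\<close> up to a power of \<open>log N\<close>, and
iterating the recurrence from \<open>k = 0\<close> produces the factorial.
\<close>
lemma moment_asymptotic:
  fixes g :: "real poly" and N s :: nat and R M :: real
  defines "a \<equiv> (\<lambda>n. unit_exp (poly g (real n)))"
  defines "Y \<equiv> nat \<lfloor>M ^ 8\<rfloor>" and "Z \<equiv> nat \<lceil>M ^ 4\<rceil>"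
  assumes s: "s \<ge> 2" and N3: "N \<ge> 3" and M: "M ^ (16 * s) = real N" and M4: "M \<ge> 4" and R1: "R \<ge> 1" and RM: "R \<le> M"
    and D: "\<And>j x. j \<le> s \<Longrightarrow> 1 \<le> x \<Longrightarrow> x \<le> N ^ s \<Longrightarrow> real (tau j x) \<le> M"
    and dens: "\<And>E U. 1 \<le> E \<Longrightarrow> 1 \<le> U \<Longrightarrow> E \<le> 2 * Z \<Longrightarrow> U * Y \<le> 2 * N \<Longrightarrow>
      real (card (exceptional_box g N R E U)) \<le> real E * real U ^ 2 / R ^ 2"
  shows "norm (moment a N s - of_nat (fact s) * of_nat N ^ s)
    \<le> (1 + real s ^ 2 + 39 * real s) * (real s * real s ^ s) * real N ^ s * (((1 + real s) * ln (real N)) ^ (3 * s ^ 2) / R)"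
proof -
  have N1: "N \<ge> 1" using N3 by simp
  define \<Lambda> where "\<Lambda> = ln (real N)"
  have L1: "\<Lambda> \<ge> 1"
  proof -
    have "exp 1 \<le> (3::real)" using exp_le by simp
    also have "\<dots> \<le> real N" using N3 by simp
    finally show ?thesis using N3 unfolding \<Lambda>_def by (subst ln_ge_iff) auto
  qed
  define H where "H = (1 + real s) * \<Lambda>"
  have H1: "H \<ge> 1" unfolding H_def using L1 mult_mono[of 1 "1 + real s" 1 \<Lambda>] by simp
  define G where "G = H ^ (3 * s ^ 2)"
  have G1: "G \<ge> 1" unfolding G_def using H1 by (rule one_le_power)
  have HG: "H ^ i \<le> G" if "i \<le> 3 * s ^ 2" for i unfolding G_def using H1 that by (intro power_increasing) auto
  have hH: "hsum X \<le> H" if "1 \<le> X" "X \<le> N ^ s" for X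
  proof -
    have "hsum X \<le> hsum (N ^ s)" by (rule hsum_mono[OF that(2)])
    also have "\<dots> \<le> 1 + ln (real (N ^ s))" using N1 by (intro hsum_le) (simp add: one_le_power)
    also have "\<dots> = 1 + real s * \<Lambda>" using N1 by (simp add: ln_realpow \<Lambda>_def)
    also have "\<dots> \<le> H" using L1 by (simp add: H_def algebra_simps)
    finally show ?thesis .
  qed
  have Mpow: "M ^ i \<le> M ^ j" if "i \<le> j" for i j using M4 that by (intro power_increasing) auto
  have Y: "real Y \<le> M ^ 8" "M ^ 8 / 2 \<le> real Y" and Z: "M ^ 4 \<le> real Z" "real Z \<le> 2 * M ^ 4"
  proof -
    have m: "M ^ 8 \<ge> 4" "M ^ 4 \<ge> 4" using Mpow[of 1 8] Mpow[of 1 4] M4 by auto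
    show "real Y \<le> M ^ 8" "M ^ 8 / 2 \<le> real Y" using m(1) unfolding Y_def by linarith+
    show "M ^ 4 \<le> real Z" "real Z \<le> 2 * M ^ 4" using m(2) unfolding Z_def by linarith+
  qed
  have m2: "2 * M ^ i \<le> M ^ Suc i" for i using M4 by simp
  have Y1: "Y \<ge> 1" and Z1: "Z \<ge> 1"
  proof -
    have "M ^ 8 \<ge> 4" "M ^ 4 \<ge> 4" using Mpow[of 1 8] Mpow[of 1 4] M4 by auto
    then have "real Y > 0" "real Z > 0" using Y Z by linarith+
    then show "Y \<ge> 1" "Z \<ge> 1" by auto
  qed
  have ZY: "Z \<le> Y"
  proof -
    have "2 * (2 * M ^ 4) \<le> M ^ 8" using m2[of 4] m2[of 5] Mpow[of 6 8] by simp
    then have "real Z \<le> real Y" using Y Z by linarith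
    then show ?thesis by simp
  qed
  have YN: "Y \<le> N"
  proof -
    have "M ^ 8 \<le> M ^ (16 * s)" using s by (intro Mpow) auto
    then have "real Y \<le> real N" using Y M by linarith
    then show ?thesis by simp
  qed
  have ZN: "Z \<le> N" using ZY YN by simp
  define B where "B = nat \<lfloor>log 2 (real N)\<rfloor> + 1"
  have NB: "N < 2 ^ B"
  proof -
    have l0: "log 2 (real N) \<ge> 0" using N1 by simp
    have "real N = 2 powr (log 2 (real N))" using N1 by simp
    also have "\<dots> < 2 powr (real B)" using l0 unfolding B_def by (intro powr_less_mono) linarith+
    also have "\<dots> = real (2 ^ B)" by (simp add: powr_realpow)
    finally show ?thesis using of_nat_less_iff by blast
  qed
  have BH: "real B \<le> 3 * H"
  proof -
    have "log 2 (real N) = \<Lambda> / ln 2" by (simp add: log_def \<Lambda>_def)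
    also have "\<dots> \<le> \<Lambda> / (1 / 2)" using L1 ln2_ge_two_thirds by (intro divide_left_mono) auto
    finally have "log 2 (real N) \<le> 2 * \<Lambda>" by simp
    moreover have "log 2 (real N) \<ge> 0" using N1 by simp
    ultimately have "real B \<le> 2 * \<Lambda> + 1" unfolding B_def by linarith
    also have "\<dots> \<le> 3 * \<Lambda>" using L1 by simp
    also have "\<dots> \<le> 3 * H" unfolding H_def using L1 mult_right_mono[of 1 "1 + real s" \<Lambda>] by simp
    finally show ?thesis .
  qed
  define C' where "C' = 1 + real s ^ 2 + 39 * real s"
  have R0: "R > 0" using R1 by simp
  have step: "norm (moment a N (Suc k) - of_nat (Suc k) * of_nat N * moment a N k) \<le> C' * real N ^ Suc k * (G / R)" if k: "Suc k \<le> s" for k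
  proof -
    have Nks: "N ^ Suc k \<le> N ^ s" using N1 k by (intro power_increasing) auto
    have Nk1: "1 \<le> N ^ k" using N1 by (simp add: one_le_power)
    have Nk2: "N ^ k \<le> N ^ s" using N1 k by (intro power_increasing) auto
    have Nk3: "N \<le> N ^ s" using N1 s by (intro self_le_power) auto
    define h where "h = hsum N"
    define hk where "hk = hsum (N ^ k)"
    have hb: "0 \<le> h" "h \<le> H" "0 \<le> hk" "hk \<le> H"
      unfolding h_def hk_def using hH[OF N1 Nk3] hH[OF Nk1 Nk2] by (auto simp: hsum_nonneg)
    have DD: "real (tau j x) \<le> M" if "j \<le> Suc k \<or> j = 2" "1 \<le> x" "x \<le> N ^ Suc k" for j x
    proof (rule D)
      show "j \<le> s" using that(1) k s by linarith
      show "x \<le> N ^ s" using that(3) Nks by linarith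
    qed (rule that)
    note E = moment_recurrence_error[where g = g and k = k and a = a and D = M, OF R0 NB Y1 Z1 ZY ZN N1 DD dens a_def[THEN meta_eq_to_obj_eq]]
    define n where "n = real N ^ Suc k / R"
    have n0: "n \<ge> 0" using R0 by (simp add: n_def)
    have t1: "real Y ^ Suc k * real N ^ k * M ^ 2 \<le> n"
    proof -
      have "real Y ^ Suc k * M ^ 2 * R \<le> (M ^ 8) ^ Suc k * M ^ 2 * M"
        using Y RM M4 R0 by (intro mult_mono power_mono) auto
      also have "\<dots> = M ^ (8 * Suc k + 3)" by (simp only: power_mult[symmetric] power_add) (simp add: power2_eq_square power3_eq_cube)
      also have "\<dots> \<le> M ^ (16 * s)" using k s by (intro Mpow) auto
      finally have "real Y ^ Suc k * M ^ 2 * R \<le> real N" using M by simp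
      then have "real N ^ k * (real Y ^ Suc k * M ^ 2 * R) \<le> real N ^ k * real N" by (intro mult_left_mono) auto
      then show ?thesis using R0 by (simp add: n_def field_simps)
    qed
    have t2: "real Y * real N ^ k * M \<le> n"
    proof -
      have "real Y * M * R \<le> M ^ 8 * M * M"
        using Y RM M4 R0 by (intro mult_mono) auto
      also have "\<dots> = M ^ 10" by (simp add: eval_nat_numeral)
      also have "\<dots> \<le> M ^ (16 * s)" using s by (intro Mpow) auto
      finally have "real Y * M * R \<le> real N" using M by simp
      then have "real N ^ k * (real Y * M * R) \<le> real N ^ k * real N" by (intro mult_left_mono) auto
      then show ?thesis using R0 by (simp add: n_def field_simps)
    qed
    have M3: "M ^ 2 * R \<le> M ^ 3" using RM M4 by (simp add: power3_eq_cube power2_eq_square)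
    have t3: "real k * M ^ 2 * real N ^ Suc k / real Y \<le> real k * n"
    proof -
      have "2 * M ^ 3 \<le> M ^ 8" using m2[of 3] Mpow[of 4 8] by simp
      then have "M ^ 2 * R \<le> real Y" using M3 Y by linarith
      then have "M ^ 2 / real Y \<le> 1 / R" using R0 Y1 by (simp add: field_simps)
      then have "real k * real N ^ Suc k * (M ^ 2 / real Y) \<le> real k * real N ^ Suc k * (1 / R)" by (intro mult_left_mono) auto
      then show ?thesis by (simp add: n_def mult_ac)
    qed
    have zz: "M ^ 2 / real Z \<le> 1 / R"
    proof -
      have "M ^ 2 * R \<le> real Z" using M3 Mpow[of 3 4] Z by linarith
      then show ?thesis using R0 Z1 by (simp add: field_simps)
    qed
    have ks: "k + 1 \<le> s" using k by simp
    have ksq: "(k + 1) * (k + 1) \<le> s ^ 2" using mult_le_mono[OF ks ks] by (simp add: power2_eq_square)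
    have e1: "k * k + (2 + 2 * k) \<le> 3 * s ^ 2" "k * k + (2 + k * k) + 1 \<le> 3 * s ^ 2" "k * k + 2 * k \<le> 3 * s ^ 2"
      using ksq by (auto simp: algebra_simps)
    have mono: "hk ^ (k * k) * h ^ i \<le> H ^ (k * k + i)" for i
      unfolding power_add using hb by (intro mult_mono power_mono) auto
    have b1: "hk ^ (k * k) * (2 / R * h ^ (2 + 2 * k)) \<le> 2 * (G / R)"
    proof -
      have "2 / R * (hk ^ (k * k) * h ^ (2 + 2 * k)) \<le> 2 / R * G"
        using order_trans[OF mono HG[OF e1(1)]] R0 by (intro mult_left_mono) auto
      then show ?thesis by (simp add: mult_ac)
    qed
    have b2: "hk ^ (k * k) * (12 * real B / R * h ^ (2 + k * k)) \<le> 36 * (G / R)"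
    proof -
      have "real B * (hk ^ (k * k) * h ^ (2 + k * k)) \<le> (3 * H) * H ^ (k * k + (2 + k * k))"
        using BH mono[of "2 + k * k"] hb H1 by (intro mult_mono) auto
      also have "\<dots> = 3 * H ^ (k * k + (2 + k * k) + 1)" by simp
      also have "\<dots> \<le> 3 * G" using HG[OF e1(2)] by simp
      finally have "12 / R * (real B * (hk ^ (k * k) * h ^ (2 + k * k))) \<le> 12 / R * (3 * G)" using R0 by (intro mult_left_mono) auto
      then show ?thesis by (simp add: mult_ac)
    qed
    have b3: "hk ^ (k * k) * (M ^ 2 / real Z * h ^ (2 * k)) \<le> G / R"
    proof -
      have "(M ^ 2 / real Z) * (hk ^ (k * k) * h ^ (2 * k)) \<le> 1 / R * G"
        using zz order_trans[OF mono HG[OF e1(3)]] hb R0 by (intro mult_mono) auto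
      then show ?thesis by (simp add: mult_ac)
    qed
    have t4: "real N ^ k * hk ^ (k * k) * (real N * (2 / R * h ^ (2 + 2 * k) + 12 * real B / R * h ^ (2 + k * k) + M ^ 2 / real Z * h ^ (2 * k))) \<le> 39 * G * n"
    proof -
      have "hk ^ (k * k) * (2 / R * h ^ (2 + 2 * k) + 12 * real B / R * h ^ (2 + k * k) + M ^ 2 / real Z * h ^ (2 * k)) \<le> 39 * (G / R)"
        using b1 b2 b3 by (simp only: distrib_left)
      then have "real N ^ Suc k * (hk ^ (k * k) * (2 / R * h ^ (2 + 2 * k) + 12 * real B / R * h ^ (2 + k * k) + M ^ 2 / real Z * h ^ (2 * k))) \<le> real N ^ Suc k * (39 * (G / R))"
        by (intro mult_left_mono) auto
      then show ?thesis by (simp add: n_def mult_ac)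
    qed
    have "norm (moment a N (Suc k) - of_nat (Suc k) * of_nat N * moment a N k) \<le> n + real (Suc k) * (n + real k * n + 39 * G * n)"
    proof -
      have "real (Suc k) * (real Y * real N ^ k * M + real k * M ^ 2 * real N ^ Suc k / real Y +
         real N ^ k * hk ^ (k * k) * (real N * (2 / R * h ^ (2 + 2 * k) + 12 * real B / R * h ^ (2 + k * k) + M ^ 2 / real Z * h ^ (2 * k))))
         \<le> real (Suc k) * (n + real k * n + 39 * G * n)"
        using t2 t3 t4 by (intro mult_left_mono add_mono) auto
      then show ?thesis using E t1 unfolding h_def[symmetric] hk_def[symmetric] by linarith
    qed
    also have "\<dots> = (1 + real (Suc k) * real (Suc k) + 39 * real (Suc k) * G) * n" by (simp add: algebra_simps)
    also have "\<dots> \<le> (1 * G + real s ^ 2 * G + 39 * real s * G) * n"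
    proof (intro mult_right_mono add_mono)
      have "real (Suc k) * real (Suc k) \<le> real s * real s" using k by (intro mult_mono) auto
      also have "\<dots> \<le> real s ^ 2 * G" using G1 by (simp add: power2_eq_square mult_le_cancel_left1)
      finally show "real (Suc k) * real (Suc k) \<le> real s ^ 2 * G" .
    qed (use k G1 n0 in auto)
    also have "\<dots> = C' * real N ^ Suc k * (G / R)" by (simp add: C'_def n_def algebra_simps)
    finally show ?thesis .
  qed
  have C'0: "C' \<ge> 0" by (simp add: C'_def)
  have GR0: "G / R \<ge> 0" using G1 R0 by simp
  have "norm (moment a N k - of_nat (fact k) * of_nat N ^ k) \<le> C' * (real k * real s ^ k) * real N ^ k * (G / R)" if "k \<le> s" for k
    using that
  proof (induction k)
    case 0
    then show ?case by (simp add: moment_0)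
  next
    case (Suc k)
    have IH: "norm (moment a N k - of_nat (fact k) * of_nat N ^ k) \<le> C' * (real k * real s ^ k) * real N ^ k * (G / R)" using Suc by simp
    define e where "e = moment a N k - of_nat (fact k) * of_nat N ^ k"
    have "moment a N (Suc k) - of_nat (fact (Suc k)) * of_nat N ^ Suc k =
        (moment a N (Suc k) - of_nat (Suc k) * of_nat N * moment a N k) + of_nat (Suc k) * of_nat N * e"
      by (simp add: e_def algebra_simps)
    then have "norm (moment a N (Suc k) - of_nat (fact (Suc k)) * of_nat N ^ Suc k) \<le>
        norm (moment a N (Suc k) - of_nat (Suc k) * of_nat N * moment a N k) + norm (of_nat (Suc k) * of_nat N * e)"
      by (simp only: norm_triangle_ineq)
    also have "norm (of_nat (Suc k) * of_nat N * e) = real (Suc k) * real N * norm e"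
      by (simp only: norm_mult norm_of_nat)
    also have "real (Suc k) * real N * norm e \<le> real s * real N * (C' * (real k * real s ^ k) * real N ^ k * (G / R))"
      using IH Suc.prems unfolding e_def by (intro mult_mono) auto
    also have "norm (moment a N (Suc k) - of_nat (Suc k) * of_nat N * moment a N k) \<le> C' * real N ^ Suc k * (G / R)"
      by (rule step[OF Suc.prems])
    also have "C' * real N ^ Suc k * (G / R) + real s * real N * (C' * (real k * real s ^ k) * real N ^ k * (G / R)) =
        C' * (1 + real k * real s ^ Suc k) * real N ^ Suc k * (G / R)" by (simp add: algebra_simps)
    also have "\<dots> \<le> C' * (real (Suc k) * real s ^ Suc k) * real N ^ Suc k * (G / R)"
    proof (intro mult_right_mono mult_left_mono)
      have "1 \<le> real s ^ Suc k" using s by (intro one_le_power) auto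
      then show "1 + real k * real s ^ Suc k \<le> real (Suc k) * real s ^ Suc k" by (simp add: distrib_right del: power_Suc)
    qed (use C'0 GR0 in auto)
    finally show ?case by simp
  qed
  from this[of s] show ?thesis by (simp only: C'_def G_def H_def \<Lambda>_def order_refl simp_thms)
qed

section \<open>The dichotomy\<close>

theorem theorem2:
  shows "\<exists>A>0. \<forall>d\<ge>1. \<exists>B>0. \<exists>K>0. \<forall>s\<ge>2. \<exists>c\<^sub>0>0. \<exists>N\<^sub>0. \<exists>C>0.
    \<forall>N\<ge>N\<^sub>0. \<forall>g :: real poly. degree g = d \<longrightarrow>
    (\<forall>(M :: 'a measure) f. steinhaus M f \<longrightarrow>
    (\<forall>\<delta>::real. real N powr (- c\<^sub>0) < \<delta> \<and> \<delta> < 1 / 8 \<longrightarrow>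
       \<bar>(LINT \<omega>|M. norm (normalized_sum f g N \<omega>) ^ (2 * s)) - fact s\<bar>
         \<le> C * \<delta> * ln (real N) powr (A * real s ^ 2)
     \<or> (\<exists>q::int. q \<noteq> 0 \<and> \<bar>real_of_int q\<bar> \<le> K * \<delta> powr (- B) \<and>
          smoothness_norm (real N) (smult (real_of_int q) g) \<le> K * \<delta> powr (- B))))"
proof (rule exI[of _ 3], rule conjI, simp, intro allI impI)
  fix d :: nat assume d: "d \<ge> 1"
  obtain C0 :: nat where C0: "\<And>R N g E U. R \<ge> (2::real) \<Longrightarrow> degree g = d \<Longrightarrow> E \<ge> 1 \<Longrightarrow> U \<ge> 1 \<Longrightarrow> R ^ C0 * real E * real U \<le> real N \<Longrightarrow>
     real (card (exceptional_box g N R E U)) \<ge> real E * real U ^ 2 / R ^ 2 \<Longrightarrow>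
     (\<exists>q\<ge>1. real q \<le> R ^ C0 \<and> (\<forall>j\<in>{1..d}. dist_to_int (real q * coeff g j) \<le> R ^ C0 / real N ^ j))"
    using box_inverse_theorem[OF d] by blast
  have main: "\<exists>c\<^sub>0>0. \<exists>N\<^sub>0. \<exists>C>0.
    \<forall>N\<ge>N\<^sub>0. \<forall>g :: real poly. degree g = d \<longrightarrow>
    (\<forall>(M :: 'a measure) f. steinhaus M f \<longrightarrow>
    (\<forall>\<delta>::real. real N powr (- c\<^sub>0) < \<delta> \<and> \<delta> < 1 / 8 \<longrightarrow>
       \<bar>(LINT \<omega>|M. norm (normalized_sum f g N \<omega>) ^ (2 * s)) - fact s\<bar>
         \<le> C * \<delta> * ln (real N) powr (3 * real s ^ 2)
     \<or> (\<exists>q::int. q \<noteq> 0 \<and> \<bar>real_of_int q\<bar> \<le> 1 * \<delta> powr (- (real C0 + 1)) \<and>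
          smoothness_norm (real N) (smult (real_of_int q) g) \<le> 1 * \<delta> powr (- (real C0 + 1)))))"
    if s: "s \<ge> 2" for s :: nat
  proof -
    obtain N1 where N1: "\<And>N j x. N \<ge> N1 \<Longrightarrow> j \<le> s \<Longrightarrow> 1 \<le> x \<Longrightarrow> x \<le> N ^ s \<Longrightarrow> real (tau j x) \<le> real N powr (1 / (16 * real s))"
      using tau_eventually_small[of s] s by auto
    \<comment> \<open>With this choice both R and R to the power C0 stay below M = N to the power 1 / (16 s).\<close>
    define c0 where "c0 = 1 / (16 * real s * (real C0 + 1))"
    define N0 where "N0 = max N1 (4 ^ (16 * s))"
    define C where "C = (1 + real s ^ 2 + 39 * real s) * (real s * real s ^ s) * (1 + real s) ^ (3 * s ^ 2)"
    have Cpos: "C > 0" unfolding C_def using s by (intro mult_pos_pos add_pos_nonneg) auto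
    have c0pos: "c0 > 0" unfolding c0_def using s by (intro divide_pos_pos mult_pos_pos) auto
    show ?thesis
    proof (rule exI[of _ c0], rule conjI, rule c0pos, rule exI[of _ N0], rule exI[of _ C], rule conjI, rule Cpos, intro allI impI)
      fix N :: nat and g :: "real poly" and P :: "'a measure" and f :: "nat \<Rightarrow> 'a \<Rightarrow> complex" and \<delta> :: real
      assume N: "N0 \<le> N" and deg: "degree g = d" and st: "steinhaus P f" and \<delta>: "real N powr (- c0) < \<delta> \<and> \<delta> < 1 / 8"
      define M where "M = real N powr (1 / (16 * real s))"
      have N4: "4 ^ (16 * s) \<le> N" and NN1: "N1 \<le> N" using N by (auto simp: N0_def)
      have "(4::nat) ^ 1 \<le> 4 ^ (16 * s)" using s by (intro power_increasing) auto
      then have N3: "N \<ge> 3" using N4 by simp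
      have Ms: "M ^ (16 * s) = real N"
      proof -
        have "M ^ (16 * s) = real N powr (1 / (16 * real s) * real (16 * s))"
          unfolding M_def using N3 by (subst powr_realpow[symmetric]) (auto simp: powr_powr)
        also have "1 / (16 * real s) * real (16 * s) = 1" using s by simp
        finally show ?thesis using N3 by simp
      qed
      have M0: "M > 0" unfolding M_def using N3 by simp
      have M4: "M \<ge> 4"
      proof (rule power_le_imp_le_base)
        have "(4::real) ^ (16 * s) \<le> real N" using N4 by (metis of_nat_le_iff of_nat_numeral of_nat_power)
        then show "(4::real) ^ Suc (16 * s - 1) \<le> M ^ Suc (16 * s - 1)" using Ms s by (simp del: power_Suc)
      qed (use M0 in simp)
      define R where "R = 1 / \<delta>"
      have \<delta>0: "\<delta> > 0" using \<delta> by (meson less_trans powr_gt_zero le_less_trans powr_ge_zero)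
      have R8: "R \<ge> 8" using \<delta> \<delta>0 by (simp add: R_def field_simps)
      have Rc: "R < real N powr c0"
      proof -
        have "1 / \<delta> < 1 / (real N powr (- c0))" using \<delta> \<delta>0 N3 by (intro divide_strict_left_mono) auto
        then show ?thesis by (simp add: R_def powr_minus field_simps)
      qed
      have RC: "R ^ (C0 + 1) \<le> M"
      proof -
        have "R ^ (C0 + 1) \<le> (real N powr c0) ^ (C0 + 1)" using Rc R8 by (intro power_mono) auto
        also have "\<dots> = real N powr (c0 * real (C0 + 1))"
          using N3 by (subst powr_realpow[symmetric]) (auto simp: powr_powr)
        also have "c0 * real (C0 + 1) = 1 / (16 * real s)"
        proof -
          have "1 / (x * z) * z = 1 / x" if "z \<noteq> 0" for x z :: real using that by simp
          from this[of "real C0 + 1" "16 * real s"] have "1 / (16 * real s * (real C0 + 1)) * (real C0 + 1) = 1 / (16 * real s)"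
            by linarith
          moreover have "real (C0 + 1) = real C0 + 1" by simp
          ultimately show ?thesis by (simp only: c0_def)
        qed
        finally show ?thesis by (simp add: M_def)
      qed
      have RM: "R \<le> M"
      proof -
        have "R ^ 1 \<le> R ^ (C0 + 1)" using R8 by (intro power_increasing) auto
        then show ?thesis using RC by simp
      qed
      have RCM: "R ^ C0 \<le> M"
      proof -
        have "R ^ C0 \<le> R ^ (C0 + 1)" using R8 by (intro power_increasing) auto
        then show ?thesis using RC by linarith
      qed
      have R\<delta>: "R ^ C0 \<le> \<delta> powr (- (real C0 + 1))"
      proof -
        have "R ^ C0 \<le> R ^ (C0 + 1)" using R8 by (intro power_increasing) auto
        also have "\<dots> = R powr (real C0 + 1)" using R8 by (subst powr_realpow[symmetric]) (auto simp: add.commute)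
        also have "\<dots> = \<delta> powr (- (real C0 + 1))" using \<delta>0 unfolding R_def powr_minus_divide by (simp add: powr_divide)
        finally show ?thesis .
      qed
      define Y where "Y = nat \<lfloor>M ^ 8\<rfloor>"
      define Z where "Z = nat \<lceil>M ^ 4\<rceil>"
      show "\<bar>(LINT \<omega>|P. norm (normalized_sum f g N \<omega>) ^ (2 * s)) - fact s\<bar> \<le> C * \<delta> * ln (real N) powr (3 * real s ^ 2)
        \<or> (\<exists>q::int. q \<noteq> 0 \<and> \<bar>real_of_int q\<bar> \<le> 1 * \<delta> powr (- (real C0 + 1)) \<and>
          smoothness_norm (real N) (smult (real_of_int q) g) \<le> 1 * \<delta> powr (- (real C0 + 1)))"
      proof (cases "\<forall>E U. 1 \<le> E \<longrightarrow> 1 \<le> U \<longrightarrow> E \<le> 2 * Z \<longrightarrow> U * Y \<le> 2 * N \<longrightarrow>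
          real (card (exceptional_box g N R E U)) \<le> real E * real U ^ 2 / R ^ 2")
        case True
        define a where "a = (\<lambda>n. unit_exp (poly g (real n)))"
        define L where "L = (LINT \<omega>|P. norm (normalized_sum f g N \<omega>) ^ (2 * s))"
        have mom: "norm (moment a N s - of_nat (fact s) * of_nat N ^ s)
          \<le> (1 + real s ^ 2 + 39 * real s) * (real s * real s ^ s) * real N ^ s * (((1 + real s) * ln (real N)) ^ (3 * s ^ 2) / R)"
          unfolding a_def
        proof (rule moment_asymptotic[OF s N3 Ms M4 _ RM])
          show "1 \<le> R" using R8 by simp
          show "real (tau j x) \<le> M" if "j \<le> s" "1 \<le> x" "x \<le> N ^ s" for j x
            unfolding M_def by (rule N1[OF NN1 that])
          show "real (card (exceptional_box g N R E U)) \<le> real E * real U ^ 2 / R ^ 2"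
            if "1 \<le> E" "1 \<le> U" "E \<le> 2 * nat \<lceil>M ^ 4\<rceil>" "U * nat \<lfloor>M ^ 8\<rfloor> \<le> 2 * N" for E U
            using True that unfolding Y_def Z_def by blast
        qed
        have NNs: "real N ^ s > 0" using N3 by simp
        have "complex_of_real (L - fact s) = (moment a N s - of_nat (fact s) * of_nat N ^ s) / of_nat N ^ s"
        proof -
          have "complex_of_real L = moment a N s / of_nat N ^ s"
            unfolding L_def a_def using N3 by (intro expectation_eq_moment[OF st]) simp
          moreover have "(of_nat N :: complex) ^ s \<noteq> 0" using N3 by simp
          ultimately show ?thesis by (simp add: diff_divide_distrib)
        qed
        then have "\<bar>L - fact s\<bar> = norm (moment a N s - of_nat (fact s) * of_nat N ^ s) / real N ^ s"
          by (metis norm_divide norm_of_nat norm_of_real norm_power)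
        also have "\<dots> \<le> (1 + real s ^ 2 + 39 * real s) * (real s * real s ^ s) * real N ^ s * (((1 + real s) * ln (real N)) ^ (3 * s ^ 2) / R) / real N ^ s"
          using mom NNs by (intro divide_right_mono) auto
        also have "\<dots> = C * \<delta> * ln (real N) ^ (3 * s ^ 2)"
          using NNs by (simp add: C_def R_def power_mult_distrib)
        also have "ln (real N) ^ (3 * s ^ 2) = ln (real N) powr (3 * real s ^ 2)"
        proof -
          have "ln (real N) > 0" using N3 by simp
          then have "ln (real N) ^ (3 * s ^ 2) = ln (real N) powr real (3 * s ^ 2)" by (rule powr_realpow[symmetric])
          then show ?thesis by simp
        qed
        finally show ?thesis unfolding L_def by blast
      next
        case False
        then obtain E U where EU: "1 \<le> E" "1 \<le> U" "E \<le> 2 * Z" "U * Y \<le> 2 * N"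
          and big: "real (card (exceptional_box g N R E U)) \<ge> real E * real U ^ 2 / R ^ 2"
          by (auto simp: not_le intro: less_imp_le)
        have fit: "R ^ C0 * real E * real U \<le> real N"
        proof -
          have p: "M ^ 8 \<ge> 4" "M ^ 4 \<ge> 4" using power_increasing[of 1 8 M] power_increasing[of 1 4 M] M4 by auto
          have Z: "real Z \<le> 2 * M ^ 4" using p unfolding Z_def by linarith
          have Y: "M ^ 8 / 2 \<le> real Y" using p unfolding Y_def by linarith
          have E: "real E \<le> 2 * real Z" using EU(3) by linarith
          have U: "real U * real Y \<le> 2 * real N" using EU(4) by (metis of_nat_le_iff of_nat_mult of_nat_numeral)
          have "16 * M ^ 5 \<le> M ^ 8"
          proof -
            have "4 * 4 * 4 \<le> M * M * M" using M4 by (intro mult_mono) auto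
            then have "16 * M ^ 5 \<le> (M * M * M) * M ^ 5" using M4 by (intro mult_right_mono) auto
            also have "\<dots> = M ^ 8" by (simp add: eval_nat_numeral)
            finally show ?thesis .
          qed
          then have small: "2 * (M * (2 * (2 * M ^ 4))) \<le> real Y"
            using Y by (simp add: eval_nat_numeral)
          have "R ^ C0 * real E \<le> M * (2 * (2 * M ^ 4))"
            using RCM E Z R8 M0 by (intro mult_mono) auto
          then have "2 * (R ^ C0 * real E) \<le> real Y" using small by linarith
          then have "real U * (2 * (R ^ C0 * real E)) \<le> real U * real Y" by (intro mult_left_mono) auto
          then show ?thesis using U by (simp add: mult_ac)
        qed
        have "R \<ge> 2" using R8 by simp
        from C0[OF this deg EU(1,2) fit big] obtain q where q: "q \<ge> 1" "real q \<le> R ^ C0"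
          and qj: "\<And>j. j \<in> {1..d} \<Longrightarrow> dist_to_int (real q * coeff g j) \<le> R ^ C0 / real N ^ j" by blast
        have "smoothness_norm (real N) (smult (real_of_int (int q)) g) \<le> R ^ C0"
        proof -
          have dq: "degree (smult (real_of_int (int q)) g) = d" using q deg by simp
          have "real N ^ j * dist_to_int (coeff (smult (real_of_int (int q)) g) j) \<le> R ^ C0" if j: "j \<in> {1..d}" for j
          proof -
            have "real N ^ j * dist_to_int (real q * coeff g j) \<le> real N ^ j * (R ^ C0 / real N ^ j)"
              using qj[OF j] by (intro mult_left_mono) auto
            also have "\<dots> = R ^ C0" using N3 by simp
            finally show ?thesis by simp
          qed
          then show ?thesis unfolding smoothness_norm_def dq using d by (subst Max_le_iff) auto
        qed
        then have "\<exists>q::int. q \<noteq> 0 \<and> \<bar>real_of_int q\<bar> \<le> 1 * \<delta> powr (- (real C0 + 1)) \<and>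
          smoothness_norm (real N) (smult (real_of_int q) g) \<le> 1 * \<delta> powr (- (real C0 + 1))"
          using q R\<delta> by (intro exI[of _ "int q"]) auto
        then show ?thesis by blast
      qed
    qed
  qed
  show "\<exists>B>0. \<exists>K>0. \<forall>s\<ge>2. \<exists>c\<^sub>0>0. \<exists>N\<^sub>0. \<exists>C>0.
    \<forall>N\<ge>N\<^sub>0. \<forall>g :: real poly. degree g = d \<longrightarrow>
    (\<forall>(M :: 'a measure) f. steinhaus M f \<longrightarrow>
    (\<forall>\<delta>::real. real N powr (- c\<^sub>0) < \<delta> \<and> \<delta> < 1 / 8 \<longrightarrow>
       \<bar>(LINT \<omega>|M. norm (normalized_sum f g N \<omega>) ^ (2 * s)) - fact s\<bar>
         \<le> C * \<delta> * ln (real N) powr (3 * real s ^ 2)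
     \<or> (\<exists>q::int. q \<noteq> 0 \<and> \<bar>real_of_int q\<bar> \<le> K * \<delta> powr (- B) \<and>
          smoothness_norm (real N) (smult (real_of_int q) g) \<le> K * \<delta> powr (- B))))"
    by (rule exI[of _ "real C0 + 1"], rule conjI, simp, rule exI[of _ 1], rule conjI, simp, intro allI impI, rule main)
qed

end
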